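(* Let $\phi$ be a Drinfeld $A$-module of rank $r$ and $\varphi$ the associated Drinfeld $\mathbb{A}$-module. Then in $\mathbb{F}_q(z_1,\dots,z_n)((\theta^{-1}))$, \[L(\varphi,\mathbb{A}):=\prod_f\frac{[\mathbb{A}/f\mathbb{A}]_{\mathbb{A}}}{[\varphi(\mathbb{A}/f\mathbb{A})]_{\mathbb{A}}}=\sum_{a\in A_+}\frac{\mu(a)a(z_1)\cdots a(z_n)}{a},\] where the product runs over the irreducible $f\in A_+$.
   Context: $A=\mathbb{F}_q[\theta]$, $A_+$ the monic polynomials. A Drinfeld $A$-module of rank $r$ is $\phi:A\to A\{\tau\}$, $\phi_\theta=\theta+\sum_{i=1}^r\phi_{\theta,i}\tau^i$, $\phi_{\theta,i}\in A$, $\phi_{\theta,r}\ne0$ ($\tau a=a^q\tau$). For irreducible $f\in A_+$ of degree $d$, $r_0$ is the largest $i\ge1$ with $\phi_{\theta,i}\not\equiv0\pmod f$ ($0$ if none). If $r_0\ge1$ let $x^{r_0}+p_{r_0-1}x^{r_0-1}+\dots+p_0\in A[x]$ be the characteristic polynomial of Frobenius $\tau^d$ on the $h$-adic Tate module ($h\ne f$) of the reduction of $\phi$ mod $f$; $p_0=c(f)^{-1}f$ with $c(f)\in\mathbb{F}_q^\times$; set $D_f(x)=1+c(f)p_1x+c(f)p_2fx^2+\dots+c(f)p_{r_0-1}f^{r_0-2}x^{r_0-1}+c(f)f^{r_0-1}x^{r_0}$; if $r_0=0$ set $D_f(x)=1$. The function $\mu:A_+\to A$ is the multiplicative function with $\sum_{i\ge0}\mu(f^i)x^i=D_f(x)^{-1}$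 for every irreducible $f\in A_+$. For $a\in A$, $a(z_k)$ denotes $a$ with $\theta$ replaced by $z_k$. $\mathbb{A}=\mathbb{F}_q(z_1,\dots,z_n)[\theta]$ ($z_i$ indeterminates), $\tau$ the $\mathbb{F}_q(z_1,\dots,z_n)$-algebra endomorphism with $\tau(\theta)=\theta^q$, $\ell_0(z)=1$, $\ell_i(z)=\prod_{j=0}^{i-1}(z-\theta^{q^j})$, and $\varphi:\mathbb{A}\to\mathbb{A}\{\tau\}$ is the $\mathbb{F}_q(z_1,\dots,z_n)$-algebra homomorphism with $\varphi_\theta=\sum_{i=0}^r\ell_i(z_1)\cdots\ell_i(z_n)\phi_{\theta,i}\tau^i$ ($\phi_{\theta,0}=\theta$). $\varphi(\mathbb{A}/f\mathbb{A})$ is $\mathbb{A}/f\mathbb{A}$ with $\theta\cdot x=\varphi_\theta(x)$. For a field $k$ and a $k[\theta]$-module $M$ finite-dimensional over $k$, $[M]_{k[\theta]}=\det_{k[X]}(X\,\mathrm{Id}-\theta\mid M\otimes_kk[X])|_{X=\theta}$. *)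

theory Defs
  imports
    "HOL-Analysis.Infinite_Sum"
    "HOL-Computational_Algebra.Formal_Laurent_Series"
    "HOL-Computational_Algebra.Polynomial_FPS"
    "HOL-Library.Cardinality"
    "HOL-Library.Poly_Mapping"
    "HOL-Library.Function_Algebras"
    "HOL-Algebra.Algebraic_Closure_Type"
    "Jordan_Normal_Form.Char_Poly"
begin


text \<open>
  The finite field with \<open>q\<close> elements is a type \<open>'a :: {field, finite}\<close>, with \<open>q = CARD('a)\<close>;
  \<open>A\<close> is \<open>'a poly\<close>, and in every polynomial ring \<open>k[\<theta>]\<close> below the variable \<open>\<theta>\<close> is \<open>[:0, 1:]\<close>.
\<close>

abbreviation theta :: "'k::comm_ring_1 poly" where
  "theta \<equiv> [:0, 1:]"

definition monics :: "'a::field poly set" where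
  "monics = {a. lead_coeff a = 1}"

definition monic_primes :: "'a::field poly set" where
  "monic_primes = {f. lead_coeff f = 1 \<and> Factorial_Ring.irreducible f}"


section \<open>Twisted polynomials and Drinfeld modules\<close>

text \<open>
  A twisted polynomial \<open>\<Sum>\<^sub>i u\<^sub>i \<tau>\<^sup>i\<close> over \<open>R\<close> is represented by its coefficient sequence, as an element of
  \<open>R poly\<close>. Addition is that of \<open>R poly\<close>; multiplication is \<open>tw_mult \<tau>\<close>, determined by
  \<open>\<tau> a = \<tau>(a) \<tau>\<close>. The action on an \<open>R\<close>-algebra with compatible \<open>\<tau>\<close> is \<open>tw_act \<tau>\<close>.
\<close>

definition tw_mult :: "('b::comm_ring_1 \<Rightarrow> 'b) \<Rightarrow> 'b poly \<Rightarrow> 'b poly \<Rightarrow> 'b poly" where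
  "tw_mult \<tau> u v =
     (\<Sum>i\<le>degree u. \<Sum>j\<le>degree v. monom (coeff u i * (\<tau> ^^ i) (coeff v j)) (i + j))"

definition tw_act :: "('b::comm_ring_1 \<Rightarrow> 'b) \<Rightarrow> 'b poly \<Rightarrow> 'b \<Rightarrow> 'b" where
  "tw_act \<tau> u x = (\<Sum>i\<le>degree u. coeff u i * (\<tau> ^^ i) x)"

text \<open>\<open>k\<close>-algebra homomorphisms from \<open>k[\<theta>]\<close> to \<open>k[\<theta>]{\<tau>}\<close>\<close>

definition tw_alg_hom ::
    "('k::field poly \<Rightarrow> 'k poly) \<Rightarrow> ('k poly \<Rightarrow> 'k poly poly) \<Rightarrow> bool" where
  "tw_alg_hom \<tau> \<phi> \<longleftrightarrow>
     (\<forall>c. \<phi> [:c:] = [:[:c:]:]) \<and>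
     (\<forall>a b. \<phi> (a + b) = \<phi> a + \<phi> b) \<and>
     (\<forall>a b. \<phi> (a * b) = tw_mult \<tau> (\<phi> a) (\<phi> b))"

text \<open>A Drinfeld module over \<open>A\<close> of rank \<open>r\<close>; \<open>coeff (\<phi> theta) i\<close> is \<open>\<phi>\<^sub>\<theta>\<^sub>,\<^sub>i\<close>.\<close>

definition drinfeld_module ::
    "nat \<Rightarrow> ('a::{field,finite} poly \<Rightarrow> 'a poly poly) \<Rightarrow> bool" where
  "drinfeld_module r \<phi> \<longleftrightarrow>
     tw_alg_hom (\<lambda>a. a ^ CARD('a)) \<phi> \<and> r \<ge> 1 \<and>
     degree (\<phi> theta) = r \<and> coeff (\<phi> theta) 0 = theta"


section \<open>Reduction modulo a prime and Tate modules\<close>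

text \<open>The rank of the reduction modulo \<open>f\<close>.\<close>

definition red_rank :: "('a::field poly \<Rightarrow> 'a poly poly) \<Rightarrow> 'a poly \<Rightarrow> nat" where
  "red_rank \<phi> f = Max (insert 0 {i. i \<ge> 1 \<and> \<not> f dvd coeff (\<phi> theta) i})"

text \<open>
  An algebraic closure of \<open>A/fA\<close> is the algebraic closure of \<open>'a\<close>, via a root \<open>\<xi>\<close> of \<open>f\<close>:
  the residue class of \<open>\<theta>\<close> is sent to \<open>\<xi>\<close>.
\<close>

definition reduce :: "'a::field alg_closure \<Rightarrow> 'a poly \<Rightarrow> 'a alg_closure" where
  "reduce \<xi> a = poly (map_poly to_ac a) \<xi>"

definition red_act :: "('a::{field,finite} poly \<Rightarrow> 'a poly poly) \<Rightarrow> 'a alg_closure \<Rightarrow>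
    'a poly \<Rightarrow> 'a alg_closure \<Rightarrow> 'a alg_closure" where
  "red_act \<phi> \<xi> a x = tw_act (\<lambda>y. y ^ CARD('a)) (map_poly (reduce \<xi>) (\<phi> a)) x"

text \<open>
  The \<open>h\<close>-adic Tate module: the inverse limit of the \<open>h\<^sup>m\<close>-torsion along multiplication by \<open>h\<close>.
\<close>

definition tate_module :: "('a::{field,finite} poly \<Rightarrow> 'a poly poly) \<Rightarrow> 'a alg_closure \<Rightarrow>
    'a poly \<Rightarrow> (nat \<Rightarrow> 'a alg_closure) set" where
  "tate_module \<phi> \<xi> h = {x. x 0 = 0 \<and> (\<forall>m. red_act \<phi> \<xi> h (x (Suc m)) = x m)}"

text \<open>
  The \<open>h\<close>-adic completion \<open>A\<^sub>h\<close> of \<open>A\<close>, the inverse limit of the rings \<open>A/h\<^sup>mA\<close>, is the quotient of the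
  ring \<open>adic_seqs h\<close> of coherent sequences (a subring of \<open>nat \<Rightarrow> 'a poly\<close> with pointwise operations)
  by its ideal \<open>adic_null h\<close>.
\<close>

definition adic_seqs :: "'a::field poly \<Rightarrow> (nat \<Rightarrow> 'a poly) set" where
  "adic_seqs h = {s. \<forall>m. h ^ m dvd s (Suc m) - s m}"

definition adic_null :: "'a::field poly \<Rightarrow> (nat \<Rightarrow> 'a poly) set" where
  "adic_null h = {s. \<forall>m. h ^ m dvd s m}"

definition tate_smult :: "('a::{field,finite} poly \<Rightarrow> 'a poly poly) \<Rightarrow> 'a alg_closure \<Rightarrow>
    (nat \<Rightarrow> 'a poly) \<Rightarrow> (nat \<Rightarrow> 'a alg_closure) \<Rightarrow> (nat \<Rightarrow> 'a alg_closure)" where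
  "tate_smult \<phi> \<xi> s x = (\<lambda>m. red_act \<phi> \<xi> (s m) (x m))"

definition tate_basis :: "('a::{field,finite} poly \<Rightarrow> 'a poly poly) \<Rightarrow> 'a alg_closure \<Rightarrow>
    'a poly \<Rightarrow> (nat \<Rightarrow> 'a alg_closure) list \<Rightarrow> bool" where
  "tate_basis \<phi> \<xi> h bs \<longleftrightarrow>
     set bs \<subseteq> tate_module \<phi> \<xi> h \<and>
     (\<forall>x\<in>tate_module \<phi> \<xi> h. \<exists>s. (\<forall>i<length bs. s i \<in> adic_seqs h) \<and>
        x = (\<Sum>i<length bs. tate_smult \<phi> \<xi> (s i) (bs ! i))) \<and>
     (\<forall>s. (\<forall>i<length bs. s i \<in> adic_seqs h) \<and>
        (\<Sum>i<length bs. tate_smult \<phi> \<xi> (s i) (bs ! i)) = 0 \<longrightarrow>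
        (\<forall>i<length bs. s i \<in> adic_null h))"

text \<open>
  \<open>P \<in> A[x]\<close> is the characteristic polynomial of \<open>\<tau>\<^sup>d\<close> on the \<open>h\<close>-adic Tate module: \<open>M\<close> is the matrix
  over \<open>A\<^sub>h\<close> of \<open>\<tau>\<^sup>d\<close> in some basis, and \<open>char_poly M\<close> equals \<open>P\<close> in \<open>A\<^sub>h[x]\<close>.
\<close>

definition tate_frob_char_poly :: "('a::{field,finite} poly \<Rightarrow> 'a poly poly) \<Rightarrow>
    'a alg_closure \<Rightarrow> 'a poly \<Rightarrow> nat \<Rightarrow> 'a poly poly \<Rightarrow> bool" where
  "tate_frob_char_poly \<phi> \<xi> h d P \<longleftrightarrow>
     (\<exists>bs M. tate_basis \<phi> \<xi> h bs \<and>
        M \<in> carrier_mat (length bs) (length bs) \<and> elements_mat M \<subseteq> adic_seqs h \<and>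
        (\<forall>j<length bs. (\<lambda>m. (bs ! j) m ^ (CARD('a) ^ d)) =
           (\<Sum>i<length bs. tate_smult \<phi> \<xi> (M $$ (i, j)) (bs ! i))) \<and>
        (\<forall>k. coeff (char_poly M) k - (\<lambda>_. coeff P k) \<in> adic_null h))"

text \<open>It depends neither on the prime \<open>h \<noteq> f\<close> nor on the chosen root \<open>\<xi>\<close> of \<open>f\<close>.\<close>

definition frob_char_poly ::
    "('a::{field,finite} poly \<Rightarrow> 'a poly poly) \<Rightarrow> 'a poly \<Rightarrow> 'a poly poly" where
  "frob_char_poly \<phi> f = (THE P. \<forall>\<xi> h. reduce \<xi> f = 0 \<and> h \<in> monic_primes \<and> h \<noteq> f \<longrightarrow>
     tate_frob_char_poly \<phi> \<xi> h (degree f) P)"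

definition frob_const ::
    "('a::{field,finite} poly \<Rightarrow> 'a poly poly) \<Rightarrow> 'a poly \<Rightarrow> 'a" where
  "frob_const \<phi> f = (THE c. c \<noteq> 0 \<and> coeff (frob_char_poly \<phi> f) 0 = smult (inverse c) f)"

definition local_poly ::
    "('a::{field,finite} poly \<Rightarrow> 'a poly poly) \<Rightarrow> 'a poly \<Rightarrow> 'a poly poly" where
  "local_poly \<phi> f =
     (let r0 = red_rank \<phi> f; p = coeff (frob_char_poly \<phi> f); c = frob_const \<phi> f in
      if r0 = 0 then 1
      else 1 + (\<Sum>i=1..r0 - 1. monom (smult c (p i * f ^ (i - 1))) i)
             + monom (smult c (f ^ (r0 - 1))) r0)"

text \<open>Only the values of \<open>\<mu>\<close> on monic polynomials matter, and these are uniquely determined.\<close>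

definition is_mu ::
    "('a::{field,finite} poly \<Rightarrow> 'a poly poly) \<Rightarrow> ('a poly \<Rightarrow> 'a poly) \<Rightarrow> bool" where
  "is_mu \<phi> \<mu> \<longleftrightarrow>
     \<mu> 1 = 1 \<and>
     (\<forall>a\<in>monics. \<forall>b\<in>monics. coprime a b \<longrightarrow> \<mu> (a * b) = \<mu> a * \<mu> b) \<and>
     (\<forall>f\<in>monic_primes. Abs_fps (\<lambda>i. \<mu> (f ^ i)) * fps_of_poly (local_poly \<phi> f) = 1)"


section \<open>The field of rational functions and the associated module\<close>

definition mpolys_in :: "nat \<Rightarrow> ((nat \<Rightarrow>\<^sub>0 nat) \<Rightarrow>\<^sub>0 'a::field) set" where
  "mpolys_in n = {p. \<forall>e\<in>Poly_Mapping.keys p. Poly_Mapping.keys e \<subseteq> {1..n}}"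

definition mpoly_eval ::
    "('a::field \<Rightarrow> 'k::field) \<Rightarrow> (nat \<Rightarrow> 'k) \<Rightarrow> ((nat \<Rightarrow>\<^sub>0 nat) \<Rightarrow>\<^sub>0 'a) \<Rightarrow> 'k" where
  "mpoly_eval \<iota> z p =
     (\<Sum>e\<in>Poly_Mapping.keys p. \<iota> (Poly_Mapping.lookup p e) *
        (\<Prod>k\<in>Poly_Mapping.keys e. z k ^ Poly_Mapping.lookup e k))"

text \<open>
  The type \<open>'k\<close>, with constants \<open>\<iota>\<close> and variables \<open>z 1, \<dots>, z n\<close>, is the field of rational functions
  in \<open>n\<close> indeterminates over \<open>'a\<close>: the \<open>z k\<close> are algebraically independent over \<open>'a\<close> and every
  element is a quotient of two polynomials in them. It is characterised rather than constructed
  since \<open>n\<close> is a natural number (possibly \<open>0\<close>) and not a type.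
\<close>

definition rational_function_field ::
    "nat \<Rightarrow> ('a::field \<Rightarrow> 'k::field) \<Rightarrow> (nat \<Rightarrow> 'k) \<Rightarrow> bool" where
  "rational_function_field n \<iota> z \<longleftrightarrow>
     field_hom \<iota> \<and>
     inj_on (mpoly_eval \<iota> z) (mpolys_in n) \<and>
     (\<forall>x. \<exists>p\<in>mpolys_in n. \<exists>s\<in>mpolys_in n.
        mpoly_eval \<iota> z s \<noteq> 0 \<and> x = mpoly_eval \<iota> z p / mpoly_eval \<iota> z s)"

text \<open>The \<open>k\<close>-algebra endomorphism of \<open>k[\<theta>]\<close> sending \<open>\<theta>\<close> to \<open>\<theta>\<^sup>q\<close>.\<close>

definition theta_frob :: "nat \<Rightarrow> 'k::field poly \<Rightarrow> 'k poly" where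
  "theta_frob q a = pcompose a (theta ^ q)"

definition ell :: "nat \<Rightarrow> nat \<Rightarrow> 'k::field \<Rightarrow> 'k poly" where
  "ell q i z = (\<Prod>j<i. [:z:] - theta ^ (q ^ j))"

definition associated_module :: "('a::{field,finite} \<Rightarrow> 'k::field) \<Rightarrow> nat \<Rightarrow> (nat \<Rightarrow> 'k) \<Rightarrow> nat \<Rightarrow>
    ('a poly \<Rightarrow> 'a poly poly) \<Rightarrow> ('k poly \<Rightarrow> 'k poly poly) \<Rightarrow> bool" where
  "associated_module \<iota> n z r \<phi> \<Phi> \<longleftrightarrow>
     tw_alg_hom (theta_frob CARD('a)) \<Phi> \<and>
     \<Phi> theta = (\<Sum>i\<le>r. monom
        ((\<Prod>k=1..n. ell CARD('a) i (z k)) * map_poly \<iota> (coeff (\<phi> theta) i)) i)"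


section \<open>The invariant of a finite-dimensional module, and the local factors\<close>

text \<open>
  For a \<open>k[\<theta>]\<close>-module given by a \<open>k\<close>-subspace \<open>V\<close> and the action \<open>T\<close> of \<open>\<theta>\<close> on it, the determinant of
  \<open>X Id - \<theta>\<close>, computed in any basis of \<open>V\<close>. The substitution \<open>X = \<theta>\<close> is the identity on \<open>'k poly\<close>,
  where \<open>X\<close> and \<open>\<theta>\<close> are both \<open>[:0, 1:]\<close>.
\<close>

definition module_char ::
    "('k::field \<Rightarrow> 'v::ab_group_add \<Rightarrow> 'v) \<Rightarrow> 'v set \<Rightarrow> ('v \<Rightarrow> 'v) \<Rightarrow> 'k poly" where
  "module_char scl V T = (THE p. \<exists>bs M.
     distinct bs \<and> \<not> module.dependent scl (set bs) \<and> module.span scl (set bs) = V \<and>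
     M \<in> carrier_mat (length bs) (length bs) \<and>
     (\<forall>j<length bs. T (bs ! j) = (\<Sum>i<length bs. scl (M $$ (i, j)) (bs ! i))) \<and>
     p = char_poly M)"

text \<open>
  The quotient \<open>k[\<theta>]/F\<close> is represented by the remainders modulo \<open>F\<close>. The first definition is for
  its natural module structure, the second for the one in which \<open>\<theta>\<close> acts through \<open>\<Phi> theta\<close>.
\<close>

definition quot_char :: "'k::field poly \<Rightarrow> 'k poly" where
  "quot_char F = module_char smult (range (\<lambda>x. x mod F)) (\<lambda>x. (theta * x) mod F)"

definition tw_quot_char ::
    "('k::field poly \<Rightarrow> 'k poly) \<Rightarrow> ('k poly \<Rightarrow> 'k poly poly) \<Rightarrow> 'k poly \<Rightarrow> 'k poly" where
  "tw_quot_char \<tau> \<Phi> F =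
     module_char smult (range (\<lambda>x. x mod F)) (\<lambda>x. tw_act \<tau> (\<Phi> theta) x mod F)"

text \<open>
  The field \<open>k((\<theta>\<^sup>-\<^sup>1))\<close> is \<open>'k fls\<close>, whose variable \<open>fls_X\<close> stands for \<open>\<theta>\<^sup>-\<^sup>1\<close>; its metric topology is
  the \<open>\<theta>\<^sup>-\<^sup>1\<close>-adic one.
\<close>

definition at_infinity_fls :: "'k::field poly \<Rightarrow> 'k fls" where
  "at_infinity_fls a = poly (map_poly fls_const a) fls_X_inv"

end

theory Submission
  imports Defs
begin

text \<open>
  Fix a prime \<open>f\<close> of degree \<open>d\<close>, a root \<open>\<xi>\<close> of it, and let \<open>S\<close> be the cyclic shift of \<open>d\<close> coordinates
  with \<open>S\<^sup>d = y\<close>. Everything is read off the polynomial \<open>\<Delta>(X, y) = det (X - \<phi>\<^sub>\<theta>(S))\<close>, the coefficients of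
  \<open>\<phi>\<^sub>\<theta>\<close> being evaluated at the conjugates \<open>\<xi>\<^sup>q\<^sup>j\<close> of \<open>\<xi>\<close>.

  Over an extension containing \<open>\<xi>\<close>, the space \<open>\<A>/f\<A>\<close> has the coordinates \<open>x \<mapsto> x(\<xi>\<^sup>q\<^sup>j)\<close>. After rescaling them,
  \<open>\<theta>\<close> acts by \<open>\<phi>\<^sub>\<theta>(S)\<close> with \<open>y = f(z\<^sub>1) \<dots> f(z\<^sub>n)\<close>, so that \<open>[\<phi>(\<A>/f\<A>)] = \<Delta>(\<theta>, f(z\<^sub>1) \<dots> f(z\<^sub>n))\<close>.

  The kernel of \<open>X - \<phi>\<^sub>\<theta>(S)\<close> consists of the solutions \<open>x\<close> of a linear recurrence of order \<open>r\<^sub>0\<close> with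
  \<open>x\<^sub>j\<^sub>+\<^sub>d = y x\<^sub>j\<close>, whence \<open>\<Delta>\<close> is a constant times the characteristic polynomial in \<open>y\<close> of the
  transfer matrix over \<open>d\<close> steps. The Frobenius twists of the Anderson generating function of a
  torsion point satisfy the same recurrence, so they conjugate the transfer matrix into the matrix of \<open>\<tau>\<^sup>d\<close> on the
  Tate module. Thus \<open>\<Delta>\<close> is \<open>c(f)\<close> times the characteristic polynomial of Frobenius, the constant being
  given by \<open>\<Delta>(X, 0) = f\<close>; hence the local factor of the product is \<open>D\<^sub>f(x)\<^sup>-\<^sup>1\<close> at \<open>x = f(z\<^sub>1) \<dots> f(z\<^sub>n)/f\<close>.

  \<open>\<Delta>\<close> has weight at most \<open>r\<^sub>0 d\<close> if \<open>X\<close> has weight \<open>r\<^sub>0\<close> and \<open>y\<close> has weight \<open>d\<close>. Therefore the term of \<open>a\<close> in the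
  sum has valuation at least \<open>deg a / r\<close>, and the Euler product converges by unique factorization.
\<close>

section \<open>Finite fields, their extensions and monic primes\<close>

text \<open>Three obstacles shape the proof. Frobenius on the Tate module is computed over the
  closure of \<open>'a\<close>, whereas the coordinates of \<open>\<A>/f\<A>\<close> live over the
  closure of \<open>'k\<close>; hence the determinant is set up for an arbitrary embedding of the
  finite field and carried from one closure to the other. The ring \<open>A_h\<close> is present
  only through coherent sequences, and the characteristic polynomial of Frobenius only through a
  definite description. Everything about Tate modules is therefore proved at level \<open>m\<close>,
  modulo \<open>h ^ m\<close>, where the elements are torsion points in a field. Letting
  \<open>m\<close> grow gives rationality over the finite field, uniqueness, and independence of
  \<open>h\<close>. The Anderson generating function is what makes this comparison possible: it
  turns the action of \<open>A\<close> on torsion into multiplication modulo \<open>h ^ m\<close>,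
  so that the transfer matrix and the matrix of Frobenius can be compared in one polynomial ring.
  Finally, \<open>r_0\<close> varies with \<open>f\<close>, while convergence needs a bound that is
  uniform in \<open>f\<close>; the weight estimate is weakened from \<open>r_0\<close> to
  \<open>r\<close> for this purpose.\<close>

lemma finite_field_pow_card: "a ^ CARD('a) = (a :: 'a :: {field,finite})"
proof (cases "a = 0")
  case False
  have bij: "bij_betw (\<lambda>x. a * x) (UNIV - {0}) (UNIV - {0})"
    by (rule bij_betwI[where g = "\<lambda>x. x / a"]) (use False in auto)
  have "(\<Prod>x\<in>UNIV - {0::'a}. x) = (\<Prod>x\<in>UNIV - {0::'a}. a * x)"
    using prod.reindex_bij_betw[OF bij, of "\<lambda>x. x"] by simp
  also have "\<dots> = a ^ (CARD('a) - 1) * (\<Prod>x\<in>UNIV - {0::'a}. x)"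
    by (simp add: prod.distrib card_Diff_singleton)
  finally have "a ^ (CARD('a) - 1) = 1" by simp
  moreover have "CARD('a) = Suc (CARD('a) - 1)"
    using finite_UNIV_card_ge_0[where ?'a = 'a] by simp
  ultimately show ?thesis by (metis mult.right_neutral power_Suc)
qed auto

lemma card_field_gt_1: "CARD('a :: {field,finite}) > 1"
proof -
  have "card {0, 1 :: 'a} \<le> CARD('a)" by (rule card_mono) auto
  then show ?thesis by simp
qed

text \<open>The polynomial \<open>(X + 1)\<^sup>q - X\<^sup>q - 1\<close> has degree less than \<open>q\<close> but vanishes on the whole field.\<close>

lemma of_nat_card_choose_eq_0:
  assumes "0 < i" "i < CARD('a :: {field,finite})"
  shows "of_nat (CARD('a) choose i) = (0 :: 'a)"
proof -
  define q where "q = CARD('a)"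
  define P where "P = (\<Sum>i\<in>{0<..<q}. monom (of_nat (q choose i) :: 'a) i)"
  have "poly P a = 0" for a :: 'a
  proof -
    have "(a + 1) ^ q = (\<Sum>i\<le>q. of_nat (q choose i) * a ^ i * 1 ^ (q - i))"
      by (rule binomial_ring)
    also have "{..q} = insert 0 (insert q {0<..<q})" using card_field_gt_1[where ?'a = 'a]
      by (auto simp: q_def)
    also have "(\<Sum>i\<in>\<dots>. of_nat (q choose i) * a ^ i * 1 ^ (q - i)) = 1 + a ^ q + poly P a"
      using card_field_gt_1[where ?'a = 'a] by (simp add: P_def poly_sum poly_monom q_def)
    finally show ?thesis
      using finite_field_pow_card[of a] finite_field_pow_card[of "a + 1"] by (simp add: q_def)
  qed
  moreover have "degree P < q"
    unfolding P_def using card_field_gt_1[where ?'a = 'a]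
    by (intro degree_sum_less) (auto intro: le_less_trans[OF degree_monom_le] simp: q_def)
  ultimately have "P = 0"
    using card_poly_roots_bound[of P] by (fastforce simp: q_def)
  then have "coeff P i = 0" by simp
  then show ?thesis using assms
    by (simp add: P_def coeff_sum q_def if_distrib cong: if_cong)
qed

section \<open>Bezout identities and primes in polynomial rings over a field\<close>

lemma field_poly_bezout:
  fixes a b :: "'b :: field poly"
  obtains u v where "u * a + v * b dvd a" "u * a + v * b dvd b"
proof -
  have "\<exists>u v. u * a + v * b dvd a \<and> u * a + v * b dvd b"
  \<comment> \<open>The measure puts the zero polynomial strictly below the nonzero constants, which
    have the same \<open>degree\<close>.\<close>
  proof (induction "if b = 0 then 0 else Suc (degree b)" arbitrary: a b rule: less_induct)
    case less
    show ?case
    proof (cases "b = 0")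
      case True
      then have "1 * a + 0 * b dvd a \<and> 1 * a + 0 * b dvd b" by simp
      then show ?thesis by blast
    next
      case False
      then have "(if a mod b = 0 then 0 else Suc (degree (a mod b))) < (if b = 0 then 0 else Suc (degree b))"
        using degree_mod_less[of b a] by auto
      from less[OF this] obtain u v where
        uv: "u * b + v * (a mod b) dvd b" "u * b + v * (a mod b) dvd a mod b" by blast
      have "u * b + v * (a mod b) dvd a" using uv by (simp add: dvd_mod_iff)
      moreover have "u * b + v * (a mod b) = v * a + (u - v * (a div b)) * b"
        by (simp add: algebra_simps flip: minus_mult_div_eq_mod)
      ultimately show ?thesis using uv(1) by metis
    qed
  qed
  then show ?thesis using that by blast
qed

lemma field_poly_coprime_bezout:
  fixes a b :: "'b :: field poly"
  assumes "coprime a b"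
  obtains u v where "u * a + v * b = 1"
proof -
  obtain u v where "u * a + v * b dvd a" "u * a + v * b dvd b" by (rule field_poly_bezout)
  then have "u * a + v * b dvd 1" using assms by (rule coprime_common_divisor[rotated])
  then obtain w where "1 = (u * a + v * b) * w" by (rule dvdE)
  then have "(w * u) * a + (w * v) * b = 1" by (simp add: algebra_simps)
  then show ?thesis using that by blast
qed

lemma field_poly_irreducible_coprime:
  fixes f a :: "'b :: field poly"
  assumes "Factorial_Ring.irreducible f" "\<not> f dvd a"
  shows "coprime f a"
proof (rule coprimeI)
  fix g assume g: "g dvd f" "g dvd a"
  from g(1) obtain h where h: "f = g * h" by (rule dvdE)
  show "is_unit g"
  proof (rule ccontr)
    assume "\<not> is_unit g"
    then have "is_unit h" using Factorial_Ring.irreducibleD[OF assms(1) h] by blast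
    then have "f dvd g" using h by (simp add: mult_unit_dvd_iff)
    then show False using g(2) assms(2) dvd_trans by blast
  qed
qed

lemma field_poly_irreducible_prime_elem:
  fixes f :: "'b :: field poly"
  assumes "Factorial_Ring.irreducible f"
  shows "prime_elem f"
proof (rule prime_elemI)
  fix a b assume ab: "f dvd a * b"
  show "f dvd a \<or> f dvd b"
  proof (rule disjCI)
    assume "\<not> f dvd b"
    then obtain u v where "u * f + v * b = 1"
      using field_poly_coprime_bezout[OF field_poly_irreducible_coprime[OF assms]] by blast
    then have "a = a * (u * f + v * b)" by simp
    also have "\<dots> = f * (a * u) + (a * b) * v" by (simp add: algebra_simps)
    finally show "f dvd a" using ab by (metis dvd_add dvd_mult2 dvd_triv_left)
  qed
qed (use assms in \<open>auto simp: Factorial_Ring.irreducible_def\<close>)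

lemma monic_primes_prime: "f \<in> monic_primes \<Longrightarrow> prime_elem f"
  by (simp add: monic_primes_def field_poly_irreducible_prime_elem)

lemma monic_prime_nz: "f \<in> monic_primes \<Longrightarrow> f \<noteq> 0"
  by (auto simp: monic_primes_def)

lemma degree_monic_prime: "f \<in> monic_primes \<Longrightarrow> degree f > 0"
  by (auto simp: monic_primes_def Factorial_Ring.irreducible_def is_unit_iff_degree intro: gr0I)

lemma monic_primes_dvd_eq:
  assumes "f \<in> monic_primes" "g \<in> monic_primes" "f dvd g"
  shows "f = g"
proof -
  obtain u where u: "g = f * u" using assms(3) by (rule dvdE)
  have "is_unit u"
    using Factorial_Ring.irreducibleD[OF _ u] assms degree_monic_prime[OF assms(1)]
    by (auto simp: monic_primes_def is_unit_iff_degree)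
  then obtain c where "u = [:c:]" by (meson is_unit_poly_iff)
  moreover have "lead_coeff g = lead_coeff f * lead_coeff u" unfolding u by (rule lead_coeff_mult)
  ultimately have "u = 1" using assms by (simp add: monic_primes_def one_pCons)
  then show ?thesis using u by simp
qed

text \<open>Instantiated twice: with the closure of \<open>'a\<close>, where torsion points live,
  and with the closure of \<open>'k\<close>, where the quotient \<open>\<A>/f\<A>\<close> gets its
  coordinates.\<close>

locale fq_hom = field_hom \<iota> for \<iota> :: "'a::{field,finite} \<Rightarrow> 'l::field" +
  fixes q :: nat
  assumes q_def: "q = CARD('a)"
begin

lemma q_gt_1: "q > 1" using card_field_gt_1[where ?'a = 'a] by (simp add: q_def)

lemma q_pos [simp]: "q > 0" using q_gt_1 by simp

lemma hom_pow_q [simp]: "\<iota> a ^ q = \<iota> a"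
  by (metis finite_field_pow_card hom_power q_def)

lemma add_pow_q: "((x :: 'l) + y) ^ q = x ^ q + y ^ q"
proof -
  have "(x + y) ^ q = (\<Sum>i\<le>q. of_nat (q choose i) * x ^ i * y ^ (q - i))"
    by (rule binomial_ring)
  also have "\<dots> = (\<Sum>i\<in>{0, q}. of_nat (q choose i) * x ^ i * y ^ (q - i))"
  proof (intro sum.mono_neutral_right ballI)
    fix i assume "i \<in> {..q} - {0, q}"
    then have "of_nat (q choose i) = (0 :: 'a)" unfolding q_def by (intro of_nat_card_choose_eq_0) auto
    then have "\<iota> (of_nat (q choose i)) = 0" by simp
    then show "of_nat (q choose i) * x ^ i * y ^ (q - i) = 0"
      by (simp add: hom_of_nat)
  qed auto
  finally show ?thesis using q_pos by (simp add: add.commute)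
qed

lemma field_hom_frob: "field_hom (\<lambda>x :: 'l. x ^ q)"
  by unfold_locales (use q_pos in \<open>auto simp: add_pow_q power_mult_distrib\<close>)

lemma field_hom_frob_pow: "field_hom (\<lambda>x :: 'l. x ^ (q ^ n))"
proof (induction n)
  case (Suc n)
  interpret A: field_hom "\<lambda>x :: 'l. x ^ (q ^ n)" by fact
  interpret B: field_hom "\<lambda>x :: 'l. x ^ q" by (rule field_hom_frob)
  show ?case
    by unfold_locales (auto simp: power_mult A.hom_add B.hom_add power_mult_distrib mult.commute[of q])
qed (unfold_locales, auto)

lemma hom_pow_q_pow [simp]: "\<iota> a ^ (q ^ n) = \<iota> a"
  by (induction n) (auto simp: power_mult mult.commute[of q])

definition ev :: "'l \<Rightarrow> 'a poly \<Rightarrow> 'l" where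
  "ev \<xi> a = poly (map_poly \<iota> a) \<xi>"

sublocale mp: map_poly_inj_idom_hom \<iota> ..

lemma ev_hom: "comm_ring_hom (ev \<xi>)"
  by unfold_locales (auto simp: ev_def hom_distribs)

lemma ev_simps [simp]: "ev \<xi> 0 = 0" "ev \<xi> 1 = 1" "ev \<xi> (a + b) = ev \<xi> a + ev \<xi> b"
  "ev \<xi> (a * b) = ev \<xi> a * ev \<xi> b" "ev \<xi> (a - b) = ev \<xi> a - ev \<xi> b" "ev \<xi> (- a) = - ev \<xi> a"
  "ev \<xi> (a ^ n) = ev \<xi> a ^ n" "ev \<xi> [:0, 1:] = \<xi>" "ev \<xi> [:c:] = \<iota> c" "ev \<xi> (smult c a) = \<iota> c * ev \<xi> a"
  by (auto simp: ev_def hom_distribs)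

lemma ev_pow_q_pow: "ev \<xi> a ^ (q ^ n) = ev (\<xi> ^ (q ^ n)) a"
proof -
  interpret F: field_hom "\<lambda>x :: 'l. x ^ (q ^ n)" by (rule field_hom_frob_pow)
  have "map_poly (\<lambda>x. x ^ (q ^ n)) (map_poly \<iota> a) = map_poly \<iota> a"
    by (rule poly_eqI) (simp add: coeff_map_poly)
  then show ?thesis unfolding ev_def by (metis F.poly_map_poly)
qed

lemma frob_pow_inj: "(x :: 'l) ^ (q ^ n) = y ^ (q ^ n) \<longleftrightarrow> x = y"
proof -
  interpret F: field_hom "\<lambda>x :: 'l. x ^ (q ^ n)" by (rule field_hom_frob_pow)
  show ?thesis by (rule F.eq_iff)
qed

lemma card_degree_less:
  assumes "n > 0"
  shows "card {a :: 'a poly. degree a < n} = q ^ n"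
proof -
  have "bij_betw (\<lambda>xs. Poly xs) {xs :: 'a list. length xs = n} {a. degree a < n}"
  proof (rule bij_betwI[where g = "\<lambda>a. map (coeff a) [0..<n]"])
    show "Poly \<in> {xs :: 'a list. length xs = n} \<rightarrow> {a. degree a < n}"
    proof (rule Pi_I, unfold mem_Collect_eq)
      fix xs :: "'a list" assume "length xs = n"
      then show "degree (Poly xs) < n" using assms by (intro degree_lessI) (auto simp: nth_default_def)
    qed
    show "Poly (map (coeff a) [0..<n]) = a" if "a \<in> {a. degree a < n}" for a
      by (rule poly_eqI) (use that in \<open>auto simp: nth_default_def coeff_eq_0\<close>)
    show "map (coeff (Poly xs)) [0..<n] = xs" if "xs \<in> {xs. length xs = n}" for xs :: "'a list"
      by (rule nth_equalityI) (use that in \<open>auto simp: nth_default_def\<close>)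
  qed auto
  then show ?thesis
    using card_lists_length_eq[of "UNIV :: 'a set" "n"] by (simp add: q_def bij_betw_same_card)
qed

section \<open>The Frobenius conjugates of a root of a prime\<close>

context
  fixes f :: "'a poly" and \<xi> :: 'l
  assumes f: "f \<in> monic_primes" and root: "ev \<xi> f = 0"
begin

lemma ev_eq_0_iff: "ev \<xi> a = 0 \<longleftrightarrow> f dvd a"
proof
  assume "f dvd a" then show "ev \<xi> a = 0" using root by auto
next
  assume a: "ev \<xi> a = 0"
  show "f dvd a"
  proof (rule ccontr)
    assume "\<not> f dvd a"
    then have "coprime f a" using f by (simp add: monic_primes_def field_poly_irreducible_coprime)
    then obtain u v where "u * f + v * a = 1" by (rule field_poly_coprime_bezout)
    then have "ev \<xi> (u * f + v * a) = 1" by simp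
    then show False using a root by simp
  qed
qed

lemma ev_inj_on: "inj_on (ev \<xi>) {a. degree a < degree f}"
proof (rule inj_onI)
  fix a b assume "a \<in> {a. degree a < degree f}" "b \<in> {a. degree a < degree f}" and "ev \<xi> a = ev \<xi> b"
  then have "f dvd a - b" "degree (a - b) < degree f" using ev_eq_0_iff[of "a - b"]
    by (auto intro: degree_diff_less)
  then show "a = b" by (metis dvd_imp_degree_le eq_iff_diff_eq_0 leD)
qed

lemma root_conj: "ev (\<xi> ^ (q ^ j)) f = 0"
  using root ev_pow_q_pow[of \<xi> f j] by (simp add: zero_power)

text \<open>If the \<open>q ^ m\<close>-th power fixes \<open>\<xi>\<close>, it fixes every
  \<open>ev \<xi> a\<close>; these are \<open>q ^ degree f\<close> distinct roots of a polynomial of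
  degree \<open>q ^ m\<close>.\<close>

lemma frob_period_ge:
  assumes "m > 0" "\<xi> ^ (q ^ m) = \<xi>"
  shows "degree f \<le> m"
proof -
  define Q where "Q = monom (1::'l) (q ^ m) - monom 1 1"
  have qm: "q ^ m > 1" using q_gt_1 assms(1) by (intro one_less_power)
  then have "coeff Q (q ^ m) = 1" by (simp add: Q_def)
  then have Q: "Q \<noteq> 0" by auto
  have deg: "degree Q \<le> q ^ m"
    unfolding Q_def by (intro degree_diff_le) (use qm in \<open>auto simp: degree_monom_eq\<close>)
  have "poly Q (ev \<xi> a) = 0" for a
    by (simp only: Q_def poly_diff poly_monom mult_1 ev_pow_q_pow assms(2) power_one_right diff_self)
  then have "ev \<xi> ` {a. degree a < degree f} \<subseteq> {x. poly Q x = 0}" by blast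
  then have "card (ev \<xi> ` {a. degree a < degree f}) \<le> card {x. poly Q x = 0}"
    by (intro card_mono poly_roots_finite Q)
  also have "\<dots> \<le> degree Q" by (rule card_poly_roots_bound[OF Q])
  also note deg
  finally have "q ^ degree f \<le> q ^ m"
    by (simp only: card_image[OF ev_inj_on] card_degree_less[OF degree_monic_prime[OF f]])
  then show ?thesis using power_le_imp_le_exp[OF q_gt_1] by blast
qed

lemma conj_distinct:
  assumes "i < j" "j < degree f"
  shows "\<xi> ^ (q ^ i) \<noteq> \<xi> ^ (q ^ j)"
proof
  assume eq: "\<xi> ^ (q ^ i) = \<xi> ^ (q ^ j)"
  have "(\<xi> ^ (q ^ (j - i))) ^ (q ^ i) = \<xi> ^ (q ^ j)"
    using assms(1) by (simp flip: power_mult power_add)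
  then have "\<xi> ^ (q ^ (j - i)) = \<xi>" by (metis eq frob_pow_inj)
  then have "degree f \<le> j - i" using assms(1) by (intro frob_period_ge) auto
  then show False using assms by linarith
qed

lemma inj_on_conj: "inj_on (\<lambda>j. \<xi> ^ (q ^ j)) {..<degree f}"
  by (rule linorder_inj_onI) (use conj_distinct in auto)

lemma map_poly_eq_prod_conj: "map_poly \<iota> f = (\<Prod>j<degree f. [:- (\<xi> ^ (q ^ j)), 1:])"
proof (rule poly_eqI_degree_lead_coeff[where n = "degree f" and A = "(\<lambda>j. \<xi> ^ (q ^ j)) ` {..<degree f}"])
  have deg: "degree (\<Prod>j<degree f. [:- (\<xi> ^ (q ^ j)), 1:]) = degree f"
    by (subst degree_prod_eq_sum_degree) auto
  show "degree (\<Prod>j<degree f. [:- (\<xi> ^ (q ^ j)), 1:]) \<le> degree f" using deg by simp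
  have "lead_coeff (\<Prod>j<degree f. [:- (\<xi> ^ (q ^ j)), 1:]) = 1"
    by (simp add: lead_coeff_prod)
  then show "coeff (map_poly \<iota> f) (degree f) = coeff (\<Prod>j<degree f. [:- (\<xi> ^ (q ^ j)), 1:]) (degree f)"
    using deg f by (simp add: monic_primes_def)
  show "degree f \<le> card ((\<lambda>j. \<xi> ^ (q ^ j)) ` {..<degree f})" by (simp add: card_image[OF inj_on_conj])
  show "poly (map_poly \<iota> f) x = poly (\<Prod>j<degree f. [:- (\<xi> ^ (q ^ j)), 1:]) x"
    if "x \<in> (\<lambda>j. \<xi> ^ (q ^ j)) ` {..<degree f}" for x
  proof -
    from that obtain j where j: "j < degree f" "x = \<xi> ^ (q ^ j)" by blast
    then have "poly (map_poly \<iota> f) x = 0" using root_conj[of j] by (simp add: ev_def)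
    moreover have "poly (\<Prod>j<degree f. [:- (\<xi> ^ (q ^ j)), 1:]) x = 0"
      unfolding poly_prod by (rule prod_zero) (use j in auto)
    ultimately show ?thesis by simp
  qed
  show "degree (map_poly \<iota> f) \<le> degree f" by (rule degree_map_poly_le)
qed

text \<open>The power on the left is again a root of \<open>f\<close>, hence one of the conjugates;
  any index other than 0 would give a period shorter than \<open>frob_period_ge\<close>
  permits.\<close>

lemma frob_period: "\<xi> ^ (q ^ degree f) = \<xi>"
proof -
  have "poly (map_poly \<iota> f) (\<xi> ^ (q ^ degree f)) = 0" using root_conj by (simp add: ev_def)
  then obtain j where j: "j < degree f" "\<xi> ^ (q ^ degree f) = \<xi> ^ (q ^ j)"
    by (auto simp: map_poly_eq_prod_conj poly_prod)
  have "(\<xi> ^ (q ^ (degree f - j))) ^ (q ^ j) = \<xi> ^ (q ^ degree f)"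
    using j by (simp flip: power_mult power_add)
  then have "\<xi> ^ (q ^ (degree f - j)) = \<xi>" using j frob_pow_inj by metis
  then have "degree f \<le> degree f - j" using j(1) by (intro frob_period_ge) auto
  then have "j = 0" using j(1) by linarith
  then show ?thesis using j(2) by (simp only: power_0 power_one_right)
qed

end

end

section \<open>Cyclic recurrences\<close>

lemma mat_mult_mat:
  "mat n m A * mat m k B = mat n k (\<lambda>(i, j). \<Sum>l<m. A (i, l) * B (l, j))"
  by (rule eq_matI) (auto simp: scalar_prod_def atLeast0LessThan intro!: sum.cong)

lemma det_mat_lower_triangular:
  assumes "\<And>i j. i < j \<Longrightarrow> j < n \<Longrightarrow> A (i, j) = 0"
  shows "det (mat n n A) = (\<Prod>i<n. A (i, i))"
proof -
  have "det (mat n n A) = prod_list (diag_mat (mat n n A))"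
    by (rule det_lower_triangular[of n]) (use assms in auto)
  also have "\<dots> = (\<Prod>i<n. A (i, i))"
    by (auto simp: diag_mat_def prod.distinct_set_conv_list[symmetric] atLeast0LessThan intro!: prod.cong)
  finally show ?thesis .
qed

lemma det_mat_block_upper:
  fixes A :: "nat \<times> nat \<Rightarrow> 'r :: idom"
  assumes "\<And>i j. n \<le> i \<Longrightarrow> i < n + m \<Longrightarrow> j < n \<Longrightarrow> A (i, j) = 0"
  shows "det (mat (n + m) (n + m) A) =
    det (mat n n A) * det (mat m m (\<lambda>(i, j). A (n + i, n + j)))"
proof -
  have "mat (n + m) (n + m) A = four_block_mat (mat n n A) (mat n m (\<lambda>(i, j). A (i, n + j)))
      (0\<^sub>m m n) (mat m m (\<lambda>(i, j). A (n + i, n + j)))"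
    by (rule eq_matI) (use assms in auto)
  moreover have "det \<dots> = det (mat n n A) * det (mat m m (\<lambda>(i, j). A (n + i, n + j)))"
    by (rule det_four_block_mat_lower_left_zero) auto
  ultimately show ?thesis by simp
qed

text \<open>The determinant of the operator whose row \<open>j\<close> is the sum of
  \<open>p j s * S ^ s\<close>, where \<open>S\<close> is the cyclic shift with
  \<open>S ^ d = y\<close>: moving from \<open>j\<close> by \<open>s\<close> steps ends at
  \<open>(j + s) mod d\<close>, and each passage through the end costs a factor
  \<open>y\<close>.\<close>

definition cyc_det :: "nat \<Rightarrow> nat \<Rightarrow> (nat \<Rightarrow> nat \<Rightarrow> 'r) \<Rightarrow> 'r \<Rightarrow> 'r :: comm_ring_1" where
  "cyc_det d r p y =
     det (mat d d (\<lambda>(j, c). \<Sum>s\<le>r. if (j + s) mod d = c then p j s * y ^ ((j + s) div d) else 0))"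

text \<open>
  The \<open>d\<close> recurrence relations \<open>\<Sum>\<^sub>s p j s x (j + s) = 0\<close> and the \<open>r\<close> boundary conditions
  \<open>x (d + i) = y x i\<close> form a square linear system in \<open>x 0, \<dots>, x (d + r - 1)\<close>. Eliminating all but the
  first \<open>d\<close> unknowns by the boundary conditions gives the left-hand side, eliminating all but
  the first \<open>r\<close> unknowns by the recurrence gives the right-hand side.
\<close>

theorem det_cyclic_recurrence:
  fixes p g :: "nat \<Rightarrow> nat \<Rightarrow> 'r :: idom" and y :: 'r
  assumes d: "d > 0"
    and init: "\<And>c n. c < r \<Longrightarrow> n < r \<Longrightarrow> g c n = (if n = c then 1 else 0)"
    and rec: "\<And>c j. c < r \<Longrightarrow> j < d \<Longrightarrow> (\<Sum>s\<le>r. p j s * g c (j + s)) = 0"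
  shows "\<exists>\<epsilon>. \<epsilon> * \<epsilon> = 1 \<and> cyc_det d r p y =
    \<epsilon> * (\<Prod>j<d. p j r) * det (mat r r (\<lambda>(i, c). (if i = c then y else 0) - g c (d + i)))"
proof -
  define Z where "Z = (\<lambda>(i, c). if i < d then (\<Sum>s\<le>r. if i + s = c then p i s else 0)
    else (if c = i then - 1 else 0) + (if c + d = i then y else 0))"
  \<comment> \<open>\<open>Q1\<close> and \<open>Q2\<close> are lower triangular with unit diagonal,
    so multiplying by them preserves the determinant. The first \<open>d\<close> columns of
    \<open>Q1\<close> satisfy the boundary conditions, the first \<open>r\<close> columns of
    \<open>Q2\<close> satisfy the recurrence; the corresponding blocks of the products
    vanish.\<close>
  define Q1 where "Q1 = (\<lambda>(c, j). if j < d then (if c mod d = j then y ^ (c div d) else 0)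
    else (if c = j then 1 else 0))"
  define Q2 where "Q2 = (\<lambda>(c, j). if j < r then g j c else (if c = j then 1 else 0))"
  define N where "N = (\<lambda>(j, c). \<Sum>s\<le>r. if (j + s) mod d = c then p j s * y ^ ((j + s) div d) else 0)"
  define M where "M = (\<lambda>(i, c). (if i = c then y else 0) - g c (d + i))"
  have Z1: "(\<Sum>l<d+r. Z (i, l) * x l) = (\<Sum>s\<le>r. p i s * x (i + s))" if "i < d" for i x
  proof -
    have "(\<Sum>l<d+r. Z (i, l) * x l) = (\<Sum>l<d+r. \<Sum>s\<le>r. if i + s = l then p i s * x l else 0)"
      using that by (auto simp: Z_def sum_distrib_right intro!: sum.cong)
    also have "\<dots> = (\<Sum>s\<le>r. \<Sum>l<d+r. if i + s = l then p i s * x l else 0)"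
      by (rule sum.swap)
    also have "\<dots> = (\<Sum>s\<le>r. p i s * x (i + s))" using that by (intro sum.cong) auto
    finally show ?thesis .
  qed
  have Z2: "(\<Sum>l<d+r. Z (i, l) * x l) = - x i + y * x (i - d)" if "d \<le> i" "i < d + r" for i x
  proof -
    have "(\<Sum>l<d+r. Z (i, l) * x l) =
        (\<Sum>l<d+r. (if l = i then - x i else 0) + (if l = i - d then y * x (i - d) else 0))"
      using that d by (intro sum.cong) (auto simp: Z_def algebra_simps)
    also have "\<dots> = - x i + y * x (i - d)" using that by (simp add: sum.distrib)
    finally show ?thesis .
  qed
  have ZQ1: "det (mat (d+r) (d+r) Z) = det (mat d d N) * (-1) ^ r"
  proof -
    define C where "C = (\<lambda>(i, j). \<Sum>l<d+r. Z (i, l) * Q1 (l, j))"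
    have "det (mat (d+r) (d+r) Q1) = 1"
      by (subst det_mat_lower_triangular) (auto simp: Q1_def intro!: prod.neutral)
    then have "det (mat (d+r) (d+r) Z) = det (mat (d+r) (d+r) C)"
      unfolding C_def by (subst mat_mult_mat[symmetric], subst det_mult[of _ "d+r"]) auto
    also have "\<dots> = det (mat d d C) * det (mat r r (\<lambda>(i, j). C (d + i, d + j)))"
    proof (rule det_mat_block_upper)
      fix i j assume ij: "d \<le> i" "i < d + r" "j < d"
      then obtain k where k: "i = d + k" by (metis le_Suc_ex)
      show "C (i, j) = 0" unfolding C_def using ij d by (simp add: Z2 Q1_def k)
    qed
    also have "mat d d C = mat d d N"
      by (rule eq_matI) (auto simp: C_def N_def Z1 Q1_def intro!: sum.cong)
    also have "det (mat r r (\<lambda>(i, j). C (d + i, d + j))) = (-1) ^ r"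
      by (subst det_mat_lower_triangular) (use d in \<open>auto simp: C_def Z2 Q1_def\<close>)
    finally show ?thesis .
  qed
  have ZQ2: "\<exists>\<epsilon>. \<epsilon> * \<epsilon> = 1 \<and> det (mat (d+r) (d+r) Z) = \<epsilon> * (det (mat r r M) * (\<Prod>j<d. p j r))"
  proof -
    define C where "C = (\<lambda>(i, j). \<Sum>l<d+r. Z (i, l) * Q2 (l, j))"
    define C' where "C' = (\<lambda>(i, j). C (if i < r then i + d else i - r, j))"
    have "det (mat (d+r) (d+r) Q2) = 1"
      by (subst det_mat_lower_triangular) (auto simp: Q2_def init intro!: prod.neutral)
    then have "det (mat (d+r) (d+r) Z) = det (mat (d+r) (d+r) C)"
      unfolding C_def by (subst mat_mult_mat[symmetric], subst det_mult[of _ "d+r"]) auto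
    \<comment> \<open>Here the vanishing block is at the upper left. Moving the \<open>r\<close>
      boundary rows to the top makes the matrix block triangular; the resulting sign is not tracked
      further, since it is later absorbed in a constant that is determined by normalisation.\<close>
    also have "\<dots> = (-1) ^ (r * d) * det (mat (r+d) (r+d) C')"
    proof -
      have "mat (r+d) (r+d) (\<lambda>(i, j). mat (d+r) (d+r) C $$ (if i < r then i + d else i - r, j)) =
          mat (r+d) (r+d) C'"
        by (rule eq_matI) (auto simp: C'_def)
      then show ?thesis using det_swap_rows[of "mat (d+r) (d+r) C" r d] by (simp add: add.commute)
    qed
    also have "det (mat (r+d) (r+d) C') =
        det (mat r r C') * det (mat d d (\<lambda>(i, j). C' (r + i, r + j)))"
    proof (rule det_mat_block_upper)
      fix i j assume ij: "r \<le> i" "i < r + d" "j < r"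
      then obtain k where k: "i = r + k" "k < d" by (metis le_Suc_ex nat_add_left_cancel_less)
      show "C' (i, j) = 0" using ij k by (simp add: C'_def C_def Z1 Q2_def rec)
    qed
    also have "mat r r C' = mat r r M"
      by (rule eq_matI) (auto simp: C'_def C_def Z2 Q2_def M_def init add.commute)
    also have "det (mat d d (\<lambda>(i, j). C' (r + i, r + j))) = (\<Prod>j<d. p j r)"
    proof (subst det_mat_lower_triangular)
      show "(case (i, j) of (i, j) \<Rightarrow> C' (r + i, r + j)) = 0" if "i < j" "j < d" for i j
        using that by (auto simp: C'_def C_def Z1 Q2_def intro!: sum.neutral)
      have "(\<Sum>s\<le>r. p i s * (if i + s = r + i then 1 else 0)) = p i r" for i
      proof -
        have "(\<Sum>s\<le>r. p i s * (if i + s = r + i then 1 else 0)) = (\<Sum>s\<le>r. if s = r then p i s else 0)"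
          by (intro sum.cong) auto
        then show ?thesis by simp
      qed
      then show "(\<Prod>i<d. case (i, i) of (i, j) \<Rightarrow> C' (r + i, r + j)) = (\<Prod>j<d. p j r)"
        by (auto simp: C'_def C_def Z1 Q2_def intro!: prod.cong)
    qed
    finally show ?thesis
      by (intro exI[of _ "(-1) ^ (r * d)"]) (auto simp flip: power_mult_distrib)
  qed
  then obtain \<epsilon> where \<epsilon>: "\<epsilon> * \<epsilon> = 1" "det (mat (d+r) (d+r) Z) = \<epsilon> * (det (mat r r M) * (\<Prod>j<d. p j r))"
    by blast
  have sq: "(-1) ^ r * (-1) ^ r = (1 :: 'r)" by (simp flip: power_mult_distrib)
  have "det (mat d d N) = (det (mat d d N) * (-1) ^ r) * (-1) ^ r"
    using sq by (simp add: mult.assoc)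
  also have "\<dots> = ((-1) ^ r * \<epsilon>) * (\<Prod>j<d. p j r) * det (mat r r M)"
    by (simp flip: ZQ1 add: \<epsilon>(2))
  finally have "det (mat d d N) = ((-1) ^ r * \<epsilon>) * (\<Prod>j<d. p j r) * det (mat r r M)" .
  moreover have "((-1) ^ r * \<epsilon>) * ((-1) ^ r * \<epsilon>) = 1"
    using \<epsilon>(1) sq by (metis mult.assoc mult.left_commute mult.right_neutral)
  ultimately show ?thesis unfolding cyc_det_def N_def M_def by blast
qed

lemma (in comm_ring_hom) hom_cyc_det:
  "hom (cyc_det d r p y) = cyc_det d r (\<lambda>j s. hom (p j s)) (hom y)"
  unfolding cyc_det_def hom_det[symmetric]
  by (intro arg_cong[of _ _ det] eq_matI) (auto simp: hom_distribs intro!: sum.cong)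

text \<open>Used to replace the rank of \<open>\<phi>\<close> by the rank of its reduction, beyond
  which the coefficients vanish at a root of \<open>f\<close>.\<close>

lemma cyc_det_truncate:
  assumes "r' \<le> r" "\<And>j s. j < d \<Longrightarrow> r' < s \<Longrightarrow> s \<le> r \<Longrightarrow> p j s = 0"
  shows "cyc_det d r p y = cyc_det d r' p y"
proof -
  have "(\<Sum>s\<le>r. if (j + s) mod d = c then p j s * y ^ ((j + s) div d) else 0) =
      (\<Sum>s\<le>r'. if (j + s) mod d = c then p j s * y ^ ((j + s) div d) else 0)" if "j < d" for j c
    using assms that by (intro sum.mono_neutral_right) auto
  then show ?thesis unfolding cyc_det_def
    by (intro arg_cong[of _ _ det] cong_mat) auto
qed

lemma det_mat_upper_triangular:
  assumes "\<And>i j. j < i \<Longrightarrow> i < n \<Longrightarrow> A (i, j) = 0"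
  shows "det (mat n n A) = (\<Prod>i<n. A (i, i))"
proof -
  have "det (mat n n A) = det (transpose_mat (mat n n A))"
    by (rule det_transpose[symmetric]) auto
  also have "transpose_mat (mat n n A) = mat n n (\<lambda>(i, j). A (j, i))"
    by (rule eq_matI) auto
  also have "det \<dots> = (\<Prod>i<n. A (i, i))"
    by (subst det_mat_lower_triangular) (use assms in auto)
  finally show ?thesis .
qed

text \<open>At \<open>y = 0\<close> only shifts that do not wrap around survive, and these leave an
  upper triangular matrix.\<close>

lemma cyc_det_0:
  assumes "d > 0"
  shows "cyc_det d r p 0 = (\<Prod>j<d. p j 0)"
proof -
  have *: "(\<Sum>s\<le>r. if (j + s) mod d = c then p j s * 0 ^ ((j + s) div d) else 0) =
      (\<Sum>s\<le>r. if j + s = c then p j s else 0)" if "c < d" for j c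
    using that by (intro sum.cong) (auto simp: power_0_left div_eq_0_iff)
  have "cyc_det d r p 0 =
      (\<Prod>j<d. \<Sum>s\<le>r. if (j + s) mod d = j then p j s * 0 ^ ((j + s) div d) else 0)"
    unfolding cyc_det_def by (subst det_mat_upper_triangular) (auto simp: * intro!: sum.neutral)
  also have "\<dots> = (\<Prod>j<d. p j 0)"
    by (intro prod.cong) (auto simp: *)
  finally show ?thesis .
qed

text \<open>Polynomials in \<open>y\<close> over \<open>R[x]\<close>, with \<open>x\<close> of weight \<open>m\<close> and \<open>y\<close> of weight \<open>n\<close>.\<close>

definition weight_le :: "nat \<Rightarrow> nat \<Rightarrow> int \<Rightarrow> 'r::comm_ring_1 poly poly \<Rightarrow> bool" where
  "weight_le m n w P \<longleftrightarrow>
     (\<forall>i a. coeff (coeff P i) a \<noteq> 0 \<longrightarrow> int (m * a + n * i) \<le> w)"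

lemma weight_le_0 [simp]: "weight_le m n w 0"
  by (simp add: weight_le_def)

lemma weight_le_sum:
  assumes "\<And>x. x \<in> A \<Longrightarrow> weight_le m n w (P x)"
  shows "weight_le m n w (\<Sum>x\<in>A. P x)"
  unfolding weight_le_def
proof (intro allI impI)
  fix i a assume "coeff (coeff (\<Sum>x\<in>A. P x) i) a \<noteq> 0"
  then have "(\<Sum>x\<in>A. coeff (coeff (P x) i) a) \<noteq> 0" by (simp add: coeff_sum)
  then obtain x where "x \<in> A" "coeff (coeff (P x) i) a \<noteq> 0" by (meson sum.neutral)
  then show "int (m * a + n * i) \<le> w" using assms unfolding weight_le_def by blast
qed

lemma weight_le_mult:
  assumes "weight_le m n w P" "weight_le m n w' Q"
  shows "weight_le m n (w + w') (P * Q)"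
  unfolding weight_le_def
proof (intro allI impI)
  fix i a assume "coeff (coeff (P * Q) i) a \<noteq> 0"
  then have "(\<Sum>j\<le>i. \<Sum>b\<le>a. coeff (coeff P j) b * coeff (coeff Q (i - j)) (a - b)) \<noteq> 0"
    by (simp add: coeff_mult coeff_sum)
  then obtain j where "j \<le> i" "(\<Sum>b\<le>a. coeff (coeff P j) b * coeff (coeff Q (i - j)) (a - b)) \<noteq> 0"
    by (meson sum.neutral atMost_iff)
  then obtain b where j: "j \<le> i" "b \<le> a" "coeff (coeff P j) b * coeff (coeff Q (i - j)) (a - b) \<noteq> 0"
    by (meson sum.neutral atMost_iff)
  then have "coeff (coeff P j) b \<noteq> 0" "coeff (coeff Q (i - j)) (a - b) \<noteq> 0" by auto
  then have "int (m * b + n * j) \<le> w" "int (m * (a - b) + n * (i - j)) \<le> w'"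
    using assms unfolding weight_le_def by blast+
  moreover have "int (m * a + n * i) = int (m * b + n * j) + int (m * (a - b) + n * (i - j))"
    using j(1,2) by (auto simp: algebra_simps dest!: le_Suc_ex)
  ultimately show "int (m * a + n * i) \<le> w + w'" by linarith
qed

lemma weight_le_prod:
  assumes "\<And>x. x \<in> A \<Longrightarrow> weight_le m n (w x) (P x)"
  shows "weight_le m n (\<Sum>x\<in>A. w x) (\<Prod>x\<in>A. P x)"
  using assms
proof (induction A rule: infinite_finite_induct)
  case (insert x A)
  then show ?case by (auto intro!: weight_le_mult)
qed (auto simp: weight_le_def coeff_1)

lemma weight_le_uminus: "weight_le m n w P \<Longrightarrow> weight_le m n w (- P)"
  by (simp add: weight_le_def)

text \<open>In each term of the Leibniz expansion the contributions \<open>i\<close> and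
  \<open>\<pi> i\<close> cancel in the sum over all rows. Weights are integers because the bound for
  a single entry may be negative.\<close>

lemma weight_le_det:
  assumes "\<And>i j. i < k \<Longrightarrow> j < k \<Longrightarrow> weight_le m n (w + int i - int j) (A (i, j))"
  shows "weight_le m n (int k * w) (det (mat k k A))"
proof -
  have "weight_le m n (int k * w) (signof \<pi> * (\<Prod>i = 0..<k. mat k k A $$ (i, \<pi> i)))"
    if \<pi>: "\<pi> permutes {0..<k}" for \<pi>
  proof -
    have lt: "\<pi> i < k" if "i < k" for i using permutes_in_image[OF \<pi>, of i] that by simp
    have "(\<Sum>i = 0..<k. int (\<pi> i)) = (\<Sum>i = 0..<k. int i)"
      using sum.permute[OF \<pi>, of int] by (simp add: o_def)
    then have "(\<Sum>i = 0..<k. w + int i - int (\<pi> i)) = int k * w"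
      by (simp add: sum_subtractf sum.distrib)
    moreover have "weight_le m n (\<Sum>i = 0..<k. w + int i - int (\<pi> i)) (\<Prod>i = 0..<k. mat k k A $$ (i, \<pi> i))"
      by (rule weight_le_prod) (use lt assms in auto)
    ultimately show ?thesis by (auto simp: sign_def intro: weight_le_uminus)
  qed
  then show ?thesis
    by (subst det_def'[of _ k]) (auto intro!: weight_le_sum)
qed

text \<open>
  The determinant \<open>det (X - \<phi>\<^sub>\<theta>(S))\<close>, \<open>S\<close> being the cyclic shift with \<open>S\<^sup>d = y\<close>, at a root \<open>\<xi>\<close> of \<open>f\<close>.
  For \<open>Y\<close> in place of \<open>\<xi>\<close> it is a polynomial with coefficients in \<open>\<F>\<^sub>q[Y]\<close>, independent of the field.
\<close>

definition univ_det :: "nat \<Rightarrow> nat \<Rightarrow> 'a::{field,finite} poly poly \<Rightarrow> 'a poly poly poly" where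
  "univ_det q d \<Phi> =
     cyc_det d (degree \<Phi>) (\<lambda>j s. [:[:- (coeff \<Phi> s ^ (q ^ j)), if s = 0 then 1 else 0:]:]) [:0, 1:]"

context fq_hom begin

text \<open>The coefficient of \<open>S ^ s\<close> in row \<open>j\<close> of
  \<open>X - \<phi>_\<theta>(S)\<close>, as a polynomial in \<open>X\<close>; the row index selects
  the conjugate of \<open>\<xi>\<close>.\<close>

definition shift_coeff :: "'l \<Rightarrow> 'a poly poly \<Rightarrow> nat \<Rightarrow> nat \<Rightarrow> 'l poly" where
  "shift_coeff \<xi> \<Phi> j s = [:- ev (\<xi> ^ (q ^ j)) (coeff \<Phi> s), if s = 0 then 1 else 0:]"

text \<open>This is \<open>\<Delta>(X, y)\<close>: the outer polynomial variable is
  \<open>y\<close>, the inner one is \<open>X\<close>.\<close>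

definition shift_det :: "'l \<Rightarrow> nat \<Rightarrow> 'a poly poly \<Rightarrow> 'l poly poly" where
  "shift_det \<xi> d \<Phi> = cyc_det d (degree \<Phi>) (\<lambda>j s. [:shift_coeff \<xi> \<Phi> j s:]) [:0, 1:]"

lemma shift_det_eq_univ_det:
  "shift_det \<xi> d \<Phi> = map_poly (map_poly (ev \<xi>)) (univ_det q d \<Phi>)"
proof -
  interpret E: comm_ring_hom "ev \<xi>" by (rule ev_hom)
  interpret E1: map_poly_comm_ring_hom "ev \<xi>" ..
  interpret E2: map_poly_comm_ring_hom "map_poly (ev \<xi>)" ..
  show ?thesis unfolding univ_det_def shift_det_def E2.hom_cyc_det
    by (intro arg_cong2[of _ _ _ _ "cyc_det d (degree \<Phi>)"] ext poly_eqI)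
      (auto simp: shift_coeff_def ev_pow_q_pow [symmetric] coeff_map_poly coeff_pCons split: nat.splits)
qed

text \<open>A term of entry \<open>(j, c)\<close> containing \<open>S ^ s\<close> carries
  \<open>y ^ e\<close> with \<open>d * e = j + s - c\<close>, and \<open>X\<close> occurs only for
  \<open>s = 0\<close>. As \<open>s \<le> m\<close> and \<open>X\<close> has weight
  \<open>m\<close>, the entry has weight at most \<open>m + j - c\<close>, and
  \<open>weight_le_det\<close> applies.\<close>

lemma weight_shift_det: "d > 0 \<Longrightarrow> m \<le> degree \<Phi> \<Longrightarrow> (\<And>s. s > m \<Longrightarrow> ev \<xi> (coeff \<Phi> s) = 0) \<Longrightarrow>
   weight_le m d (int d * int m) (shift_det \<xi> d \<Phi>)"
proof -
  assume d: "d > 0" and m: "m \<le> degree \<Phi>" and 0: "\<And>s. s > m \<Longrightarrow> ev \<xi> (coeff \<Phi> s) = 0"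
  have 0: "shift_coeff \<xi> \<Phi> j s = 0" if "s > m" for j s
    using 0[OF that] that by (simp add: shift_coeff_def ev_pow_q_pow [symmetric] zero_power)
  have "shift_det \<xi> d \<Phi> = cyc_det d m (\<lambda>j s. [:shift_coeff \<xi> \<Phi> j s:]) [:0, 1:]"
    unfolding shift_det_def by (rule cyc_det_truncate) (use m 0 in auto)
  also have "weight_le m d (int d * int m) \<dots>"
    unfolding cyc_det_def
  proof (rule weight_le_det, unfold split, intro weight_le_sum)
    fix j c s assume j: "j < d" and s: "s \<in> {..m}"
    show "weight_le m d (int m + int j - int c) (if (j + s) mod d = c
        then [:shift_coeff \<xi> \<Phi> j s:] * [:0, 1:] ^ ((j + s) div d) else 0)"
    proof (cases "(j + s) mod d = c")
      case True
      define e where "e = (j + s) div d"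
      have eq: "d * e + c = j + s" using True mult_div_mod_eq[of d "j + s"] by (simp add: e_def)
      have "m * a + d * i + c \<le> m + j"
        if "coeff (coeff ([:shift_coeff \<xi> \<Phi> j s:] * [:0, 1:] ^ e) i) a \<noteq> 0" for i a
      proof -
        from that have i: "i = e" and a: "coeff (shift_coeff \<xi> \<Phi> j s) a \<noteq> 0"
          by (auto simp flip: monom_altdef simp: x_pow_n smult_monom split: if_splits)
        show ?thesis
        proof (cases "s = 0")
          case True
          then have "a \<le> 1" using a by (auto simp: shift_coeff_def coeff_pCons split: nat.splits)
          then have "m * a \<le> m * 1" by (rule mult_le_mono2)
          then show ?thesis unfolding i using eq True by linarith
        next
          case False
          then have "a = 0" using a by (auto simp: shift_coeff_def coeff_pCons split: nat.splits)
          then show ?thesis using eq i s by simp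
        qed
      qed
      then have "int (m * a + d * i) \<le> int m + int j - int c"
        if "coeff (coeff ([:shift_coeff \<xi> \<Phi> j s:] * [:0, 1:] ^ e) i) a \<noteq> 0" for i a
        using that by (smt (verit) of_nat_add of_nat_mono)
      then show ?thesis using True unfolding weight_le_def e_def by simp
    qed simp
  qed
  finally show ?thesis .
qed

context
  fixes f :: "'a poly" and \<xi> :: 'l and \<Phi> :: "'a poly poly"
  assumes f: "f \<in> monic_primes" and root: "ev \<xi> f = 0" and \<Phi>0: "coeff \<Phi> 0 = theta"
begin

lemma shift_coeff_0: "shift_coeff \<xi> \<Phi> j 0 = [:- (\<xi> ^ (q ^ j)), 1:]"
  by (simp add: shift_coeff_def \<Phi>0)

lemma shift_det_at_0: "coeff (shift_det \<xi> (degree f) \<Phi>) 0 = map_poly \<iota> f"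
proof -
  have "coeff (shift_det \<xi> (degree f) \<Phi>) 0 = poly (shift_det \<xi> (degree f) \<Phi>) 0"
    by (simp add: poly_0_coeff_0)
  also have "\<dots> = cyc_det (degree f) (degree \<Phi>) (\<lambda>j s. shift_coeff \<xi> \<Phi> j s) 0"
    unfolding shift_det_def poly_hom.hom_cyc_det by simp
  also have "\<dots> = map_poly \<iota> f"
    by (simp add: cyc_det_0[OF degree_monic_prime[OF f]] shift_coeff_0 map_poly_eq_prod_conj[OF f root])
  finally show ?thesis .
qed

end

end

text \<open>
  If the determinant is defined over the finite field at one root of \<open>f\<close>, the irreducible polynomial
  \<open>f\<close> divides the difference of \<open>univ_det\<close> and its value, which therefore is the same at every root of \<open>f\<close> in every field.
\<close>

lemma shift_det_transfer:
  assumes "fq_hom \<iota> q" "fq_hom \<iota>' q" "f \<in> monic_primes" "fq_hom.ev \<iota> \<xi> f = 0" "fq_hom.ev \<iota>' \<xi>' f = 0"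
    and "fq_hom.shift_det \<iota> q \<xi> d \<Phi> = map_poly (map_poly \<iota>) Q"
  shows "fq_hom.shift_det \<iota>' q \<xi>' d \<Phi> = map_poly (map_poly \<iota>') Q"
proof -
  interpret A: fq_hom \<iota> q by fact
  interpret B: fq_hom \<iota>' q by fact
  show ?thesis
  proof (intro poly_eqI)
    fix i a
    define u where "u = coeff (coeff (univ_det q d \<Phi>) i) a"
    define w where "w = coeff (coeff Q i) a"
    have "A.ev \<xi> u = \<iota> w"
      using arg_cong[OF assms(6), of "\<lambda>P. coeff (coeff P i) a"]
      by (simp add: A.shift_det_eq_univ_det coeff_map_poly u_def w_def)
    then have "A.ev \<xi> (u - [:w:]) = 0" by simp
    then have "B.ev \<xi>' (u - [:w:]) = 0"
      using A.ev_eq_0_iff[OF assms(3,4)] B.ev_eq_0_iff[OF assms(3,5)] by blast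
    then have "B.ev \<xi>' u = \<iota>' w" by simp
    then show "coeff (coeff (B.shift_det \<xi>' d \<Phi>) i) a = coeff (coeff (map_poly (map_poly \<iota>') Q) i) a"
      by (simp add: B.shift_det_eq_univ_det coeff_map_poly u_def w_def)
  qed
qed

section \<open>The reduction of a Drinfeld module at a prime\<close>

lemma funpow_power: "((\<lambda>x :: 'b::monoid_mult. x ^ q) ^^ i) x = x ^ (q ^ i)"
  by (induction i) (auto simp: power_mult mult.commute[of q] simp flip: power_mult)

lemma coeff_tw_mult:
  assumes "\<tau> 0 = 0"
  shows "coeff (tw_mult \<tau> u v) n = (\<Sum>i\<le>n. coeff u i * (\<tau> ^^ i) (coeff v (n - i)))"
proof -
  have 0: "(\<tau> ^^ i) 0 = 0" for i using assms by (induction i) auto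
  have "coeff (tw_mult \<tau> u v) n =
      (\<Sum>i\<le>degree u. \<Sum>j\<le>degree v. if i + j = n then coeff u i * (\<tau> ^^ i) (coeff v j) else 0)"
    by (simp add: tw_mult_def coeff_sum)
  also have "\<dots> = (\<Sum>i\<le>degree u. if i \<le> n then coeff u i * (\<tau> ^^ i) (coeff v (n - i)) else 0)"
  proof (intro sum.cong refl)
    fix i
    have "(\<Sum>j\<le>degree v. if i + j = n then coeff u i * (\<tau> ^^ i) (coeff v j) else 0) =
        (\<Sum>j\<le>degree v. if j = n - i then (if i \<le> n then coeff u i * (\<tau> ^^ i) (coeff v (n - i)) else 0) else 0)"
      by (intro sum.cong) auto
    also have "\<dots> = (if i \<le> n then coeff u i * (\<tau> ^^ i) (coeff v (n - i)) else 0)"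
      by (simp add: 0 coeff_eq_0)
    finally show "(\<Sum>j\<le>degree v. if i + j = n then coeff u i * (\<tau> ^^ i) (coeff v j) else 0) = \<dots>" .
  qed
  also have "\<dots> = (\<Sum>i\<le>max n (degree u). if i \<le> n then coeff u i * (\<tau> ^^ i) (coeff v (n - i)) else 0)"
    by (intro sum.mono_neutral_left) (auto simp: coeff_eq_0)
  also have "\<dots> = (\<Sum>i\<le>n. coeff u i * (\<tau> ^^ i) (coeff v (n - i)))"
    by (intro sum.mono_neutral_cong_right) auto
  finally show ?thesis .
qed

lemma tw_act_altdef:
  assumes "degree u \<le> n"
  shows "tw_act \<tau> u x = (\<Sum>i\<le>n. coeff u i * (\<tau> ^^ i) x)"
  unfolding tw_act_def by (rule sum.mono_neutral_left) (use assms in \<open>auto simp: coeff_eq_0\<close>)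

lemma tw_act_add: "tw_act \<tau> (u + v) x = tw_act \<tau> u x + tw_act \<tau> v x"
proof -
  define n where "n = max (degree u) (degree v)"
  have "degree u \<le> n" "degree v \<le> n" "degree (u + v) \<le> n"
    by (auto simp: n_def degree_add_le)
  then show ?thesis by (simp add: tw_act_altdef[of _ n] algebra_simps sum.distrib)
qed

lemma tw_act_0 [simp]: "tw_act \<tau> 0 x = 0"
  by (simp add: tw_act_def)

lemma tw_act_sum: "tw_act \<tau> (\<Sum>i\<in>I. u i) x = (\<Sum>i\<in>I. tw_act \<tau> (u i) x)"
  by (induction I rule: infinite_finite_induct) (auto simp: tw_act_add)

lemma tw_act_monom: "tw_act \<tau> (monom c k) x = c * (\<tau> ^^ k) x"
proof -
  have "tw_act \<tau> (monom c k) x = (\<Sum>i\<le>k. if i = k then c * (\<tau> ^^ i) x else 0)"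
    by (subst tw_act_altdef[OF degree_monom_le]) (intro sum.cong, auto)
  then show ?thesis by (simp cong: if_cong)
qed

lemma card_roots_separable:
  fixes p :: "'b :: alg_closed_field poly"
  assumes "p \<noteq> 0" and sep: "\<And>x. poly p x = 0 \<Longrightarrow> poly (pderiv p) x \<noteq> 0"
  shows "card {x. poly p x = 0} = degree p"
proof -
  obtain A where A: "size A = degree p" "p = smult (lead_coeff p) (\<Prod>x\<in>#A. [:-x, 1:])"
    using alg_closed_imp_factorization[OF assms(1)] by blast
  have root: "poly p x = 0 \<longleftrightarrow> x \<in># A" for x
    by (subst A(2)) (use assms(1) in \<open>auto simp: poly_prod_mset prod_mset_zero_iff\<close>)
  have "count A x = 1" if "x \<in># A" for x
  proof (rule ccontr)
    assume "count A x \<noteq> 1"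
    define B where "B = A - {#x#}"
    have B: "A = add_mset x B" using that by (simp add: B_def)
    then have "x \<in># B" using \<open>count A x \<noteq> 1\<close> by (simp add: not_in_iff)
    then have "B = add_mset x (B - {#x#})" by simp
    then obtain C where "B = add_mset x C" by blast
    then have "p = smult (lead_coeff p) ([:-x, 1:] * ([:-x, 1:] * (\<Prod>x\<in>#C. [:-x, 1:])))"
      using A(2) B by simp
    then have "poly (pderiv p) x = poly (pderiv (smult (lead_coeff p) ([:-x, 1:] * ([:-x, 1:] * (\<Prod>x\<in>#C. [:-x, 1:]))))) x"
      by simp
    also have "\<dots> = 0" by (simp only: pderiv_smult pderiv_mult) simp
    finally show False using sep that root by blast
  qed
  then have "A = mset_set (set_mset A)"
    by (intro multiset_eqI) (auto simp: count_mset_set' not_in_iff)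
  then have "card (set_mset A) = degree p" using A(1) by (metis size_mset_set)
  then show ?thesis by (simp add: root)
qed

context fq_hom begin

text \<open>Turns the kernel of a twisted polynomial into the root set of an ordinary one, so that
  torsion can be counted by degrees.\<close>

definition additive_poly :: "'l poly \<Rightarrow> 'l poly" where
  "additive_poly u = (\<Sum>i\<le>degree u. monom (coeff u i) (q ^ i))"

abbreviation frob_act :: "'l poly \<Rightarrow> 'l \<Rightarrow> 'l" where
  "frob_act \<equiv> tw_act (\<lambda>x. x ^ q)"

lemma frob_act_def: "frob_act u x = (\<Sum>i\<le>degree u. coeff u i * x ^ (q ^ i))"
  by (simp add: tw_act_def funpow_power)

lemma poly_additive_poly: "poly (additive_poly u) x = frob_act u x"
  by (simp add: additive_poly_def frob_act_def poly_sum poly_monom)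

lemma q_pow_eq_iff [simp]: "q ^ i = q ^ j \<longleftrightarrow> i = j"
  using q_gt_1 by simp

lemma coeff_additive_poly: "coeff (additive_poly u) (q ^ i) = coeff u i"
proof -
  have "coeff (additive_poly u) (q ^ i) = (\<Sum>j\<le>degree u. if j = i then coeff u j else 0)"
    by (simp add: additive_poly_def coeff_sum)
  then show ?thesis by (simp add: coeff_eq_0)
qed

lemma degree_additive_poly:
  assumes "u \<noteq> 0"
  shows "degree (additive_poly u) = q ^ degree u"
proof (rule antisym)
  show "degree (additive_poly u) \<le> q ^ degree u"
    unfolding additive_poly_def
  proof (intro degree_sum_le)
    fix i assume "i \<in> {..degree u}"
    then have "q ^ i \<le> q ^ degree u" by (intro power_increasing) (use q_gt_1 in auto)
    then show "degree (monom (coeff u i) (q ^ i)) \<le> q ^ degree u"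
      using degree_monom_le le_trans by blast
  qed simp
  show "q ^ degree u \<le> degree (additive_poly u)"
    by (rule le_degree) (use assms in \<open>simp add: coeff_additive_poly\<close>)
qed

lemma of_nat_q: "of_nat q = (0 :: 'l)"
proof -
  have "of_nat (CARD('a) choose 1) = (0 :: 'a)"
    by (rule of_nat_card_choose_eq_0) (use q_gt_1 q_def in auto)
  then have "\<iota> (of_nat q) = 0" by (simp add: q_def)
  then show ?thesis by (simp add: hom_of_nat)
qed

text \<open>All exponents \<open>q ^ i\<close> with \<open>i > 0\<close> vanish in the field. A
  nonzero constant coefficient of \<open>u\<close> therefore makes the polynomial separable.\<close>

lemma pderiv_additive_poly: "pderiv (additive_poly u) = [:coeff u 0:]"
proof -
  have "pderiv (additive_poly u) = (\<Sum>i\<le>degree u. pderiv (monom (coeff u i) (q ^ i)))"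
    by (simp add: additive_poly_def pderiv_sum)
  also have "\<dots> = (\<Sum>i\<le>degree u. if i = 0 then [:coeff u 0:] else 0)"
    by (intro sum.cong) (auto simp: pderiv_monom of_nat_q zero_power monom_0)
  finally show ?thesis by simp
qed

lemma frob_act_plus: "frob_act u (x + y) = frob_act u x + frob_act u y"
proof -
  have "(x + y) ^ (q ^ i) = x ^ (q ^ i) + y ^ (q ^ i)" for i
  proof -
    interpret F: field_hom "\<lambda>x :: 'l. x ^ (q ^ i)" by (rule field_hom_frob_pow)
    show ?thesis by (rule F.hom_add)
  qed
  then show ?thesis by (simp add: frob_act_def algebra_simps sum.distrib)
qed

lemma frob_act_zero [simp]: "frob_act u 0 = 0"
  by (simp add: frob_act_def zero_power)

lemma frob_act_uminus: "frob_act u (- x) = - frob_act u x"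
  using frob_act_plus[of u x "- x"] by (simp add: eq_neg_iff_add_eq_0 add.commute)

lemma frob_act_minus: "frob_act u (x - y) = frob_act u x - frob_act u y"
  using frob_act_plus[of u x "- y"] by (simp add: frob_act_uminus)

lemma frob_act_sum_right: "frob_act u (\<Sum>i\<in>I. x i) = (\<Sum>i\<in>I. frob_act u (x i))"
  by (induction I rule: infinite_finite_induct) (auto simp: frob_act_plus)

lemma frob_act_tw_mult: "frob_act (tw_mult (\<lambda>x. x ^ q) u v) x = frob_act u (frob_act v x)"
proof -
  have "(\<Sum>j\<le>n. g j) ^ (q ^ i) = (\<Sum>j\<le>n. g j ^ (q ^ i))" for g :: "nat \<Rightarrow> 'l" and n i :: nat
  proof -
    interpret F: field_hom "\<lambda>x :: 'l. x ^ (q ^ i)" by (rule field_hom_frob_pow)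
    show ?thesis by (rule F.hom_sum)
  qed
  note sum_pow = this
  have pow: "(v * y ^ (q ^ j)) ^ (q ^ i) = v ^ (q ^ i) * y ^ (q ^ (i + j))" for v y :: 'l and i j
    by (simp only: power_mult_distrib power_mult[symmetric] power_add mult.commute[of "q ^ i"])
  have "frob_act (tw_mult (\<lambda>x. x ^ q) u v) x =
      (\<Sum>i\<le>degree u. \<Sum>j\<le>degree v. coeff u i * coeff v j ^ (q ^ i) * x ^ (q ^ (i + j)))"
    by (simp only: tw_mult_def tw_act_sum tw_act_monom funpow_power)
  also have "\<dots> = frob_act u (frob_act v x)"
    by (simp only: frob_act_def sum_pow pow sum_distrib_left mult.assoc)
  finally show ?thesis .
qed

end

lemma red_rank_bounds:
  fixes \<phi> :: "'a::field poly \<Rightarrow> 'a poly poly"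
  shows "s > red_rank \<phi> f \<Longrightarrow> f dvd coeff (\<phi> theta) s" "red_rank \<phi> f \<le> degree (\<phi> theta)"
    "red_rank \<phi> f \<ge> 1 \<Longrightarrow> \<not> f dvd coeff (\<phi> theta) (red_rank \<phi> f)"
proof -
  let ?A = "insert 0 {i. i \<ge> 1 \<and> \<not> f dvd coeff (\<phi> theta) i}"
  have fin: "finite ?A"
    by (rule finite_subset[of _ "{..degree (\<phi> theta)}"]) (auto intro: ccontr simp: coeff_eq_0)
  have A: "red_rank \<phi> f \<in> ?A" unfolding red_rank_def by (rule Max_in[OF fin]) simp
  then show "red_rank \<phi> f \<le> degree (\<phi> theta)" by (auto intro: ccontr simp: coeff_eq_0)
  show "\<not> f dvd coeff (\<phi> theta) (red_rank \<phi> f)" if "red_rank \<phi> f \<ge> 1" using A that by auto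
  assume s: "s > red_rank \<phi> f"
  show "f dvd coeff (\<phi> theta) s"
  proof (rule ccontr)
    assume "\<not> f dvd coeff (\<phi> theta) s"
    then have "s \<le> red_rank \<phi> f" using s unfolding red_rank_def by (intro Max_ge[OF fin]) auto
    then show False using s by simp
  qed
qed

locale drinfeld_reduction =
  fq_hom "to_ac :: 'a::{field,finite} \<Rightarrow> 'a::{field,finite} alg_closure" q for q +
  fixes \<phi> :: "'a::{field,finite} poly \<Rightarrow> 'a::{field,finite} poly poly"
    and f :: "'a::{field,finite} poly" and \<xi> :: "'a::{field,finite} alg_closure" and r :: nat
  assumes drinfeld: "drinfeld_module r \<phi>" and f: "f \<in> monic_primes" and root: "ev \<xi> f = 0"
    and red_rank_pos: "red_rank \<phi> f \<ge> 1"
begin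

abbreviation r0 :: nat where "r0 \<equiv> red_rank \<phi> f"

definition red :: "'a poly \<Rightarrow> 'a alg_closure poly" where
  "red a = map_poly (ev \<xi>) (\<phi> a)"

abbreviation act :: "'a poly \<Rightarrow> 'a alg_closure \<Rightarrow> 'a alg_closure" where
  "act a \<equiv> frob_act (red a)"

lemma reduce_eq_ev: "reduce x = ev x"
  by (simp add: fun_eq_iff reduce_def ev_def)

lemma red_act_eq: "red_act \<phi> \<xi> = act"
  by (simp add: fun_eq_iff red_act_def red_def reduce_eq_ev q_def)

lemma phi_const: "\<phi> [:c:] = [:[:c:]:]" and phi_add: "\<phi> (a + b) = \<phi> a + \<phi> b"
  and phi_mult: "\<phi> (a * b) = tw_mult (\<lambda>a. a ^ q) (\<phi> a) (\<phi> b)"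
  and phi_theta_0: "coeff (\<phi> theta) 0 = theta"
  using drinfeld by (auto simp: drinfeld_module_def tw_alg_hom_def q_def)

lemma coeff_red: "coeff (red a) i = ev \<xi> (coeff (\<phi> a) i)"
  by (simp add: red_def coeff_map_poly)

lemma red_const: "red [:c:] = [:to_ac c:]"
  by (rule poly_eqI) (simp add: coeff_red phi_const coeff_pCons split: nat.splits)

lemma red_add: "red (a + b) = red a + red b"
  by (rule poly_eqI) (simp add: coeff_red phi_add)

lemma red_mult: "red (a * b) = tw_mult (\<lambda>x. x ^ q) (red a) (red b)"
proof (rule poly_eqI)
  fix n
  interpret E: comm_ring_hom "ev \<xi>" by (rule ev_hom)
  show "coeff (red (a * b)) n = coeff (tw_mult (\<lambda>x. x ^ q) (red a) (red b)) n"
    by (simp add: coeff_red phi_mult coeff_tw_mult zero_power E.hom_sum funpow_power)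
qed

lemma act_add: "act (a + b) x = act a x + act b x"
  by (simp add: red_add tw_act_add)

lemma act_mult: "act (a * b) x = act a (act b x)"
  by (simp add: red_mult frob_act_tw_mult)

lemma act_const: "act [:c:] x = to_ac c * x"
  by (simp add: red_const frob_act_def)

lemma act_0 [simp]: "act 0 x = 0" and act_1 [simp]: "act 1 x = x"
  using act_const[of 0 x] act_const[of 1 x] by (simp_all add: one_pCons)

lemma act_uminus: "act (- a) x = - act a x"
  using act_add[of a "- a" x] by (simp add: eq_neg_iff_add_eq_0 add.commute)

lemma act_diff: "act (a - b) x = act a x - act b x"
  using act_add[of a "- b" x] by (simp add: act_uminus)

lemma act_commute: "act a (act b x) = act b (act a x)"
  by (simp add: mult.commute flip: act_mult)

text \<open>The coefficients of the reduction lie in the field with \<open>q ^ degree f\<close>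
  elements, so this power of Frobenius commutes with them and is an endomorphism of the reduced
  module.\<close>

lemma act_frob: "act a (x ^ (q ^ degree f)) = act a x ^ (q ^ degree f)"
proof -
  interpret F: field_hom "\<lambda>x :: 'a alg_closure. x ^ (q ^ degree f)" by (rule field_hom_frob_pow)
  have "ev \<xi> u ^ (q ^ degree f) = ev \<xi> u" for u
    by (simp add: ev_pow_q_pow frob_period[OF f root])
  then show ?thesis
    by (simp add: frob_act_def F.hom_sum power_mult_distrib coeff_red mult.commute flip: power_mult)
qed

lemma coeff_red_rank: "ev \<xi> (coeff (\<phi> theta) r0) \<noteq> 0"
  using red_rank_bounds(3)[OF red_rank_pos] ev_eq_0_iff[OF f root] by blast

lemma coeff_gt_red_rank: "s > r0 \<Longrightarrow> ev \<xi> (coeff (\<phi> theta) s) = 0"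
  using red_rank_bounds(1) ev_eq_0_iff[OF f root] by blast

lemma degree_red_theta: "degree (red theta) = r0"
proof (rule antisym)
  show "degree (red theta) \<le> r0" by (rule degree_le) (auto simp: coeff_red coeff_gt_red_rank)
  show "r0 \<le> degree (red theta)" by (rule le_degree) (simp add: coeff_red coeff_red_rank)
qed

lemma act_theta: "act theta x = (\<Sum>s\<le>r0. ev \<xi> (coeff (\<phi> theta) s) * x ^ (q ^ s))"
  by (simp add: frob_act_def degree_red_theta coeff_red)

lemma red_pCons: "red (pCons c a) = [:to_ac c:] + tw_mult (\<lambda>x. x ^ q) (red theta) (red a)"
proof -
  have "pCons c a = [:c:] + theta * a" by simp
  then show ?thesis by (simp only: red_add red_const red_mult)
qed

lemma degree_tw_mult:
  fixes u v :: "'a alg_closure poly"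
  assumes "u \<noteq> 0" "v \<noteq> 0"
  shows "degree (tw_mult (\<lambda>x. x ^ q) u v) = degree u + degree v" "tw_mult (\<lambda>x. x ^ q) u v \<noteq> 0"
proof -
  let ?w = "tw_mult (\<lambda>x. x ^ q) u v" and ?n = "degree u + degree v"
  have "coeff ?w ?n = (\<Sum>i\<le>?n. coeff u i * coeff v (?n - i) ^ (q ^ i))"
    by (simp add: coeff_tw_mult zero_power funpow_power)
  also have "\<dots> = (\<Sum>i\<le>?n. if i = degree u then lead_coeff u * lead_coeff v ^ (q ^ i) else 0)"
  proof (intro sum.cong refl)
    fix i show "coeff u i * coeff v (?n - i) ^ (q ^ i) =
        (if i = degree u then lead_coeff u * lead_coeff v ^ (q ^ i) else 0)"
      by (cases i "degree u" rule: linorder_cases) (auto simp: coeff_eq_0 zero_power)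
  qed
  finally have ne: "coeff ?w ?n \<noteq> 0" using assms by simp
  then show "?w \<noteq> 0" by auto
  have "degree ?w \<le> ?n" unfolding tw_mult_def
    by (intro degree_sum_le) (auto intro!: degree_monom_le[THEN le_trans])
  then show "degree ?w = ?n" using le_degree[OF ne] by simp
qed

lemma red_degree: "a \<noteq> 0 \<Longrightarrow> red a \<noteq> 0 \<and> degree (red a) = r0 * degree a"
proof (induction a)
  case (pCons c a)
  show ?case
  proof (cases "a = 0")
    case True
    then show ?thesis using pCons by (simp add: red_const)
  next
    case False
    have ne: "red theta \<noteq> 0" using degree_red_theta red_rank_pos by auto
    have deg: "degree (tw_mult (\<lambda>x. x ^ q) (red theta) (red a)) = r0 + r0 * degree a"
      using degree_tw_mult(1)[OF ne] pCons False by (simp add: degree_red_theta)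
    have "degree [:to_ac c:] < degree (tw_mult (\<lambda>x. x ^ q) (red theta) (red a))"
      unfolding deg degree_pCons_0 using red_rank_pos by linarith
    then have d: "degree (red (pCons c a)) = r0 + r0 * degree a"
      by (subst red_pCons) (simp only: degree_add_eq_right deg)
    then have "degree (red (pCons c a)) \<noteq> 0" using red_rank_pos by linarith
    then have "red (pCons c a) \<noteq> 0" by (metis degree_0)
    with d show ?thesis using False by (simp only: degree_pCons_eq) simp
  qed
qed simp

lemma coeff_red_0: "coeff (red a) 0 = ev \<xi> a"
proof (induction a)
  case (pCons c a)
  have "pCons c a = [:c:] + theta * a" by simp
  then have "ev \<xi> (pCons c a) = to_ac c + \<xi> * ev \<xi> a" by (simp only: ev_simps)
  moreover have "coeff (tw_mult (\<lambda>x. x ^ q) (red theta) (red a)) 0 = \<xi> * ev \<xi> a"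
    by (simp add: coeff_tw_mult zero_power pCons coeff_red[of theta] phi_theta_0)
  ultimately show ?case
    by (subst red_pCons) simp
qed (use red_const[of 0] in simp)

text \<open>The additive polynomial of \<open>red H\<close> has degree
  \<open>q ^ (r0 * degree H)\<close> and constant derivative \<open>ev \<xi> H\<close>; it is
  separable away from \<open>f\<close>.\<close>

lemma card_torsion:
  assumes "ev \<xi> H \<noteq> 0"
  shows "card {x. act H x = 0} = q ^ (r0 * degree H)" "finite {x. act H x = 0}"
proof -
  have H: "H \<noteq> 0" using assms by auto
  let ?p = "additive_poly (red H)"
  have deg: "degree ?p = q ^ (r0 * degree H)" using red_degree[OF H] by (simp add: degree_additive_poly)
  have p: "?p \<noteq> 0" using deg q_pos by (metis degree_0 power_eq_0_iff gr_implies_not0)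
  have "card {x. poly ?p x = 0} = degree ?p"
    by (rule card_roots_separable[OF p])
      (use assms in \<open>simp add: pderiv_additive_poly coeff_red_0\<close>)
  then show "card {x. act H x = 0} = q ^ (r0 * degree H)" by (simp add: deg poly_additive_poly)
  show "finite {x. act H x = 0}" using poly_roots_finite[OF p] by (simp add: poly_additive_poly)
qed

lemma act_surj:
  assumes "H \<noteq> 0"
  obtains y where "act H y = x"
proof -
  have "degree (additive_poly (red H) - [:x:]) > 0"
    unfolding diff_conv_add_uminus using red_degree[OF assms] q_pos
    by (subst degree_add_eq_left) (auto simp: degree_additive_poly)
  then obtain y where "poly (additive_poly (red H) - [:x:]) y = 0"
    using alg_closed_imp_poly_has_root by blast
  then show ?thesis using that by (simp add: poly_additive_poly)
qed

end

section \<open>Tate modules\<close>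

lemma sum_fun_apply: "(\<Sum>i\<in>I. g i) x = (\<Sum>i\<in>I. g i x)"
  by (induction I rule: infinite_finite_induct) auto

context drinfeld_reduction begin

definition tate :: "'a poly \<Rightarrow> (nat \<Rightarrow> 'a alg_closure) set" where
  "tate h = {x. x 0 = 0 \<and> (\<forall>m. act h (x (Suc m)) = x m)}"

lemma tate_module_eq: "tate_module \<phi> \<xi> h = tate h"
  by (simp add: tate_module_def tate_def red_act_eq)

lemma tate_smult_eq: "tate_smult \<phi> \<xi> s x = (\<lambda>m. act (s m) (x m))"
  by (simp add: tate_smult_def red_act_eq)

lemma tate_lin_comb: "(\<Sum>i<l. tate_smult \<phi> \<xi> (s i) (b i)) m = (\<Sum>i<l. act (s i m) (b i m))"
  by (simp add: sum_fun_apply tate_smult_eq)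

lemma tate_shift: "x \<in> tate h \<Longrightarrow> act (h ^ k) (x (k + m)) = x m"
proof (induction k)
  case (Suc k)
  have "act (h ^ Suc k) (x (Suc k + m)) = act (h ^ k) (act h (x (Suc (k + m))))"
    by (simp add: act_mult act_commute)
  then show ?case using Suc by (simp add: tate_def)
qed simp

lemma tate_torsion: "x \<in> tate h \<Longrightarrow> act (h ^ m) (x m) = 0"
  using tate_shift[of x h m 0] by (simp add: tate_def)

lemma tate_diff: "x \<in> tate h \<Longrightarrow> y \<in> tate h \<Longrightarrow> (\<lambda>m. x m - y m) \<in> tate h"
  by (simp add: tate_def frob_act_minus)

lemma tate_smult_const: "x \<in> tate h \<Longrightarrow> (\<lambda>m. act a (x m)) \<in> tate h"
  by (simp add: tate_def act_commute[of h])

lemma tate_sum: "(\<And>i. i \<in> I \<Longrightarrow> x i \<in> tate h) \<Longrightarrow> (\<lambda>m. \<Sum>i\<in>I. x i m) \<in> tate h"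
  by (simp add: tate_def frob_act_sum_right)

lemma tate_frob: "x \<in> tate h \<Longrightarrow> (\<lambda>m. x m ^ (q ^ degree f)) \<in> tate h"
  by (simp add: tate_def act_frob zero_power)

text \<open>Division in the Tate module: by \<open>tate_shift\<close>, the shifted sequence is a
  quotient of \<open>x\<close> by \<open>h ^ k\<close>.\<close>

lemma tate_div:
  assumes "x \<in> tate h" "x k = 0"
  shows "(\<lambda>m. x (k + m)) \<in> tate h"
  using assms by (simp add: tate_def)

text \<open>Below level \<open>m\<close> the sequence is forced by multiplication with
  \<open>h\<close>; above it, division points exist because the field is algebraically
  closed.\<close>

lemma tate_lift:
  assumes "h \<noteq> 0" "act (h ^ m) x = 0"
  obtains t where "t \<in> tate h" "t m = x"
proof -
  define u where "u = rec_nat x (\<lambda>_ y. SOME z. act h z = y)"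
  have u: "u 0 = x" "act h (u (Suc k)) = u k" for k
  proof -
    show "u 0 = x" by (simp add: u_def)
    have "\<exists>z. act h z = u k" by (rule act_surj[OF assms(1)]) blast
    then have "act h (SOME z. act h z = u k) = u k" by (rule someI_ex)
    then show "act h (u (Suc k)) = u k" by (simp add: u_def)
  qed
  define t where "t = (\<lambda>i. if i \<le> m then act (h ^ (m - i)) x else u (i - m))"
  have "act h (t (Suc i)) = t i" for i
  proof (cases "i < m")
    case True
    then have "m - i = Suc (m - Suc i)" by simp
    then show ?thesis using True by (simp add: t_def act_mult)
  next
    case False
    then have "Suc i - m = Suc (i - m)" by simp
    then show ?thesis using False u by (cases "i = m") (auto simp: t_def)
  qed
  moreover have "t 0 = 0" using assms by (simp add: t_def)
  ultimately have "t \<in> tate h" by (simp add: tate_def)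
  moreover have "t m = x" by (simp add: t_def)
  ultimately show ?thesis using that by blast
qed

context
  fixes h :: "'a poly" and bs :: "(nat \<Rightarrow> 'a alg_closure) list"
  assumes h: "h \<in> monic_primes" and hf: "h \<noteq> f"
begin

lemma ev_h: "ev \<xi> h \<noteq> 0"
proof
  assume "ev \<xi> h = 0"
  then have "f dvd h" using ev_eq_0_iff[OF f root] by blast
  then show False using monic_primes_dvd_eq[OF f h] hf by simp
qed

lemma card_torsion_h:
  "card {x. act (h ^ m) x = 0} = q ^ (r0 * (m * degree h))" "finite {x. act (h ^ m) x = 0}"
  using card_torsion[of "h ^ m"] ev_h by (simp_all add: degree_power_eq monic_prime_nz[OF h])

lemma tate_basis_gen:
  assumes "tate_basis \<phi> \<xi> h bs" "act (h ^ m) x = 0"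
  obtains a where "x = (\<Sum>i<length bs. act (a i) ((bs ! i) m))"
proof -
  obtain t where t: "t \<in> tate h" "t m = x" using tate_lift[OF monic_prime_nz[OF h] assms(2)] .
  then obtain s where "t = (\<Sum>i<length bs. tate_smult \<phi> \<xi> (s i) (bs ! i))"
    using assms(1) unfolding tate_basis_def tate_module_eq by blast
  then have "x = (\<Sum>i<length bs. act (s i m) ((bs ! i) m))"
    using t(2) by (simp only: tate_lin_comb[symmetric])
  then show ?thesis by (rule that)
qed

lemma tate_basis_mem:
  assumes "tate_basis \<phi> \<xi> h bs" "i < length bs"
  shows "bs ! i \<in> tate h"
  using assms unfolding tate_basis_def tate_module_eq by (meson nth_mem subsetD)

text \<open>A relation at level \<open>m\<close> makes the sum of the \<open>a i\<close> times the
  basis elements divisible by \<open>h ^ m\<close> in the Tate module. Expanding the quotient in the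
  basis with coefficients \<open>s i\<close> turns the \<open>a i - h ^ m * s i\<close> into
  coefficients of a relation in the whole module, which must be null.\<close>

lemma tate_basis_indep:
  assumes bs: "tate_basis \<phi> \<xi> h bs" and 0: "(\<Sum>i<length bs. act (a i) ((bs ! i) m)) = 0" and "i < length bs"
  shows "h ^ m dvd a i"
proof -
  define x where "x = (\<lambda>k. \<Sum>i<length bs. act (a i) ((bs ! i) k))"
  have x_sum: "(\<Sum>i<length bs. act (a i) ((bs ! i) k)) = x k" for k by (simp add: x_def)
  have x: "x \<in> tate h" unfolding x_def
    by (intro tate_sum tate_smult_const tate_basis_mem[OF bs]) auto
  have "x m = 0" using 0 by (simp add: x_def)
  then have "(\<lambda>k. x (m + k)) \<in> tate h" using x by (intro tate_div)
  then obtain s where s: "\<And>i. i < length bs \<Longrightarrow> s i \<in> adic_seqs h"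
      "(\<lambda>k. x (m + k)) = (\<Sum>i<length bs. tate_smult \<phi> \<xi> (s i) (bs ! i))"
    using bs unfolding tate_basis_def tate_module_eq by blast
  have s': "x (m + k) = (\<Sum>i<length bs. act (s i k) ((bs ! i) k))" for k
    using fun_cong[OF s(2), of k] by (simp only: tate_lin_comb)
  define w where "w = (\<lambda>i k. a i - h ^ m * s i k)"
  have "(\<Sum>i<length bs. tate_smult \<phi> \<xi> (w i) (bs ! i)) = 0"
  proof
    fix k
    have "(\<Sum>i<length bs. act (w i k) ((bs ! i) k)) = x k - act (h ^ m) (x (m + k))"
      by (simp add: w_def s' act_diff act_mult frob_act_sum_right sum_subtractf x_sum)
    also have "\<dots> = 0" using tate_shift[OF x] by simp
    finally show "(\<Sum>i<length bs. tate_smult \<phi> \<xi> (w i) (bs ! i)) k = 0 k"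
      by (simp add: tate_lin_comb)
  qed
  moreover have "w i \<in> adic_seqs h" if "i < length bs" for i
  proof -
    have "w i (Suc k) - w i k = - (h ^ m) * (s i (Suc k) - s i k)" for k
      by (simp add: w_def algebra_simps)
    then show ?thesis using s(1)[OF that] by (auto simp: adic_seqs_def intro!: dvd_mult)
  qed
  ultimately have "w i \<in> adic_null h" using bs assms(3) unfolding tate_basis_def by blast
  then have "h ^ m dvd w i m" by (simp add: adic_null_def)
  then have "h ^ m dvd w i m + h ^ m * s i m" by simp
  then show ?thesis by (simp add: w_def)
qed

text \<open>Polynomials of degree below \<open>degree h\<close> represent \<open>A/h\<close>, so
  independence modulo \<open>h\<close> makes the map from coefficient tuples injective.\<close>

lemma card_lin_combs:
  assumes "\<And>a i. (\<Sum>i<l. act (a i) (x i)) = 0 \<Longrightarrow> i < l \<Longrightarrow> h dvd a i"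
  shows "card ((\<lambda>a. \<Sum>i<l. act (a i) (x i)) ` (PiE {..<l} (\<lambda>_. {a. degree a < degree h}))) = q ^ (degree h * l)"
proof -
  have "inj_on (\<lambda>a. \<Sum>i<l. act (a i) (x i)) (PiE {..<l} (\<lambda>_. {a. degree a < degree h}))"
  proof (rule inj_onI)
    fix a b assume a: "a \<in> PiE {..<l} (\<lambda>_. {a. degree a < degree h})"
      and b: "b \<in> PiE {..<l} (\<lambda>_. {a. degree a < degree h})"
      and eq: "(\<Sum>i<l. act (a i) (x i)) = (\<Sum>i<l. act (b i) (x i))"
    show "a = b"
    proof (rule PiE_ext[OF a b])
      fix i assume i: "i \<in> {..<l}"
      have "(\<Sum>i<l. act (a i - b i) (x i)) = 0" using eq by (simp add: act_diff sum_subtractf)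
      then have "h dvd a i - b i" using assms[of "\<lambda>i. a i - b i" i] i by simp
      moreover have "degree (a i - b i) < degree h"
        using PiE_mem[OF a i] PiE_mem[OF b i] by (simp add: degree_diff_less)
      ultimately show "a i = b i" by (metis dvd_imp_degree_le eq_iff_diff_eq_0 leD)
    qed
  qed
  then have "card ((\<lambda>a. \<Sum>i<l. act (a i) (x i)) ` (PiE {..<l} (\<lambda>_. {a. degree a < degree h}))) =
      card (PiE {..<l} (\<lambda>_. {a :: 'a poly. degree a < degree h}))" by (rule card_image)
  also have "\<dots> = q ^ (degree h * l)"
    by (simp add: card_PiE card_degree_less[OF degree_monic_prime[OF h]] power_mult)
  finally show ?thesis .
qed

lemma degree_mod_h: "degree (u mod h) < degree h"
  using degree_mod_less[OF monic_prime_nz[OF h], of u] degree_monic_prime[OF h] by auto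

lemma act_mod_h: "act h x = 0 \<Longrightarrow> act (a mod h) x = act a x"
proof -
  assume "act h x = 0"
  then have "act (a div h * h) x = 0" by (simp add: act_mult)
  moreover have "a = a div h * h + a mod h" by simp
  ultimately show ?thesis by (metis act_add add_0)
qed

lemma act_lin_comb_eq_0:
  assumes "\<And>i. i < l \<Longrightarrow> act h (x i) = 0"
  shows "act h (\<Sum>i<l. act (a i) (x i)) = 0"
  unfolding frob_act_sum_right
proof (rule sum.neutral, rule ballI)
  fix i assume "i \<in> {..<l}"
  then show "act h (act (a i) (x i)) = 0" by (subst act_commute) (simp add: assms)
qed

text \<open>The level 1 components of a basis form an \<open>A/h\<close>-basis of the
  \<open>h\<close>-torsion, whose cardinality is known from \<open>card_torsion_h\<close>.\<close>

lemma length_tate_basis: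
  assumes bs: "tate_basis \<phi> \<xi> h bs"
  shows "length bs = r0"
proof -
  define x where "x = (\<lambda>i. (bs ! i) 1)"
  have x: "act h (x i) = 0" if "i < length bs" for i
    using tate_torsion[OF tate_basis_mem[OF bs that], of 1] by (simp add: x_def)
  let ?P = "PiE {..<length bs} (\<lambda>_. {a :: 'a poly. degree a < degree h})"
  have "(\<lambda>a. \<Sum>i<length bs. act (a i) (x i)) ` ?P = {y. act h y = 0}"
  proof (intro equalityI subsetI)
    fix y assume "y \<in> (\<lambda>a. \<Sum>i<length bs. act (a i) (x i)) ` ?P"
    then obtain a where y: "y = (\<Sum>i<length bs. act (a i) (x i))" by (rule imageE)
    show "y \<in> {y. act h y = 0}" unfolding y mem_Collect_eq
      by (rule act_lin_comb_eq_0) (rule x)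
  next
    fix y assume "y \<in> {y. act h y = 0}"
    then obtain a where y0: "y = (\<Sum>i<length bs. act (a i) (x i))"
      using tate_basis_gen[OF bs, of 1 y] by (auto simp: x_def)
    define a' where "a' = restrict (\<lambda>i. a i mod h) {..<length bs}"
    have y: "y = (\<Sum>i<length bs. act (a' i) (x i))" unfolding y0
      by (intro sum.cong) (auto simp: act_mod_h x a'_def)
    have "a' \<in> ?P" by (simp add: a'_def restrict_PiE_iff degree_mod_h)
    then show "y \<in> (\<lambda>a. \<Sum>i<length bs. act (a i) (x i)) ` ?P" unfolding y by (rule imageI)
  qed
  moreover have "card ((\<lambda>a. \<Sum>i<length bs. act (a i) (x i)) ` ?P) = q ^ (degree h * length bs)"
    by (rule card_lin_combs) (use tate_basis_indep[OF bs, of _ 1] in \<open>auto simp: x_def\<close>)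
  ultimately have "q ^ (degree h * length bs) = q ^ (r0 * degree h)"
    using card_torsion_h(1)[of 1] by simp
  then show ?thesis using degree_monic_prime[OF h] by simp
qed

text \<open>A maximal \<open>A/h\<close>-independent family in the \<open>h\<close>-torsion is
  lifted to the Tate module. As in Nakayama's lemma, generation and independence at level 1
  propagate to all levels.\<close>

lemma tate_basis_exists: "\<exists>bs. tate_basis \<phi> \<xi> h bs"
proof -
  define V where "V = {x. act h x = 0}"
  define indep where "indep = (\<lambda>xs. set xs \<subseteq> V \<and>
    (\<forall>a. (\<Sum>i<length xs. act (a i) (xs ! i)) = 0 \<longrightarrow> (\<forall>i<length xs. h dvd a i)))"
  have V: "card V = q ^ (r0 * degree h)" "finite V" using card_torsion_h[of 1] by (simp_all add: V_def)
  have bound: "length xs \<le> r0" if "indep xs" for xs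
  proof -
    have xs: "xs ! i \<in> V" if "i < length xs" for i
      using \<open>indep xs\<close> that by (auto simp: indep_def)
    let ?C = "(\<lambda>a. \<Sum>i<length xs. act (a i) (xs ! i)) ` (PiE {..<length xs} (\<lambda>_. {a. degree a < degree h}))"
    have "?C \<subseteq> V"
    proof (clarify)
      fix a
      have "act h (\<Sum>i<length xs. act (a i) (xs ! i)) = 0"
        by (rule act_lin_comb_eq_0) (use xs in \<open>simp add: V_def\<close>)
      then show "(\<Sum>i<length xs. act (a i) (xs ! i)) \<in> V" by (simp add: V_def)
    qed
    then have "card ?C \<le> card V" by (rule card_mono[OF V(2)])
    moreover have "card ?C = q ^ (degree h * length xs)"
      by (rule card_lin_combs) (use that in \<open>auto simp: indep_def\<close>)
    ultimately have "q ^ (degree h * length xs) \<le> q ^ (r0 * degree h)" using V(1) by simp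
    then have "degree h * length xs \<le> r0 * degree h"
      by (rule power_le_imp_le_exp[OF q_gt_1])
    then show ?thesis using degree_monic_prime[OF h] by (simp add: mult.commute)
  qed
  have "indep []" by (simp add: indep_def)
  then have "\<exists>xs. indep xs \<and> (\<forall>ys. indep ys \<longrightarrow> length ys \<le> length xs)"
    by (rule Lattices_Big.ex_has_greatest_nat[of indep "[]" length "Suc r0"])
      (blast intro: le_imp_less_Suc bound)
  then obtain xs where xs: "indep xs" and max: "\<And>ys. indep ys \<Longrightarrow> length ys \<le> length xs"
    by blast
  let ?l = "length xs"
  \<comment> \<open>Maximality gives a relation that involves \<open>x\<close>; the coefficient of
    \<open>x\<close> is prime to \<open>h\<close>, hence invertible on the \<open>h\<close>-torsion
    by Bezout.\<close>
  have gen: "\<exists>a. x = (\<Sum>i<?l. act (a i) (xs ! i))" if x: "x \<in> V" for x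
  proof -
    have "\<not> indep (xs @ [x])" using max[of "xs @ [x]"] by auto
    then obtain a where a: "(\<Sum>i<Suc ?l. act (a i) ((xs @ [x]) ! i)) = 0" "\<exists>i<Suc ?l. \<not> h dvd a i"
      using x xs unfolding indep_def by auto
    have sum0: "(\<Sum>i<?l. act (a i) (xs ! i)) + act (a ?l) x = 0"
      using a(1) by (simp add: nth_append)
    have "\<not> h dvd a ?l"
    proof
      assume d: "h dvd a ?l"
      then have "act (a ?l) x = 0" using x by (auto simp: V_def mult.commute[of h] act_mult elim!: dvdE)
      then have "\<forall>i<?l. h dvd a i" using sum0 xs by (simp add: indep_def)
      then show False using d a(2) less_Suc_eq by blast
    qed
    then have "coprime h (a ?l)"
      using h by (intro field_poly_irreducible_coprime) (auto simp: monic_primes_def)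
    then obtain u v where uv: "u * h + v * a ?l = 1" by (rule field_poly_coprime_bezout)
    have "x = act (u * h + v * a ?l) x" unfolding uv by simp
    also have "\<dots> = act v (act (a ?l) x)" using x by (simp add: act_add act_mult V_def)
    also have "act (a ?l) x = - (\<Sum>i<?l. act (a i) (xs ! i))"
      using sum0 by (simp add: eq_neg_iff_add_eq_0 add.commute)
    also have "act v \<dots> = (\<Sum>i<?l. act (- v * a i) (xs ! i))"
      by (simp add: frob_act_uminus frob_act_sum_right act_mult act_uminus sum_negf)
    finally show ?thesis by (intro exI[of _ "\<lambda>i. - v * a i"])
  qed
  have "\<exists>t. t \<in> tate h \<and> t 1 = xs ! i" if "i < ?l" for i
  proof -
    have "xs ! i \<in> V" using xs nth_mem[OF that] by (auto simp: indep_def)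
    then have "act (h ^ 1) (xs ! i) = 0" by (simp add: V_def)
    from tate_lift[OF monic_prime_nz[OF h] this] show ?thesis by metis
  qed
  then obtain t where t: "\<And>i. i < ?l \<Longrightarrow> t i \<in> tate h" "\<And>i. i < ?l \<Longrightarrow> t i 1 = xs ! i" by metis
  define bs where "bs = map t [0..<?l]"
  have bs: "length bs = ?l" "\<And>i. i < ?l \<Longrightarrow> bs ! i = t i" by (auto simp: bs_def)
  \<comment> \<open>Multiplication by \<open>h ^ m\<close> pushes a relation at level
    \<open>Suc m\<close> down to level 1, where \<open>h\<close> divides all coefficients;
    cancelling one \<open>h\<close> leaves a relation at level \<open>m\<close>.\<close>
  have indep_level: "\<forall>i<?l. h ^ m dvd a i" if "(\<Sum>i<?l. act (a i) (t i m)) = 0" for a m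
    using that
  proof (induction m arbitrary: a)
    case (Suc m)
    have "0 = act (h ^ m) (\<Sum>i<?l. act (a i) (t i (Suc m)))" using Suc.prems by simp
    also have "\<dots> = (\<Sum>i<?l. act (a i) (act (h ^ m) (t i (Suc m))))"
      by (simp add: frob_act_sum_right act_commute)
    also have "\<dots> = (\<Sum>i<?l. act (a i) (xs ! i))"
    proof (intro sum.cong refl)
      fix i assume "i \<in> {..<?l}"
      then show "act (a i) (act (h ^ m) (t i (Suc m))) = act (a i) (xs ! i)"
        using tate_shift[of "t i" h m 1] t by simp
    qed
    finally have "\<forall>i<?l. h dvd a i" using xs by (simp add: indep_def)
    moreover define c where "c = (\<lambda>i. a i div h)"
    ultimately have c: "a i = c i * h" if "i < ?l" for i using that by simp
    have "(\<Sum>i<?l. act (a i) (t i (Suc m))) = (\<Sum>i<?l. act (c i) (t i m))"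
    proof (intro sum.cong refl)
      fix i assume "i \<in> {..<?l}"
      then show "act (a i) (t i (Suc m)) = act (c i) (t i m)"
        using c t(1)[of i] by (simp add: act_mult tate_def)
    qed
    then have "\<forall>i<?l. h ^ m dvd c i" using Suc by simp
    then show ?case using c by (simp add: mult.commute[of h] mult_dvd_mono)
  qed simp
  have "tate_basis \<phi> \<xi> h bs"
    unfolding tate_basis_def tate_module_eq
  proof (intro conjI ballI allI impI)
    show "set bs \<subseteq> tate h" using t(1) by (auto simp: bs_def)
  next
    fix x assume x: "x \<in> tate h"
    define co where "co = (\<lambda>y. SOME a. y = (\<Sum>i<?l. act (a i) (xs ! i)))"
    have co: "y = (\<Sum>i<?l. act (co y i) (xs ! i))" if "y \<in> V" for y
      unfolding co_def using someI_ex[OF gen[OF that]] .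
    \<comment> \<open>Subtracting from \<open>y\<close> the combination of the \<open>t i\<close>
      that matches it at level 1 leaves a multiple of \<open>h\<close>; \<open>next_tate y\<close>
      is the quotient by \<open>h\<close>.\<close>
    define next_tate where "next_tate = (\<lambda>y k. y (Suc k) - (\<Sum>i<?l. act (co (y 1) i) (t i (Suc k))))"
    define tail where "tail = (\<lambda>j. (next_tate ^^ j) x)"
    have step: "next_tate y \<in> tate h \<and>
        (\<forall>k. act h (next_tate y k) = y k - (\<Sum>i<?l. act (co (y 1) i) (t i k)))" if y: "y \<in> tate h" for y
    proof -
      define w where "w = (\<lambda>k. y k - (\<Sum>i<?l. act (co (y 1) i) (t i k)))"
      have w: "w \<in> tate h" unfolding w_def
        by (intro tate_diff tate_sum tate_smult_const y) (use t in auto)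
      have "y 1 \<in> V" using tate_torsion[OF y, of 1] by (simp add: V_def)
      then have "w 1 = 0" using co t(2) by (simp add: w_def)
      then have "(\<lambda>k. w (1 + k)) \<in> tate h" by (rule tate_div[OF w])
      then show ?thesis using w by (simp add: w_def next_tate_def tate_def)
    qed
    have tail: "tail j \<in> tate h" for j
      by (induction j) (use x step in \<open>auto simp: tail_def\<close>)
    \<comment> \<open>The \<open>h\<close>-adic expansion whose digits are the successive level 1
      coordinates. At level \<open>m\<close> the first \<open>m\<close> digits suffice, because
      \<open>h ^ m\<close> kills the remainder there.\<close>
    define s where "s = (\<lambda>i m. \<Sum>j<m. h ^ j * co (tail j 1) i)"
    have expand: "x k = (\<Sum>i<?l. act (s i m) (t i k)) + act (h ^ m) (tail m k)" for m k
    proof (induction m)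
      case 0
      then show ?case by (simp add: s_def tail_def)
    next
      case (Suc m)
      have "act (h ^ Suc m) (tail (Suc m) k) = act (h ^ m) (act h (next_tate (tail m) k))"
        by (simp add: tail_def act_mult act_commute)
      also have "\<dots> = act (h ^ m) (tail m k) - (\<Sum>i<?l. act (h ^ m * co (tail m 1) i) (t i k))"
        using step[OF tail] by (simp add: frob_act_minus frob_act_sum_right act_mult)
      finally show ?case
        using Suc by (simp add: s_def act_add sum.distrib)
    qed
    have "x = (\<Sum>i<length bs. tate_smult \<phi> \<xi> (s i) (bs ! i))"
    proof
      fix m
      show "x m = (\<Sum>i<length bs. tate_smult \<phi> \<xi> (s i) (bs ! i)) m"
        unfolding tate_lin_comb using expand[of m m] tate_torsion[OF tail, of m] bs by simp
    qed
    moreover have "s i \<in> adic_seqs h" for i by (simp add: adic_seqs_def s_def)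
    ultimately show "\<exists>s. (\<forall>i<length bs. s i \<in> adic_seqs h) \<and>
        x = (\<Sum>i<length bs. tate_smult \<phi> \<xi> (s i) (bs ! i))"
      by (intro exI[of _ s]) simp
  next
    fix s i
    assume s: "(\<forall>i<length bs. s i \<in> adic_seqs h) \<and> (\<Sum>i<length bs. tate_smult \<phi> \<xi> (s i) (bs ! i)) = 0"
      and i: "i < length bs"
    have "h ^ m dvd s i m" for m
    proof -
      have "(\<Sum>i<length bs. tate_smult \<phi> \<xi> (s i) (bs ! i)) m = 0" using s by simp
      then have "(\<Sum>i<?l. act (s i m) (t i m)) = 0" unfolding tate_lin_comb using bs by simp
      from indep_level[OF this] show ?thesis using i bs(1) by simp
    qed
    then show "s i \<in> adic_null h" by (simp add: adic_null_def)
  qed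
  then show ?thesis by blast
qed

end

end

section \<open>The characteristic polynomial of Frobenius\<close>

context fq_hom begin

definition frobp :: "nat \<Rightarrow> 'l poly \<Rightarrow> 'l poly" where
  "frobp n = map_poly (\<lambda>x. x ^ (q ^ n))"

lemma coeff_frobp: "coeff (frobp n p) k = coeff p k ^ (q ^ n)"
  by (simp add: frobp_def coeff_map_poly zero_power)

lemma frobp_hom: "comm_ring_hom (frobp n)"
proof -
  interpret F: field_hom "\<lambda>x :: 'l. x ^ (q ^ n)" by (rule field_hom_frob_pow)
  interpret F1: map_poly_comm_ring_hom "\<lambda>x :: 'l. x ^ (q ^ n)" ..
  show ?thesis unfolding frobp_def by unfold_locales
qed

lemma frobp_frobp: "frobp m (frobp n p) = frobp (m + n) p"
  by (rule poly_eqI) (simp add: coeff_frobp power_add mult.commute flip: power_mult)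

lemma frobp_0 [simp]: "frobp 0 p = p"
  by (rule poly_eqI) (simp add: coeff_frobp)

lemma frobp_map_poly: "frobp n (map_poly \<iota> a) = map_poly \<iota> a"
  by (rule poly_eqI) (simp add: coeff_frobp coeff_map_poly)

lemma frobp_shift_coeff: "frobp m (shift_coeff \<xi> \<Phi> j s) = shift_coeff \<xi> \<Phi> (j + m) s"
proof -
  interpret F: field_hom "\<lambda>x :: 'l. x ^ (q ^ m)" by (rule field_hom_frob_pow)
  show ?thesis
    by (rule poly_eqI)
      (auto simp: coeff_frobp shift_coeff_def coeff_pCons F.hom_uminus ev_pow_q_pow power_add
        zero_power simp flip: power_mult split: nat.splits)
qed

end

section \<open>Torsion points as solutions of the recurrence, and the transfer matrix\<close>

context drinfeld_reduction begin

abbreviation rc :: "nat \<Rightarrow> nat \<Rightarrow> 'a alg_closure poly" where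
  "rc \<equiv> shift_coeff \<xi> (\<phi> theta)"

abbreviation mp :: "'a poly \<Rightarrow> 'a alg_closure poly" where
  "mp \<equiv> map_poly to_ac"

lemma rc_0: "rc j 0 = [:- (\<xi> ^ (q ^ j)), 1:]"
  by (rule shift_coeff_0[OF f root phi_theta_0])

lemma rc_pos: "s > 0 \<Longrightarrow> rc j s = [:- (ev \<xi> (coeff (\<phi> theta) s) ^ (q ^ j)):]"
  by (simp add: shift_coeff_def ev_pow_q_pow)

lemma rc_top: "rc j r0 = [:- (ev \<xi> (coeff (\<phi> theta) r0) ^ (q ^ j)):]"
  using red_rank_pos by (simp add: rc_pos)

text \<open>
  A point \<open>x\<close> of the \<open>H\<close>-torsion gives the functional \<open>a \<mapsto> \<phi>\<^sub>a(x)\<close> on \<open>A/H\<close>. Under the residue pairing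
  it corresponds to a class modulo \<open>H\<close>, represented by the following polynomial (a truncated
  Anderson generating function).
\<close>

definition gen :: "'a poly \<Rightarrow> 'a alg_closure \<Rightarrow> 'a alg_closure poly" where
  "gen H x = (\<Sum>k<degree H. monom (act (poly_shift (Suc k) H) x) k)"

lemma coeff_gen: "coeff (gen H x) k = act (poly_shift (Suc k) H) x"
proof -
  have "poly_shift (Suc k) H = 0" if "\<not> k < degree H"
    by (rule poly_eqI) (use that in \<open>simp add: coeff_poly_shift coeff_eq_0\<close>)
  then show ?thesis by (simp add: gen_def coeff_sum)
qed

lemma gen_add: "gen H (x + y) = gen H x + gen H y"
  by (rule poly_eqI) (simp add: coeff_gen frob_act_plus)

lemma gen_0 [simp]: "gen H 0 = 0"
  by (rule poly_eqI) (simp add: coeff_gen)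

lemma gen_sum: "gen H (\<Sum>i\<in>I. x i) = (\<Sum>i\<in>I. gen H (x i))"
  by (induction I rule: infinite_finite_induct) (auto simp: gen_add)

lemma gen_frob: "gen H (x ^ (q ^ degree f)) = frobp (degree f) (gen H x)"
  by (rule poly_eqI) (simp add: coeff_gen coeff_frobp act_frob)

lemma gen_const: "gen H (act [:c:] x) = smult (to_ac c) (gen H x)"
proof (rule poly_eqI)
  fix k
  have "act b (act [:c:] x) = to_ac c * act b x" for b by (subst act_commute) (rule act_const)
  then show "coeff (gen H (act [:c:] x)) k = coeff (smult (to_ac c) (gen H x)) k"
    by (simp only: coeff_gen coeff_smult)
qed

text \<open>Horner's rule for evaluating \<open>H\<close> through the Drinfeld module.\<close>

lemma act_shift: "act theta (act (poly_shift (Suc k) H) x) = act (poly_shift k H) x - to_ac (coeff H k) * x"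
proof -
  have "poly_shift k H = theta * poly_shift (Suc k) H + [:coeff H k:]"
    by (rule poly_eqI) (auto simp: coeff_poly_shift coeff_pCons split: nat.splits)
  then have "act (poly_shift k H) x = act (theta * poly_shift (Suc k) H + [:coeff H k:]) x" by (rule arg_cong)
  also have "\<dots> = act theta (act (poly_shift (Suc k) H) x) + to_ac (coeff H k) * x"
    by (simp only: act_add act_mult act_const)
  finally show ?thesis by simp
qed

text \<open>The functional equation of the Anderson generating function: Horner's rule telescopes,
  and the truncation appears as the multiple of \<open>H\<close> on the right. The torsion
  hypothesis enters in the constant coefficient.\<close>

lemma theta_gen:
  assumes "act H x = 0"
  shows "[:0, 1:] * gen H x - gen H (act theta x) = smult x (mp H)"
proof (rule poly_eqI)
  fix k
  have "coeff (gen H (act theta x)) k = act (poly_shift k H) x - to_ac (coeff H k) * x"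
    unfolding coeff_gen by (simp only: act_commute[of _ theta] act_shift)
  moreover have "coeff ([:0, 1:] * gen H x) k = act (poly_shift k H) x"
    using assms by (cases k) (simp_all add: coeff_gen)
  ultimately show "coeff ([:0, 1:] * gen H x - gen H (act theta x)) k = coeff (smult x (mp H)) k"
    by (simp add: coeff_map_poly mult.commute)
qed

lemma gen_rec_0:
  assumes "act H x = 0"
  shows "(\<Sum>s\<le>r0. rc 0 s * frobp s (gen H x)) = smult x (mp H)"
proof -
  have "gen H (act theta x) = (\<Sum>s\<le>r0. smult (ev \<xi> (coeff (\<phi> theta) s)) (frobp s (gen H x)))"
  proof (rule poly_eqI)
    fix k
    have "act b (act theta x) = (\<Sum>s\<le>r0. ev \<xi> (coeff (\<phi> theta) s) * act b x ^ (q ^ s))" for b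
      by (subst act_commute) (rule act_theta)
    then show "coeff (gen H (act theta x)) k =
        coeff (\<Sum>s\<le>r0. smult (ev \<xi> (coeff (\<phi> theta) s)) (frobp s (gen H x))) k"
      by (simp only: coeff_gen coeff_sum coeff_smult coeff_frobp)
  qed
  then have "smult x (mp H) = [:0, 1:] * gen H x - (\<Sum>s\<le>r0. smult (ev \<xi> (coeff (\<phi> theta) s)) (frobp s (gen H x)))"
    using theta_gen[OF assms] by simp
  also have "\<dots> = (\<Sum>s\<le>r0. (if s = 0 then [:0, 1:] * gen H x else 0) - smult (ev \<xi> (coeff (\<phi> theta) s)) (frobp s (gen H x)))"
    by (simp add: sum_subtractf)
  also have "\<dots> = (\<Sum>s\<le>r0. rc 0 s * frobp s (gen H x))"
  proof (intro sum.cong refl)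
    fix s
    show "(if s = 0 then [:0, 1:] * gen H x else 0) - smult (ev \<xi> (coeff (\<phi> theta) s)) (frobp s (gen H x)) =
        rc 0 s * frobp s (gen H x)"
      by (cases "s = 0") (simp_all add: rc_0 rc_pos phi_theta_0)
  qed
  finally show ?thesis by simp
qed

text \<open>Twisting \<open>gen_rec_0\<close> by \<open>frobp j\<close> moves the coefficients from
  row 0 to row \<open>j\<close> and fixes \<open>H\<close>, which is defined over the finite field.
  Thus the successive twists solve the recurrence modulo \<open>H\<close>.\<close>

lemma gen_rec:
  assumes "act H x = 0"
  shows "mp H dvd (\<Sum>s\<le>r0. rc j s * frobp (j + s) (gen H x))"
proof -
  interpret F: comm_ring_hom "frobp j" by (rule frobp_hom)
  have "(\<Sum>s\<le>r0. rc j s * frobp (j + s) (gen H x)) = frobp j (\<Sum>s\<le>r0. rc 0 s * frobp s (gen H x))"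
    by (simp add: F.hom_sum F.hom_mult frobp_shift_coeff frobp_frobp)
  also have "\<dots> = frobp j ([:x:] * mp H)" by (simp add: gen_rec_0[OF assms])
  also have "\<dots> = frobp j [:x:] * mp H" by (simp only: F.hom_mult frobp_map_poly)
  finally show ?thesis by simp
qed

text \<open>By \<open>theta_gen\<close>, the action of \<open>\<theta>\<close> becomes
  multiplication by the variable modulo \<open>H\<close>; this extends to all of \<open>A\<close> by
  Horner's rule.\<close>

lemma gen_act:
  assumes "act H x = 0"
  shows "mp H dvd gen H (act a x) - mp a * gen H x"
proof (induction a)
  case (pCons c a)
  have "pCons c a = [:c:] + theta * a" by simp
  then have act: "act (pCons c a) x = act [:c:] x + act theta (act a x)"
    by (simp only: act_add act_mult)
  have "act H (act a x) = 0" using act_commute[of H a x] assms by simp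
  then have "[:0, 1:] * gen H (act a x) - gen H (act theta (act a x)) = smult (act a x) (mp H)"
    by (rule theta_gen)
  then have g: "gen H (act theta (act a x)) = [:0, 1:] * gen H (act a x) - [:act a x:] * mp H"
    by (simp add: algebra_simps)
  have "mp (pCons c a) = [:to_ac c:] + [:0, 1:] * mp a"
    by (rule poly_eqI) (simp add: coeff_map_poly coeff_pCons split: nat.splits)
  then have eq: "gen H (act (pCons c a) x) - mp (pCons c a) * gen H x =
      [:0, 1:] * (gen H (act a x) - mp a * gen H x) - [:act a x:] * mp H"
    unfolding act gen_add gen_const g by (simp only: ) (simp add: algebra_simps)
  show ?case unfolding eq by (intro dvd_diff dvd_mult dvd_refl pCons.IH)
qed simp

text \<open>The \<open>c\<close>-th fundamental solution of the recurrence. The top coefficient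
  \<open>rc j r0\<close> is minus a nonzero constant, so solving for the next term needs no sign and
  stays within polynomials.\<close>

function sol :: "nat \<Rightarrow> nat \<Rightarrow> 'a alg_closure poly" where
  "sol c n = (if n < r0 then (if n = c then 1 else 0)
     else smult (inverse (ev \<xi> (coeff (\<phi> theta) r0) ^ (q ^ (n - r0))))
       (\<Sum>s<r0. rc (n - r0) s * sol c (n - r0 + s)))"
  by auto
termination by (relation "measure snd") auto

declare sol.simps [simp del]

lemma sol_init: "n < r0 \<Longrightarrow> sol c n = (if n = c then 1 else 0)"
  by (simp add: sol.simps)

lemma sol_rec: "(\<Sum>s\<le>r0. rc j s * sol c (j + s)) = 0"
proof -
  define b where "b = ev \<xi> (coeff (\<phi> theta) r0) ^ (q ^ j)"
  have b: "b \<noteq> 0" using coeff_red_rank by (simp add: b_def)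
  have "sol c (j + r0) = smult (inverse b) (\<Sum>s<r0. rc j s * sol c (j + s))"
    by (subst sol.simps) (simp add: b_def)
  then have "rc j r0 * sol c (j + r0) = - (\<Sum>s<r0. rc j s * sol c (j + s))"
    using b by (simp add: rc_top b_def[symmetric])
  moreover have "{..r0} = insert r0 {..<r0}" by auto
  ultimately show ?thesis by simp
qed

text \<open>The difference solves the recurrence modulo \<open>M\<close> with zero initial values,
  and the top coefficient, a nonzero constant, can be cancelled modulo \<open>M\<close>.\<close>

lemma dvd_solution:
  fixes w :: "nat \<Rightarrow> 'a alg_closure poly"
  assumes "\<And>j. M dvd (\<Sum>s\<le>r0. rc j s * w (j + s))"
  shows "M dvd w n - (\<Sum>c<r0. sol c n * w c)"
proof (induction n rule: less_induct)
  case (less n)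
  show ?case
  proof (cases "n < r0")
    case True
    then have "(\<Sum>c<r0. sol c n * w c) = (\<Sum>c<r0. if c = n then w c else 0)"
      by (intro sum.cong) (auto simp: sol_init)
    then show ?thesis using True by simp
  next
    case False
    then obtain j where n: "n = j + r0" by (metis add.commute le_Suc_ex not_less)
    define D where "D = (\<lambda>n. w n - (\<Sum>c<r0. sol c n * w c))"
    have "(\<Sum>s\<le>r0. rc j s * D (j + s)) =
        (\<Sum>s\<le>r0. rc j s * w (j + s)) - (\<Sum>s\<le>r0. \<Sum>c<r0. (rc j s * sol c (j + s)) * w c)"
      by (simp add: D_def algebra_simps sum_subtractf sum_distrib_left)
    also have "(\<Sum>s\<le>r0. \<Sum>c<r0. (rc j s * sol c (j + s)) * w c) =
        (\<Sum>c<r0. (\<Sum>s\<le>r0. rc j s * sol c (j + s)) * w c)"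
      by (subst sum.swap) (simp add: sum_distrib_right)
    also have "\<dots> = 0" by (simp only: sol_rec) simp
    finally have "M dvd (\<Sum>s\<le>r0. rc j s * D (j + s))" using assms by simp
    moreover have "(\<Sum>s\<le>r0. rc j s * D (j + s)) = rc j r0 * D n + (\<Sum>s<r0. rc j s * D (j + s))"
    proof -
      have "{..r0} = insert r0 {..<r0}" by auto
      then show ?thesis by (simp add: n)
    qed
    moreover have "M dvd (\<Sum>s<r0. rc j s * D (j + s))"
      by (intro dvd_sum dvd_mult) (use less n in \<open>auto simp: D_def\<close>)
    ultimately have "M dvd rc j r0 * D n" by (simp add: dvd_add_left_iff)
    then show ?thesis
      unfolding rc_top D_def using coeff_red_rank by (simp add: dvd_smult_iff)
  qed
qed

definition trans_mat :: "'a alg_closure poly mat" where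
  "trans_mat = mat r0 r0 (\<lambda>(i, c). sol c (degree f + i))"

lemma char_poly_trans_mat:
  "char_poly trans_mat =
     det (mat r0 r0 (\<lambda>(i, c). (if i = c then [:0, 1:] else 0) - [:sol c (degree f + i):]))"
  unfolding char_poly_defs by (intro arg_cong[of _ _ det] eq_matI) (auto simp: trans_mat_def)

text \<open>This is \<open>det_cyclic_recurrence\<close> with the fundamental solutions
  \<open>sol\<close>. The top coefficients are constants, so their product and the unknown sign
  combine to one scalar \<open>b\<close>.\<close>

lemma shift_det_eq_char_poly:
  obtains b where "b \<noteq> 0" "shift_det \<xi> (degree f) (\<phi> theta) = smult [:b:] (char_poly trans_mat)"
proof -
  have "shift_det \<xi> (degree f) (\<phi> theta) = cyc_det (degree f) r0 (\<lambda>j s. [:rc j s:]) [:0, 1:]"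
    unfolding shift_det_def
    by (rule cyc_det_truncate[OF red_rank_bounds(2)]) (simp add: rc_pos coeff_gt_red_rank zero_power)
  moreover have "\<exists>\<epsilon>. \<epsilon> * \<epsilon> = 1 \<and> cyc_det (degree f) r0 (\<lambda>j s. [:rc j s:]) [:0, 1:] =
    \<epsilon> * (\<Prod>j<degree f. [:rc j r0:]) *
      det (mat r0 r0 (\<lambda>(i, c). (if i = c then [:0, 1:] else 0) - [:sol c (degree f + i):]))"
  proof (rule det_cyclic_recurrence[OF degree_monic_prime[OF f]])
    show "(\<Sum>s\<le>r0. [:rc j s:] * [:sol c (j + s):]) = 0" if "c < r0" for c j
    proof -
      have "(\<Sum>s\<le>r0. [:rc j s:] * [:sol c (j + s):]) = [:\<Sum>s\<le>r0. rc j s * sol c (j + s):]"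
        by (rule poly_eqI) (simp add: coeff_sum coeff_pCons mult.commute split: nat.splits)
      then show ?thesis by (simp only: sol_rec) simp
    qed
  qed (simp_all add: sol_init one_pCons)
  ultimately obtain \<epsilon> where \<epsilon>: "\<epsilon> * \<epsilon> = 1"
    "shift_det \<xi> (degree f) (\<phi> theta) = \<epsilon> * (\<Prod>j<degree f. [:rc j r0:]) * char_poly trans_mat"
    by (auto simp: char_poly_trans_mat)
  define b where "b = (\<Prod>j<degree f. - (ev \<xi> (coeff (\<phi> theta) r0) ^ (q ^ j)))"
  have b: "b \<noteq> 0" using coeff_red_rank by (simp add: b_def)
  have prod: "(\<Prod>j\<in>J. [:rc j r0:]) = [:[:\<Prod>j\<in>J. - (ev \<xi> (coeff (\<phi> theta) r0) ^ (q ^ j)):]:]" for J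
    by (induction J rule: infinite_finite_induct) (auto simp: rc_top one_pCons)
  have "\<epsilon> = 1 \<or> \<epsilon> = - 1" using \<epsilon>(1) by (simp add: square_eq_1_iff)
  then show ?thesis
  proof
    assume "\<epsilon> = 1"
    then show ?thesis using \<epsilon>(2) that[of b] b by (simp add: prod b_def)
  next
    assume "\<epsilon> = - 1"
    then show ?thesis using \<epsilon>(2) that[of "- b"] b by (simp add: prod b_def)
  qed
qed

end

section \<open>Congruences between determinants and between characteristic polynomials\<close>

lemma dvd_prod_diff:
  fixes A B :: "'b \<Rightarrow> 'r :: comm_ring_1"
  assumes "\<And>i. i \<in> I \<Longrightarrow> c dvd A i - B i"
  shows "c dvd (\<Prod>i\<in>I. A i) - (\<Prod>i\<in>I. B i)"
  using assms
proof (induction I rule: infinite_finite_induct)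
  case (insert i I)
  have "A i * (\<Prod>i\<in>I. A i) - B i * (\<Prod>i\<in>I. B i) =
      (A i - B i) * (\<Prod>i\<in>I. A i) + B i * ((\<Prod>i\<in>I. A i) - (\<Prod>i\<in>I. B i))"
    by (simp add: algebra_simps)
  moreover have "c dvd \<dots>" using insert by (intro dvd_add dvd_mult2 dvd_mult) auto
  ultimately show ?case using insert by simp
qed auto

lemma dvd_det_diff:
  fixes A B :: "nat \<times> nat \<Rightarrow> 'r :: comm_ring_1"
  assumes "\<And>i j. i < n \<Longrightarrow> j < n \<Longrightarrow> c dvd A (i, j) - B (i, j)"
  shows "c dvd det (mat n n A) - det (mat n n B)"
proof -
  have "c dvd signof p * (\<Prod>i = 0..<n. mat n n A $$ (i, p i)) - signof p * (\<Prod>i = 0..<n. mat n n B $$ (i, p i))"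
    if p: "p permutes {0..<n}" for p
  proof -
    have "p i < n" if "i < n" for i using permutes_in_image[OF p, of i] that by simp
    then have "c dvd (\<Prod>i = 0..<n. mat n n A $$ (i, p i)) - (\<Prod>i = 0..<n. mat n n B $$ (i, p i))"
      by (intro dvd_prod_diff) (auto intro!: assms)
    then show ?thesis by (metis dvd_mult right_diff_distrib)
  qed
  then show ?thesis
    by (subst (1 2) det_def'[of _ n]) (auto simp flip: sum_subtractf intro!: dvd_sum)
qed

lemma char_poly_mat:
  "char_poly (mat n n A) = det (mat n n (\<lambda>(i, j). (if i = j then [:0, 1:] else 0) - [:A (i, j):]))"
  unfolding char_poly_defs by (intro arg_cong[of _ _ det] eq_matI) auto

lemma sum_pCons_0: "(\<Sum>i\<in>I. [:g i:]) = [:\<Sum>i\<in>I. g i:]"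
  by (induction I rule: infinite_finite_induct) auto

text \<open>For \<open>c = 0\<close> this says that intertwined matrices have the same characteristic polynomial.\<close>

lemma dvd_char_poly_diff:
  fixes A B W :: "nat \<times> nat \<Rightarrow> 'r :: comm_ring_1"
  assumes "\<And>i j. i < n \<Longrightarrow> j < n \<Longrightarrow> c dvd (\<Sum>l<n. A (i, l) * W (l, j)) - (\<Sum>l<n. W (i, l) * B (l, j))"
  shows "c dvd det (mat n n W) * (coeff (char_poly (mat n n A)) k - coeff (char_poly (mat n n B)) k)"
proof -
  define W' where "W' = (\<lambda>(i, j). [:W (i, j):])"
  define A' where "A' = (\<lambda>(i, j). (if i = j then [:0, 1:] else 0) - [:A (i, j):])"
  define B' where "B' = (\<lambda>(i, j). (if i = j then [:0, 1:] else 0) - [:B (i, j):])"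
  \<comment> \<open>With \<open>X\<close> the variable of the characteristic polynomial,
    \<open>(X - A) W\<close> and \<open>W (X - B)\<close> are congruent entrywise modulo
    \<open>c\<close>, and so are their determinants.\<close>
  have "[:c:] dvd det (mat n n (\<lambda>(i, j). \<Sum>l<n. A' (i, l) * W' (l, j))) -
      det (mat n n (\<lambda>(i, j). \<Sum>l<n. W' (i, l) * B' (l, j)))"
  proof (rule dvd_det_diff, unfold split)
    fix i j assume ij: "i < n" "j < n"
    have "(\<Sum>l<n. A' (i, l) * W' (l, j)) =
        (\<Sum>l<n. (if l = i then [:0, 1:] * [:W (i, j):] else 0) - [:A (i, l) * W (l, j):])"
      by (intro sum.cong) (auto simp: A'_def W'_def algebra_simps)
    also have "\<dots> = [:0, 1:] * [:W (i, j):] - [:\<Sum>l<n. A (i, l) * W (l, j):]"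
      using ij(1) by (simp add: sum_subtractf sum_pCons_0)
    finally have 1: "(\<Sum>l<n. A' (i, l) * W' (l, j)) = \<dots>" .
    have "(\<Sum>l<n. W' (i, l) * B' (l, j)) =
        (\<Sum>l<n. (if l = j then [:0, 1:] * [:W (i, j):] else 0) - [:W (i, l) * B (l, j):])"
      by (intro sum.cong) (auto simp: B'_def W'_def algebra_simps)
    also have "\<dots> = [:0, 1:] * [:W (i, j):] - [:\<Sum>l<n. W (i, l) * B (l, j):]"
      using ij(2) by (simp add: sum_subtractf sum_pCons_0)
    finally have 2: "(\<Sum>l<n. W' (i, l) * B' (l, j)) = \<dots>" .
    have "c dvd (\<Sum>l<n. W (i, l) * B (l, j)) - (\<Sum>l<n. A (i, l) * W (l, j))"
      using assms[OF ij] by (metis dvd_minus_iff minus_diff_eq)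
    then obtain u where "(\<Sum>l<n. W (i, l) * B (l, j)) - (\<Sum>l<n. A (i, l) * W (l, j)) = c * u" by (rule dvdE)
    then have "(\<Sum>l<n. A' (i, l) * W' (l, j)) - (\<Sum>l<n. W' (i, l) * B' (l, j)) = [:c:] * [:u:]"
      unfolding 1 2 by simp
    then show "[:c:] dvd (\<Sum>l<n. A' (i, l) * W' (l, j)) - (\<Sum>l<n. W' (i, l) * B' (l, j))"
      by (rule dvdI)
  qed
  also have "det (mat n n (\<lambda>(i, j). \<Sum>l<n. A' (i, l) * W' (l, j))) = det (mat n n A') * det (mat n n W')"
    by (subst mat_mult_mat[symmetric]) (rule det_mult, auto)
  also have "det (mat n n (\<lambda>(i, j). \<Sum>l<n. W' (i, l) * B' (l, j))) = det (mat n n W') * det (mat n n B')"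
    by (subst mat_mult_mat[symmetric]) (rule det_mult, auto)
  also have "det (mat n n A') = char_poly (mat n n A)"
    by (simp add: char_poly_mat A'_def)
  also have "det (mat n n B') = char_poly (mat n n B)"
    by (simp add: char_poly_mat B'_def)
  also have "det (mat n n W') = [:det (mat n n W):]"
  proof -
    interpret C: comm_ring_hom "\<lambda>a :: 'r. [:a:]"
      by unfold_locales (auto simp: one_pCons)
    have "mat n n W' = map_mat (\<lambda>a. [:a:]) (mat n n W)"
      by (rule eq_matI) (auto simp: W'_def)
    then show ?thesis by (simp only: C.hom_det)
  qed
  finally have "[:c:] dvd [:det (mat n n W):] * (char_poly (mat n n A) - char_poly (mat n n B))"
    by (simp add: algebra_simps smult_diff_right)
  then obtain u where "[:det (mat n n W):] * (char_poly (mat n n A) - char_poly (mat n n B)) = [:c:] * u"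
    by (rule dvdE)
  from arg_cong[OF this, of "\<lambda>p. coeff p k"] show ?thesis by simp
qed

lemma coprime_if_no_common_root:
  fixes a b :: "'b :: alg_closed_field poly"
  assumes "a \<noteq> 0" "\<And>x. poly a x = 0 \<Longrightarrow> poly b x \<noteq> 0"
  shows "coprime a b"
proof (rule coprimeI)
  fix g assume g: "g dvd a" "g dvd b"
  show "is_unit g"
  proof (rule ccontr)
    assume "\<not> is_unit g"
    moreover have "g \<noteq> 0" using g(1) assms(1) by auto
    ultimately have "degree g > 0" by (metis gr0I is_unit_iff_degree)
    then obtain x where "poly g x = 0" using alg_closed_imp_poly_has_root by blast
    then show False using g assms(2) by (metis poly_eq_0_iff_dvd dvd_trans)
  qed
qed

lemma field_poly_coprime_dvd_mult:
  fixes a b c :: "'b :: field poly"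
  assumes "coprime a b" "a dvd b * c"
  shows "a dvd c"
proof -
  obtain u v where uv: "u * a + v * b = 1" using field_poly_coprime_bezout[OF assms(1)] .
  have "c = c * (u * a + v * b)" by (simp add: uv)
  also have "\<dots> = a * (u * c) + (b * c) * v" by (simp add: algebra_simps)
  finally show ?thesis using assms(2) by (metis dvd_add dvd_mult2 dvd_triv_left)
qed

section \<open>Comparison of the transfer matrix with Frobenius on torsion\<close>

context drinfeld_reduction begin

lemma degree_poly_shift: "k < degree H \<Longrightarrow> degree (poly_shift (Suc k) H) = degree H - Suc k"
proof (rule antisym)
  assume "k < degree H"
  show "degree (poly_shift (Suc k) H) \<le> degree H - Suc k"
    by (rule degree_le) (auto simp: coeff_poly_shift coeff_eq_0)
  show "degree H - Suc k \<le> degree (poly_shift (Suc k) H)"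
    by (rule le_degree) (use \<open>k < degree H\<close> in \<open>auto simp: coeff_poly_shift\<close>)
qed

lemma poly_frobp_gen:
  "poly (frobp i (gen H x)) \<eta> = (\<Sum>k<degree H. \<eta> ^ k * act (poly_shift (Suc k) H) x ^ (q ^ i))"
proof -
  interpret F: comm_ring_hom "frobp i" by (rule frobp_hom)
  have "frobp i (monom c k) = monom (c ^ (q ^ i)) k" for c k
    by (rule poly_eqI) (simp add: coeff_frobp zero_power)
  then have "frobp i (gen H x) = (\<Sum>k<degree H. monom (act (poly_shift (Suc k) H) x ^ (q ^ i)) k)"
    by (simp add: gen_def F.hom_sum)
  then show ?thesis by (simp add: poly_sum poly_monom mult.commute)
qed

text \<open>
  A linear relation between the rows would be an additive polynomial of degree less
  than \<open>q ^ (r0 * degree H)\<close>, the number of its zeros.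
\<close>

lemma gen_rows_independent:
  assumes H: "degree H > 0" "ev \<xi> H \<noteq> 0"
    and v: "i < r0" "v i \<noteq> 0"
    and zero: "\<And>x. act H x = 0 \<Longrightarrow> (\<Sum>i<r0. v i * poly (frobp i (gen H x)) \<eta>) = 0"
  shows False
proof -
  define N where "N = degree H"
  define T where "T = (\<lambda>i k. additive_poly (red (poly_shift (Suc k) H)) ^ (q ^ i))"
  define U where "U = (\<Sum>i<r0. \<Sum>k<N. smult (v i * \<eta> ^ k) (T i k))"
  have ne: "poly_shift (Suc k) H \<noteq> 0" if "k < N" for k
  proof -
    have "coeff (poly_shift (Suc k) H) (N - Suc k) = lead_coeff H" using that by (simp add: coeff_poly_shift N_def)
    moreover have "lead_coeff H \<noteq> 0" using H by auto
    ultimately show ?thesis by auto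
  qed
  have T: "degree (T i k) = q ^ (r0 * (N - Suc k) + i)" "T i k \<noteq> 0" if "k < N" for i k
  proof -
    have "additive_poly (red (poly_shift (Suc k) H)) \<noteq> 0"
      using red_degree[OF ne[OF that]] by (metis coeff_additive_poly coeff_0 leading_coeff_neq_0)
    moreover have "degree (additive_poly (red (poly_shift (Suc k) H))) = q ^ (r0 * (N - Suc k))"
      using red_degree[OF ne[OF that]] that by (simp add: degree_additive_poly degree_poly_shift N_def)
    ultimately show "degree (T i k) = q ^ (r0 * (N - Suc k) + i)" "T i k \<noteq> 0"
      by (simp_all add: T_def degree_power_eq power_add mult.commute)
  qed
  define i0 where "i0 = Max {i. i < r0 \<and> v i \<noteq> 0}"
  have fin: "finite {i. i < r0 \<and> v i \<noteq> 0}" by simp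
  have i0: "i0 < r0" "v i0 \<noteq> 0"
    using Max_in[OF fin] v unfolding i0_def by blast+
  have i0_max: "i \<le> i0" if "i < r0" "v i \<noteq> 0" for i
    unfolding i0_def by (rule Max_ge[OF fin]) (use that in auto)
  have N: "N > 0" using H by (simp add: N_def)
  \<comment> \<open>The degree of \<open>T i k\<close> is \<open>q\<close> to the power
    \<open>r0 * (N - Suc k) + i\<close> with \<open>i < r0\<close>. Terms with \<open>k > 0\<close>
    lie below \<open>r0 * (N - 1)\<close>, so \<open>D\<close> comes from \<open>k = 0\<close> and
    the largest index \<open>i0\<close> with \<open>v i0 \<noteq> 0\<close>; no other term can
    cancel it.\<close>
  define D where "D = r0 * (N - 1) + i0"
  have small: "r0 * (N - Suc k) + i < D" if "k < N" "i < r0" "v i \<noteq> 0" "(i, k) \<noteq> (i0, 0)" for i k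
  proof (cases k)
    case 0
    then have "i < i0" using i0_max[OF that(2,3)] that(4) by simp
    then show ?thesis using 0 by (simp add: D_def)
  next
    case (Suc k')
    have "N - 1 = Suc (N - Suc k) + k'" using that(1) Suc by simp
    then have "r0 * (N - 1) = r0 + r0 * (N - Suc k) + r0 * k'" by (simp add: algebra_simps)
    then show ?thesis using that(2) by (simp add: D_def)
  qed
  have "coeff U (q ^ D) = (\<Sum>i<r0. \<Sum>k<N. v i * \<eta> ^ k * coeff (T i k) (q ^ D))"
    by (simp add: U_def coeff_sum)
  also have "\<dots> = (\<Sum>i<r0. \<Sum>k<N. if i = i0 \<and> k = 0 then v i0 * coeff (T i0 0) (q ^ D) else 0)"
  proof (intro sum.cong refl)
    fix i k assume i: "i \<in> {..<r0}" and k: "k \<in> {..<N}"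
    show "v i * \<eta> ^ k * coeff (T i k) (q ^ D) =
        (if i = i0 \<and> k = 0 then v i0 * coeff (T i0 0) (q ^ D) else 0)"
    proof (cases "(i = i0 \<and> k = 0) \<or> v i = 0")
      case False
      then have "r0 * (N - Suc k) + i < D" using i k by (intro small) auto
      then have "degree (T i k) < q ^ D" using T(1)[of k i] k q_gt_1 by simp
      then show ?thesis using False by (auto simp: coeff_eq_0)
    qed auto
  qed
  also have "\<dots> = (\<Sum>i<r0. if i = i0 then v i0 * coeff (T i0 0) (q ^ D) else 0)"
  proof (intro sum.cong refl)
    fix i
    show "(\<Sum>k<N. if i = i0 \<and> k = 0 then v i0 * coeff (T i0 0) (q ^ D) else 0) =
        (if i = i0 then v i0 * coeff (T i0 0) (q ^ D) else 0)"
      using N by (cases "i = i0") simp_all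
  qed
  also have "\<dots> = v i0 * coeff (T i0 0) (q ^ D)" using i0(1) by simp
  also have "\<dots> = v i0 * lead_coeff (T i0 0)" using T(1)[OF N] by (simp add: D_def)
  also have "\<dots> \<noteq> 0" using i0 T(2)[OF N] by simp
  finally have U: "U \<noteq> 0" by auto
  have "degree U \<le> q ^ (r0 * N - 1)"
    unfolding U_def
  proof (intro degree_sum_le finite_lessThan)
    fix i k assume i: "i \<in> {..<r0}" and k: "k \<in> {..<N}"
    have "N = Suc (N - Suc k) + k" using k by simp
    then have "r0 * N = r0 + r0 * (N - Suc k) + r0 * k" by (metis add_mult_distrib2 mult_Suc_right)
    then have "r0 * (N - Suc k) + i \<le> r0 * N - 1" using i by simp
    then have "q ^ (r0 * (N - Suc k) + i) \<le> q ^ (r0 * N - 1)"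
      by (rule power_increasing) (use q_gt_1 in simp)
    then show "degree (smult (v i * \<eta> ^ k) (T i k)) \<le> q ^ (r0 * N - 1)"
      using degree_smult_le[of "v i * \<eta> ^ k" "T i k"] T(1)[of k i] k by simp
  qed
  also have "\<dots> < q ^ (r0 * N)"
    using q_gt_1 N red_rank_pos by (intro power_strict_increasing) auto
  also have "\<dots> = card {x. act H x = 0}" using card_torsion[OF H(2)] by (simp add: N_def)
  also have "\<dots> \<le> card {x. poly U x = 0}"
  proof (intro card_mono poly_roots_finite U subsetI)
    fix x assume "x \<in> {x. act H x = 0}"
    then have "(\<Sum>i<r0. v i * poly (frobp i (gen H x)) \<eta>) = 0" using zero by simp
    moreover have "poly U x = (\<Sum>i<r0. v i * poly (frobp i (gen H x)) \<eta>)"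
      by (simp add: U_def T_def poly_sum poly_frobp_gen N_def poly_additive_poly sum_distrib_left mult.assoc)
    ultimately show "x \<in> {x. poly U x = 0}" by simp
  qed
  also have "\<dots> \<le> degree U" by (rule card_poly_roots_bound[OF U])
  finally show False by simp
qed

context
  fixes h :: "'a poly" and bs :: "(nat \<Rightarrow> 'a alg_closure) list"
  assumes h: "h \<in> monic_primes" and hf: "h \<noteq> f" and bs: "tate_basis \<phi> \<xi> h bs"
begin

text \<open>The Casorati matrix of the recurrence (a Wronskian with Frobenius in place of
  differentiation) for the solutions given by the basis at level \<open>m\<close>.\<close>

definition wr :: "nat \<Rightarrow> nat \<times> nat \<Rightarrow> 'a alg_closure poly" where
  "wr m = (\<lambda>(i, j). frobp i (gen (h ^ m) ((bs ! j) m)))"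

lemma length_bs: "length bs = r0"
  by (rule length_tate_basis[OF h hf bs])

lemma torsion_bs: "j < r0 \<Longrightarrow> act (h ^ m) ((bs ! j) m) = 0"
  using tate_basis_mem[OF h hf bs] tate_torsion length_bs by simp

text \<open>A vanishing determinant yields a functional \<open>u\<close> that kills the basis at
  level \<open>m\<close>. Since \<open>\<eta>\<close> is a root of \<open>h ^ m\<close>,
  \<open>gen_act\<close> shows that \<open>u\<close> turns the action of \<open>a\<close> into
  multiplication by \<open>a(\<eta>)\<close>; so \<open>u\<close> kills all
  \<open>h ^ m\<close>-torsion, against \<open>gen_rows_independent\<close>.\<close>

lemma det_wr_nz:
  assumes m: "m > 0" and \<eta>: "poly (mp h) \<eta> = 0"
  shows "poly (det (mat r0 r0 (wr m))) \<eta> \<noteq> 0"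
proof
  let ?H = "h ^ m"
  let ?W = "mat r0 r0 (\<lambda>(i, j). poly (wr m (j, i)) \<eta>)"
  assume 0: "poly (det (mat r0 r0 (wr m))) \<eta> = 0"
  have "poly (det (mat r0 r0 (wr m))) \<eta> = det (map_mat (\<lambda>p. poly p \<eta>) (mat r0 r0 (wr m)))"
    by (rule comm_ring_hom.hom_det[OF poly_hom.comm_ring_hom_axioms, symmetric])
  also have "\<dots> = det (transpose_mat (map_mat (\<lambda>p. poly p \<eta>) (mat r0 r0 (wr m))))"
    by (rule det_transpose[symmetric, of _ r0]) simp
  also have "transpose_mat (map_mat (\<lambda>p. poly p \<eta>) (mat r0 r0 (wr m))) = ?W"
    by (rule eq_matI) auto
  finally have "det ?W = 0" using 0 by simp
  then obtain v where v: "v \<in> carrier_vec r0" "v \<noteq> 0\<^sub>v r0" "?W *\<^sub>v v = 0\<^sub>v r0"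
    using det_0_iff_vec_prod_zero_field[of ?W r0] by auto
  define u where "u = (\<lambda>x. \<Sum>i<r0. v $ i * poly (frobp i (gen ?H x)) \<eta>)"
  have u_bs: "u ((bs ! j) m) = 0" if j: "j < r0" for j
  proof -
    have "0 = (?W *\<^sub>v v) $ j" using v(3) j by simp
    also have "\<dots> = (\<Sum>i<r0. poly (wr m (i, j)) \<eta> * v $ i)"
      using j v(1) by (simp add: scalar_prod_def atLeast0LessThan)
    also have "\<dots> = u ((bs ! j) m)" by (simp add: u_def wr_def mult.commute)
    finally show ?thesis by simp
  qed
  have \<eta>H: "poly (mp ?H) \<eta> = 0" using \<eta> m by (simp add: hom_distribs poly_power)
  have u_act: "u (act a x) = poly (mp a) \<eta> * u x" if x0: "act ?H x = 0" for a x
  proof -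
    have "poly (frobp i (gen ?H (act a x))) \<eta> = poly (mp a) \<eta> * poly (frobp i (gen ?H x)) \<eta>" for i
    proof -
      interpret F: comm_ring_hom "frobp i" by (rule frobp_hom)
      obtain w where "gen ?H (act a x) - mp a * gen ?H x = mp ?H * w"
        using gen_act[OF x0, of a] by (rule dvdE)
      then have "frobp i (gen ?H (act a x) - mp a * gen ?H x) = frobp i (mp ?H * w)" by simp
      then have "frobp i (gen ?H (act a x)) - mp a * frobp i (gen ?H x) = mp ?H * frobp i w"
        by (simp add: F.hom_minus F.hom_mult frobp_map_poly)
      then have "poly (frobp i (gen ?H (act a x)) - mp a * frobp i (gen ?H x)) \<eta> = 0"
        using \<eta>H by simp
      then show ?thesis by simp
    qed
    then show ?thesis by (simp add: u_def sum_distrib_left mult_ac)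
  qed
  have u_sum: "u (\<Sum>j<r0. x j) = (\<Sum>j<r0. u (x j))" for x
  proof -
    have "frobp i (gen ?H (\<Sum>j<r0. x j)) = (\<Sum>j<r0. frobp i (gen ?H (x j)))" for i
    proof -
      interpret F: comm_ring_hom "frobp i" by (rule frobp_hom)
      show ?thesis by (simp add: gen_sum F.hom_sum)
    qed
    then show ?thesis
      unfolding u_def by (simp add: poly_sum sum_distrib_left) (rule sum.swap)
  qed
  have zero: "u x = 0" if x: "act ?H x = 0" for x
  proof -
    obtain a where "x = (\<Sum>i<length bs. act (a i) ((bs ! i) m))"
      by (rule tate_basis_gen[OF h hf bs x])
    then have "u x = (\<Sum>i<r0. u (act (a i) ((bs ! i) m)))" by (simp add: length_bs u_sum)
    also have "\<dots> = 0" by (rule sum.neutral) (simp add: u_act torsion_bs u_bs)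
    finally show ?thesis .
  qed
  have "\<exists>i<r0. v $ i \<noteq> 0" using v(1,2) by (metis carrier_vecD eq_vecI index_zero_vec)
  then obtain i where i: "i < r0" "v $ i \<noteq> 0" by blast
  show False
  proof (rule gen_rows_independent)
    show "degree ?H > 0" using m degree_monic_prime[OF h] monic_prime_nz[OF h] by (simp add: degree_power_eq)
    show "ev \<xi> ?H \<noteq> 0" using ev_h[OF h hf] by simp
    show "(\<Sum>i<r0. v $ i * poly (frobp i (gen ?H x)) \<eta>) = 0" if "act ?H x = 0" for x
      using zero[OF that] by (simp add: u_def)
  qed (use i in auto)
qed

lemma coprime_det_wr: "coprime (mp (h ^ m)) (det (mat r0 r0 (wr m)))"
proof (cases "m = 0")
  case False
  show ?thesis
  proof (rule coprime_if_no_common_root)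
    show "mp (h ^ m) \<noteq> 0" using monic_prime_nz[OF h] by simp
    fix \<eta> assume "poly (mp (h ^ m)) \<eta> = 0"
    then have "poly (mp h) \<eta> = 0" by (simp add: hom_distribs poly_power)
    then show "poly (det (mat r0 r0 (wr m))) \<eta> \<noteq> 0" using False by (intro det_wr_nz) auto
  qed
qed simp

text \<open>The twists of order \<open>degree f + i\<close> are computed in two ways: by the
  recurrence, which multiplies \<open>wr\<close> on the left by \<open>trans_mat\<close>, and by
  Frobenius on the basis, which multiplies it on the right by \<open>E\<close>. The determinant of
  \<open>wr\<close> is prime to \<open>h ^ m\<close> and can be cancelled.\<close>

lemma char_poly_congr:
  assumes E: "E \<in> carrier_mat r0 r0"
    and frob: "\<And>j. j < r0 \<Longrightarrow> (bs ! j) m ^ (q ^ degree f) = (\<Sum>i<r0. act (E $$ (i, j)) ((bs ! i) m))"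
  shows "mp (h ^ m) dvd coeff (char_poly trans_mat) k - mp (coeff (char_poly E) k)"
proof -
  let ?M = "mp (h ^ m)" and ?d = "degree f"
  define w where "w = (\<lambda>j n. frobp n (gen (h ^ m) ((bs ! j) m)))"
  have sol: "?M dvd w j n - (\<Sum>c<r0. sol c n * w j c)" if "j < r0" for j n
    unfolding w_def by (rule dvd_solution, rule gen_rec, rule torsion_bs[OF that])
  have mat: "?M dvd w j (?d + i) - (\<Sum>c<r0. w c i * mp (E $$ (c, j)))" if j: "j < r0" for i j
  proof -
    interpret F: comm_ring_hom "frobp i" by (rule frobp_hom)
    have "w j (?d + i) = frobp i (gen (h ^ m) ((bs ! j) m ^ (q ^ ?d)))"
      unfolding gen_frob w_def frobp_frobp by (simp add: add.commute)
    also have "\<dots> = (\<Sum>c<r0. frobp i (gen (h ^ m) (act (E $$ (c, j)) ((bs ! c) m))))"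
      by (simp add: frob[OF j] gen_sum F.hom_sum)
    finally have "w j (?d + i) - (\<Sum>c<r0. w c i * mp (E $$ (c, j))) =
        (\<Sum>c<r0. frobp i (gen (h ^ m) (act (E $$ (c, j)) ((bs ! c) m)) - mp (E $$ (c, j)) * gen (h ^ m) ((bs ! c) m)))"
      by (simp add: sum_subtractf F.hom_minus F.hom_mult frobp_map_poly w_def mult.commute)
    moreover have "?M dvd \<dots>"
    proof (rule dvd_sum)
      fix c assume "c \<in> {..<r0}"
      then have "?M dvd gen (h ^ m) (act (E $$ (c, j)) ((bs ! c) m)) - mp (E $$ (c, j)) * gen (h ^ m) ((bs ! c) m)"
        by (intro gen_act torsion_bs) simp
      then have "frobp i ?M dvd frobp i (gen (h ^ m) (act (E $$ (c, j)) ((bs ! c) m)) - mp (E $$ (c, j)) * gen (h ^ m) ((bs ! c) m))"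
        by (rule F.hom_dvd)
      then show "?M dvd frobp i (gen (h ^ m) (act (E $$ (c, j)) ((bs ! c) m)) - mp (E $$ (c, j)) * gen (h ^ m) ((bs ! c) m))"
        by (simp only: frobp_map_poly)
    qed
    ultimately show ?thesis by simp
  qed
  have "mat r0 r0 (\<lambda>(i, c). sol c (?d + i)) = trans_mat" "mat r0 r0 (\<lambda>(i, j). mp (E $$ (i, j))) = map_mat mp E"
    using E by (auto simp: trans_mat_def)
  moreover have "?M dvd (\<Sum>c<r0. sol c (?d + i) * w j c) - (\<Sum>c<r0. w c i * mp (E $$ (c, j)))"
    if "i < r0" "j < r0" for i j
    using dvd_diff[OF mat[OF that(2), of i] sol[OF that(2), of "?d + i"]] by (simp add: algebra_simps)
  ultimately have "?M dvd det (mat r0 r0 (wr m)) * (coeff (char_poly trans_mat) k - coeff (char_poly (map_mat mp E)) k)"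
    using dvd_char_poly_diff[where c = ?M and n = r0 and A = "\<lambda>(i, c). sol c (?d + i)" and W = "wr m"
        and B = "\<lambda>(i, j). mp (E $$ (i, j))" and k = k]
    by (simp add: wr_def w_def)
  then have "?M dvd det (mat r0 r0 (wr m)) * (coeff (char_poly trans_mat) k - mp (coeff (char_poly E) k))"
    by (simp add: mp.char_poly_hom[OF E] coeff_map_poly)
  then show ?thesis by (rule field_poly_coprime_dvd_mult[OF coprime_det_wr])
qed

end

end

lemma monic_linear_prime: "[:c, 1:] \<in> (monic_primes :: 'a :: field poly set)"
  unfolding monic_primes_def
proof (intro CollectI conjI Factorial_Ring.irreducibleI)
  fix a b :: "'a poly" assume ab: "[:c, 1:] = a * b"
  then have nz: "a \<noteq> 0" "b \<noteq> 0" by auto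
  have "degree a + degree b = 1" using arg_cong[OF ab, of degree] nz by (simp add: degree_mult_eq)
  then show "is_unit a \<or> is_unit b" using nz by (auto simp: is_unit_iff_degree add_is_1)
qed (auto simp: is_unit_iff_degree)

lemma eq_0_if_all_powers_dvd:
  fixes h p :: "'b :: field poly"
  assumes "degree h > 0" "\<And>m. h ^ m dvd p"
  shows "p = 0"
proof (rule ccontr)
  assume p: "p \<noteq> 0"
  have "h \<noteq> 0" using assms(1) by auto
  have "Suc (degree p) * 1 \<le> degree h * Suc (degree p)"
    using assms(1) by (subst mult.commute) (intro mult_le_mono1, simp)
  also have "\<dots> = degree (h ^ Suc (degree p))" by (rule degree_power_eq[OF \<open>h \<noteq> 0\<close>, symmetric])
  also have "\<dots> \<le> degree p" by (rule dvd_imp_degree_le[OF assms(2) p])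
  finally show False by simp
qed

section \<open>Rationality and uniqueness of the characteristic polynomial\<close>

context drinfeld_reduction begin

definition frob_matrix :: "'a poly \<Rightarrow> (nat \<Rightarrow> 'a alg_closure) list \<Rightarrow> (nat \<Rightarrow> 'a poly) mat \<Rightarrow> bool" where
  "frob_matrix h bs M \<longleftrightarrow> M \<in> carrier_mat (length bs) (length bs) \<and> elements_mat M \<subseteq> adic_seqs h \<and>
     (\<forall>j<length bs. (\<lambda>m. (bs ! j) m ^ (q ^ degree f)) =
        (\<Sum>i<length bs. tate_smult \<phi> \<xi> (M $$ (i, j)) (bs ! i)))"

lemma tate_frob_char_poly_altdef:
  "tate_frob_char_poly \<phi> \<xi> h (degree f) P \<longleftrightarrow>
     (\<exists>bs M. tate_basis \<phi> \<xi> h bs \<and> frob_matrix h bs M \<and>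
        (\<forall>k m. h ^ m dvd coeff (char_poly M) k m - coeff P k))"
proof -
  have "s - (\<lambda>_. a) \<in> adic_null h \<longleftrightarrow> (\<forall>m. h ^ m dvd s m - a)" for s :: "nat \<Rightarrow> 'a poly" and a
    by (simp add: adic_null_def)
  then show ?thesis
    by (simp only: tate_frob_char_poly_def frob_matrix_def q_def[symmetric] conj_assoc)
qed

text \<open>Here \<open>of_ac\<close> inverts \<open>to_ac\<close> on its range; that all
  coefficients lie in that range is the content of \<open>char_poly_rational\<close>.\<close>

definition frobpoly :: "'a poly poly" where
  "frobpoly = map_poly (map_poly of_ac) (char_poly trans_mat)"

context
  fixes h :: "'a poly"
  assumes h: "h \<in> monic_primes" and hf: "h \<noteq> f"
begin

lemma frob_matrix_exists:
  assumes bs: "tate_basis \<phi> \<xi> h bs"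
  shows "\<exists>M. frob_matrix h bs M"
proof -
  let ?l = "length bs"
  have "\<exists>s. (\<forall>i<?l. s i \<in> adic_seqs h) \<and>
      (\<lambda>m. (bs ! j) m ^ (q ^ degree f)) = (\<Sum>i<?l. tate_smult \<phi> \<xi> (s i) (bs ! i))" if "j < ?l" for j
  proof -
    have "(\<lambda>m. (bs ! j) m ^ (q ^ degree f)) \<in> tate h"
      by (rule tate_frob, rule tate_basis_mem[OF h hf bs that])
    then show ?thesis using bs unfolding tate_basis_def tate_module_eq by blast
  qed
  then have "\<forall>j. \<exists>s. j < ?l \<longrightarrow> (\<forall>i<?l. s i \<in> adic_seqs h) \<and>
      (\<lambda>m. (bs ! j) m ^ (q ^ degree f)) = (\<Sum>i<?l. tate_smult \<phi> \<xi> (s i) (bs ! i))" by blast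
  then obtain s where s: "\<forall>j. j < ?l \<longrightarrow> (\<forall>i<?l. s j i \<in> adic_seqs h) \<and>
      (\<lambda>m. (bs ! j) m ^ (q ^ degree f)) = (\<Sum>i<?l. tate_smult \<phi> \<xi> (s j i) (bs ! i))"
    by (rule choice[THEN exE])
  have "frob_matrix h bs (mat ?l ?l (\<lambda>(i, j). s j i))"
    unfolding frob_matrix_def using s by (auto simp: elements_mat_def)
  then show ?thesis by blast
qed

lemma frob_matrix_char_poly:
  assumes bs: "tate_basis \<phi> \<xi> h bs" and M: "frob_matrix h bs M"
  shows "mp (h ^ m) dvd coeff (char_poly trans_mat) k - mp (coeff (char_poly M) k m)"
proof -
  have l: "length bs = r0" by (rule length_tate_basis[OF h hf bs])
  have Mc: "M \<in> carrier_mat r0 r0" using M l by (simp add: frob_matrix_def)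
  \<comment> \<open>Evaluation of sequences at level \<open>m\<close> is a ring homomorphism, so
    \<open>M\<close> may be specialised before its characteristic polynomial is taken.\<close>
  interpret E: comm_ring_hom "\<lambda>s :: nat \<Rightarrow> 'a poly. s m" by unfold_locales auto
  let ?E = "map_mat (\<lambda>s. s m) M"
  have "mp (h ^ m) dvd coeff (char_poly trans_mat) k - mp (coeff (char_poly ?E) k)"
  proof (rule char_poly_congr[OF h hf bs])
    show "?E \<in> carrier_mat r0 r0" using Mc by simp
    fix j assume j: "j < r0"
    have "\<forall>j<length bs. (\<lambda>m. (bs ! j) m ^ (q ^ degree f)) =
        (\<Sum>i<length bs. tate_smult \<phi> \<xi> (M $$ (i, j)) (bs ! i))"
      using M unfolding frob_matrix_def by (elim conjE)
    then have "(\<lambda>m. (bs ! j) m ^ (q ^ degree f)) =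
        (\<Sum>i<length bs. tate_smult \<phi> \<xi> (M $$ (i, j)) (bs ! i))"
      by (rule allE[of _ j]) (simp only: l j)
    from fun_cong[OF this, of m]
    have "(bs ! j) m ^ (q ^ degree f) = (\<Sum>i<length bs. tate_smult \<phi> \<xi> (M $$ (i, j)) (bs ! i)) m" .
    also have "\<dots> = (\<Sum>i<r0. act (?E $$ (i, j)) ((bs ! i) m))"
      unfolding tate_lin_comb l using Mc j by (intro sum.cong) auto
    finally show "(bs ! j) m ^ (q ^ degree f) = \<dots>" .
  qed
  then show ?thesis by (simp add: E.char_poly_hom[OF Mc] coeff_map_poly)
qed

text \<open>Each coefficient \<open>v\<close> is congruent modulo \<open>h ^ m\<close> to a
  polynomial over the finite field. Once \<open>h ^ m\<close> has larger degree than
  \<open>v\<close>, the remainder is \<open>v\<close> itself and is rational.\<close>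

lemma char_poly_rational: "char_poly trans_mat = map_poly mp frobpoly"
proof (rule poly_eqI)
  fix k
  define v where "v = coeff (char_poly trans_mat) k"
  obtain bs where bs: "tate_basis \<phi> \<xi> h bs" using tate_basis_exists[OF h hf] by blast
  obtain M where M: "frob_matrix h bs M" using frob_matrix_exists[OF bs] by blast
  define m where "m = Suc (degree v)"
  define e where "e = coeff (char_poly M) k m"
  have "mp (h ^ m) dvd v - mp e" using frob_matrix_char_poly[OF bs M] by (simp add: v_def e_def)
  then have "v mod mp (h ^ m) = mp e mod mp (h ^ m)" by (simp add: mod_eq_dvd_iff)
  moreover have "degree v < degree (mp (h ^ m))"
  proof -
    have "m * 1 \<le> m * degree h" using degree_monic_prime[OF h] by (intro mult_le_mono2) simp
    moreover have "degree (mp (h ^ m)) = degree (h ^ m)" by simp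
    moreover have "degree (h ^ m) = m * degree h" using monic_prime_nz[OF h] by (simp add: degree_power_eq mult.commute)
    ultimately show ?thesis by (simp add: m_def)
  qed
  ultimately have v: "v = mp (e mod h ^ m)" by (simp add: mod_poly_less map_poly_mod)
  have "map_poly of_ac (mp u) = u" for u :: "'a poly"
    by (rule poly_eqI) (simp add: coeff_map_poly)
  then have "mp (map_poly of_ac v) = v" by (simp add: v)
  then show "coeff (char_poly trans_mat) k = coeff (map_poly mp frobpoly) k"
    by (simp add: frobpoly_def coeff_map_poly v_def)
qed

lemma coeff_frobpoly_congr:
  assumes bs: "tate_basis \<phi> \<xi> h bs" and M: "frob_matrix h bs M"
  shows "h ^ m dvd coeff (char_poly M) k m - coeff frobpoly k"
proof -
  have "mp (h ^ m) dvd mp (coeff frobpoly k - coeff (char_poly M) k m)"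
    using frob_matrix_char_poly[OF bs M, of m k] by (simp add: char_poly_rational coeff_map_poly hom_distribs)
  then have "h ^ m dvd coeff frobpoly k - coeff (char_poly M) k m"
    by (rule dvd_map_poly_hom_imp_dvd)
  then show ?thesis by (simp add: dvd_diff_commute)
qed

text \<open>For any basis and matrix, the level \<open>m\<close> coefficients are congruent modulo
  \<open>h ^ m\<close> to those of \<open>frobpoly\<close>, for every \<open>m\<close>; this leaves
  only one candidate \<open>P\<close>, and the candidate does not involve \<open>h\<close>.\<close>

lemma tate_frob_char_poly_iff: "tate_frob_char_poly \<phi> \<xi> h (degree f) P \<longleftrightarrow> P = frobpoly"
proof
  assume "P = frobpoly"
  then show "tate_frob_char_poly \<phi> \<xi> h (degree f) P"
    unfolding tate_frob_char_poly_altdef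
    using tate_basis_exists[OF h hf] frob_matrix_exists coeff_frobpoly_congr by blast
next
  assume "tate_frob_char_poly \<phi> \<xi> h (degree f) P"
  then obtain bs M where bs: "tate_basis \<phi> \<xi> h bs" and M: "frob_matrix h bs M"
    and P: "\<And>k m. h ^ m dvd coeff (char_poly M) k m - coeff P k"
    unfolding tate_frob_char_poly_altdef by blast
  show "P = frobpoly"
  proof (rule poly_eqI)
    fix k
    have "h ^ m dvd coeff P k - coeff frobpoly k" for m
      using dvd_diff[OF coeff_frobpoly_congr[OF bs M, of m k] P[of m k]] by simp
    then have "coeff P k - coeff frobpoly k = 0"
      by (intro eq_0_if_all_powers_dvd[OF degree_monic_prime[OF h]])
    then show "coeff P k = coeff frobpoly k" by simp
  qed
qed

end

lemma other_prime:
  obtains h :: "'a poly" where "h \<in> monic_primes" "h \<noteq> f"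
proof (cases "f = [:0, 1:]")
  case True
  then show ?thesis using that[of "[:1, 1:]"] monic_linear_prime by auto
next
  case False
  then show ?thesis using that[of "[:0, 1:]"] monic_linear_prime by auto
qed

lemma trans_mat_char_poly: "char_poly trans_mat = map_poly mp frobpoly"
  by (rule other_prime) (rule char_poly_rational)

lemma frobpoly_monic: "lead_coeff frobpoly = 1" and degree_frobpoly: "degree frobpoly = r0"
proof -
  have M: "trans_mat \<in> carrier_mat r0 r0" by (simp add: trans_mat_def)
  have inj: "mp u = 0 \<longleftrightarrow> u = 0" for u :: "'a poly" by simp
  have deg: "degree (map_poly mp frobpoly) = degree frobpoly"
    by (rule degree_map_poly) (simp add: inj)
  show "degree frobpoly = r0"
    using degree_monic_char_poly[OF M] by (simp add: trans_mat_char_poly deg)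
  have "coeff (char_poly trans_mat) (degree (char_poly trans_mat)) = 1"
    using degree_monic_char_poly[OF M] by simp
  then have "mp (lead_coeff frobpoly) = 1"
    by (simp add: trans_mat_char_poly deg coeff_map_poly)
  then have "mp (lead_coeff frobpoly) = mp 1" by simp
  then show "lead_coeff frobpoly = 1" using mp.eq_iff by blast
qed

text \<open>At \<open>y = 0\<close> the determinant is \<open>f\<close>, so \<open>b\<close> times
  the constant coefficient of \<open>frobpoly\<close> is \<open>f\<close>; comparing leading
  coefficients puts \<open>b\<close> into the finite field.\<close>

lemma frobpoly_const:
  obtains c where "c \<noteq> 0" "coeff frobpoly 0 = smult (inverse c) f"
    "shift_det \<xi> (degree f) (\<phi> theta) = map_poly mp (smult [:c:] frobpoly)"
proof -
  obtain b where b: "b \<noteq> 0" "shift_det \<xi> (degree f) (\<phi> theta) = smult [:b:] (map_poly mp frobpoly)"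
    using shift_det_eq_char_poly unfolding trans_mat_char_poly by blast
  let ?u = "coeff frobpoly 0"
  have eq: "smult b (mp ?u) = mp f"
    using arg_cong[OF b(2), of "\<lambda>P. coeff P 0"]
    by (simp add: shift_det_at_0[OF f root phi_theta_0] coeff_map_poly)
  have "b * to_ac (lead_coeff ?u) = 1"
  proof -
    have "degree f = degree ?u" using arg_cong[OF eq, of degree] b(1) by simp
    then have "b * to_ac (lead_coeff ?u) = coeff (smult b (mp ?u)) (degree f)" by (simp add: coeff_map_poly)
    also have "\<dots> = to_ac (lead_coeff f)" unfolding eq by (simp add: coeff_map_poly)
    finally show ?thesis using f by (simp add: monic_primes_def)
  qed
  moreover define c where "c = inverse (lead_coeff ?u)"
  ultimately have bc: "b = to_ac c" by (simp add: c_def inverse_unique mult.commute)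
  then have c: "c \<noteq> 0" using b(1) by auto
  have "mp (smult c ?u) = mp f" using eq by (simp add: bc hom_distribs)
  then have fu: "smult c ?u = f" using mp.eq_iff by blast
  have "?u = smult (inverse c) (smult c ?u)" using c by simp
  then have "?u = smult (inverse c) f" unfolding fu .
  moreover have "shift_det \<xi> (degree f) (\<phi> theta) = map_poly mp (smult [:c:] frobpoly)"
    unfolding b(2) by (rule poly_eqI) (simp add: coeff_map_poly bc hom_distribs)
  ultimately show ?thesis using that c by blast
qed

end

lemma (in drinfeld_reduction) frobpoly_indep:
  assumes "drinfeld_reduction q \<phi> f \<xi>' r"
  shows "drinfeld_reduction.frobpoly q \<phi> f \<xi>' = frobpoly"
proof -
  interpret B: drinfeld_reduction q \<phi> f \<xi>' r by fact
  obtain c where c: "c \<noteq> 0" "shift_det \<xi> (degree f) (\<phi> theta) = map_poly mp (smult [:c:] frobpoly)"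
    using frobpoly_const by blast
  obtain c' where c': "c' \<noteq> 0" "shift_det \<xi>' (degree f) (\<phi> theta) = map_poly mp (smult [:c':] B.frobpoly)"
    using B.frobpoly_const by blast
  have "shift_det \<xi>' (degree f) (\<phi> theta) = map_poly mp (smult [:c:] frobpoly)"
    by (rule shift_det_transfer[OF fq_hom_axioms fq_hom_axioms f root B.root c(2)])
  then have "map_poly mp (smult [:c:] frobpoly) = map_poly mp (smult [:c':] B.frobpoly)"
    using c'(2) by simp
  then have "coeff (map_poly mp (smult [:c:] frobpoly)) k = coeff (map_poly mp (smult [:c':] B.frobpoly)) k" for k
    by (rule arg_cong)
  then have "mp (coeff (smult [:c:] frobpoly) k) = mp (coeff (smult [:c':] B.frobpoly) k)" for k
    by (simp only: coeff_map_poly map_poly_0)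
  then have "coeff (smult [:c:] frobpoly) k = coeff (smult [:c':] B.frobpoly) k" for k
    by (simp only: mp.eq_iff)
  then have eq: "smult [:c:] frobpoly = smult [:c':] B.frobpoly"
    by (rule poly_eqI)
  have "[:c:] = [:c':]"
    using arg_cong[OF eq, of "\<lambda>p. coeff p r0"] frobpoly_monic B.frobpoly_monic
    by (simp add: degree_frobpoly B.degree_frobpoly)
  then have "[:[:c:]:] * frobpoly = [:[:c:]:] * B.frobpoly" using eq by simp
  then show ?thesis using c(1) by (simp only: mult_cancel_left) simp
qed

text \<open>Both definite descriptions are resolved here, since \<open>frobpoly\<close> serves all
  roots and all \<open>h\<close> at once. The last conclusion is in the form that
  \<open>shift_det_transfer\<close> carries to the closure of \<open>'k\<close>.\<close>

theorem frob_char_poly_props: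
  fixes \<phi> :: "'a::{field,finite} poly \<Rightarrow> 'a poly poly"
  assumes "drinfeld_module r \<phi>" "f \<in> monic_primes" "red_rank \<phi> f \<ge> 1"
  defines "P \<equiv> frob_char_poly \<phi> f" and "c \<equiv> frob_const \<phi> f"
  shows "c \<noteq> 0" "coeff P 0 = smult (inverse c) f" "lead_coeff P = 1" "degree P = red_rank \<phi> f"
    "\<exists>\<xi>. fq_hom.ev to_ac \<xi> f = 0 \<and> fq_hom.shift_det to_ac (CARD('a)) \<xi> (degree f) (\<phi> theta) =
       map_poly (map_poly to_ac) (smult [:c:] P)"
proof -
  let ?q = "CARD('a)"
  interpret F: fq_hom "to_ac :: 'a \<Rightarrow> 'a alg_closure" ?q by unfold_locales auto
  have red: "drinfeld_reduction ?q \<phi> f \<xi> r" if "F.ev \<xi> f = 0" for \<xi>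
    using assms that by unfold_locales auto
  have "degree (map_poly to_ac f) > 0" using degree_monic_prime[OF assms(2)] by simp
  then obtain \<xi> where \<xi>: "F.ev \<xi> f = 0"
    unfolding F.ev_def using alg_closed_imp_poly_has_root by blast
  interpret R: drinfeld_reduction ?q \<phi> f \<xi> r by (rule red[OF \<xi>])
  have "P = R.frobpoly"
    unfolding P_def frob_char_poly_def
  proof (rule the_equality)
    show "\<forall>\<xi> h. reduce \<xi> f = 0 \<and> h \<in> monic_primes \<and> h \<noteq> f \<longrightarrow>
        tate_frob_char_poly \<phi> \<xi> h (degree f) R.frobpoly"
    proof (intro allI impI, elim conjE)
      fix \<xi>' h assume "reduce \<xi>' f = 0" and h: "h \<in> monic_primes" "h \<noteq> f"
      then have "F.ev \<xi>' f = 0" by (simp add: reduce_def F.ev_def)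
      note B = red[OF this]
      show "tate_frob_char_poly \<phi> \<xi>' h (degree f) R.frobpoly"
        using drinfeld_reduction.tate_frob_char_poly_iff[OF B h] R.frobpoly_indep[OF B] by simp
    qed
  next
    fix P' assume P': "\<forall>\<xi> h. reduce \<xi> f = 0 \<and> h \<in> monic_primes \<and> h \<noteq> f \<longrightarrow>
        tate_frob_char_poly \<phi> \<xi> h (degree f) P'"
    obtain h where h: "h \<in> monic_primes" "h \<noteq> f" by (rule R.other_prime)
    have "reduce \<xi> f = 0" using \<xi> by (simp add: reduce_def F.ev_def)
    then show "P' = R.frobpoly" using P' h R.tate_frob_char_poly_iff[OF h] by blast
  qed
  moreover obtain c' where c': "c' \<noteq> 0" "coeff R.frobpoly 0 = smult (inverse c') f"
    "F.shift_det \<xi> (degree f) (\<phi> theta) = map_poly (map_poly to_ac) (smult [:c':] R.frobpoly)"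
    by (rule R.frobpoly_const)
  moreover have "c = c'"
    unfolding c_def frob_const_def
  proof (rule the_equality)
    show "c' \<noteq> 0 \<and> coeff (frob_char_poly \<phi> f) 0 = smult (inverse c') f"
      using c' calculation(1) by (simp add: P_def)
    fix c assume "c \<noteq> 0 \<and> coeff (frob_char_poly \<phi> f) 0 = smult (inverse c) f"
    then have "smult (inverse c) f = smult (inverse c') f"
      using c' calculation(1) by (simp add: P_def)
    then have "smult (inverse c - inverse c') f = 0" by (simp add: smult_diff_left)
    then show "c = c'" using monic_prime_nz[OF assms(2)] by simp
  qed
  ultimately show "c \<noteq> 0" "coeff P 0 = smult (inverse c) f" "lead_coeff P = 1" "degree P = red_rank \<phi> f"
    "\<exists>\<xi>. F.ev \<xi> f = 0 \<and> F.shift_det \<xi> (degree f) (\<phi> theta) = map_poly (map_poly to_ac) (smult [:c:] P)"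
    using \<xi> R.frobpoly_monic R.degree_frobpoly by auto
qed

section \<open>The local factors\<close>

lemma vector_space_smult: "vector_space (smult :: 'k::field \<Rightarrow> 'k poly \<Rightarrow> 'k poly)"
  by unfold_locales (simp_all add: smult_add_right smult_add_left)

lemma range_mod_poly:
  fixes G :: "'k::field poly"
  assumes "degree G > 0"
  shows "range (\<lambda>x. x mod G) = {x. degree x < degree G}"
proof (intro equalityI subsetI)
  fix x assume "x \<in> range (\<lambda>x. x mod G)"
  then obtain y where "x = y mod G" by blast
  then show "x \<in> {x. degree x < degree G}"
    using degree_mod_less[of G y] assms by (cases "G = 0"; cases "y mod G = 0"; simp)
next
  fix x assume "x \<in> {x :: 'k poly. degree x < degree G}"
  then have "x = x mod G" by (simp add: mod_poly_less)
  then show "x \<in> range (\<lambda>x. x mod G)" by (rule range_eqI)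
qed

text \<open>
  The characteristic polynomial is computed over an extension in which the space of polynomials of
  degree less than \<open>d\<close> has the coordinates \<open>x \<mapsto> \<beta> i * x(\<zeta> i)\<close>.
\<close>

lemma module_char_eval:
  fixes T :: "'k::field poly \<Rightarrow> 'k poly" and \<beta> \<zeta> :: "nat \<Rightarrow> 'k alg_closure"
    and N :: "nat \<times> nat \<Rightarrow> 'k alg_closure"
  assumes \<zeta>: "inj_on \<zeta> {..<d}" and \<beta>: "\<And>i. i < d \<Longrightarrow> \<beta> i \<noteq> 0"
    and T: "\<And>x. degree x < d \<Longrightarrow> degree (T x) < d"
    and N: "\<And>x i. degree x < d \<Longrightarrow> i < d \<Longrightarrow> \<beta> i * poly (map_poly to_ac (T x)) (\<zeta> i) =
      (\<Sum>c<d. N (i, c) * (\<beta> c * poly (map_poly to_ac x) (\<zeta> c)))"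
    and d: "d > 0"
  shows "map_poly to_ac (module_char smult {x. degree x < d} T) = char_poly (mat d d N)"
proof -
  interpret vs: vector_space "smult :: 'k \<Rightarrow> 'k poly \<Rightarrow> 'k poly" by (rule vector_space_smult)
  interpret A: field_hom "to_ac :: 'k \<Rightarrow> 'k alg_closure" by unfold_locales auto
  interpret A1: map_poly_inj_idom_hom "to_ac :: 'k \<Rightarrow> 'k alg_closure" ..
  define V where "V = {x :: 'k poly. degree x < d}"
  define e where "e = (\<lambda>i x. \<beta> i * poly (map_poly to_ac x) (\<zeta> i))"
  have e_add: "e i (x + y) = e i x + e i y" for i x y by (simp add: e_def hom_distribs algebra_simps)
  have e_smult: "e i (smult a x) = to_ac a * e i x" for i a x by (simp add: e_def hom_distribs)
  have e_0: "e i 0 = 0" for i by (simp add: e_def)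
  have e_sum: "e i (\<Sum>j\<in>J. x j) = (\<Sum>j\<in>J. e i (x j))" for i J and x :: "nat \<Rightarrow> 'k poly"
    by (induction J rule: infinite_finite_induct) (auto simp: e_add e_0)
  define B0 where "B0 = (\<lambda>i. monom (1 :: 'k) i) ` {..<d}"
  have V_sub: "vs.subspace V"
    unfolding vs.subspace_def V_def using d
    by (auto intro: degree_add_less le_less_trans[OF degree_smult_le])
  have inj: "inj_on (\<lambda>i. monom (1 :: 'k) i) {..<d}" by (auto intro!: inj_onI simp: monom_eq_iff')
  have span0: "vs.span B0 = V"
  proof (intro equalityI subsetI)
    fix x assume "x \<in> vs.span B0"
    moreover have "B0 \<subseteq> V" by (auto simp: B0_def V_def degree_monom_eq)
    ultimately show "x \<in> V" using vs.span_minimal[OF _ V_sub] by blast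
  next
    fix x assume x: "x \<in> V"
    have "x = (\<Sum>i<d. smult (coeff x i) (monom 1 i))"
      by (rule poly_eqI) (use x in \<open>simp add: coeff_sum V_def coeff_eq_0 if_distrib cong: if_cong\<close>)
    also have "\<dots> \<in> vs.span B0"
      by (intro vs.span_sum vs.span_scale vs.span_base) (auto simp: B0_def)
    finally show "x \<in> vs.span B0" .
  qed
  have indep0: "\<not> vs.dependent B0"
  proof
    assume dep: "vs.dependent B0"
    have "finite B0" by (simp add: B0_def)
    then obtain u where u: "\<exists>v\<in>B0. u v \<noteq> 0" "(\<Sum>v\<in>B0. smult (u v) v) = 0"
      using dep vs.dependent_finite[of B0] by blast
    from u(1) obtain k where k: "k < d" "u (monom 1 k) \<noteq> 0" by (auto simp: B0_def)
    have "(\<Sum>i<d. smult (u (monom 1 i)) (monom 1 i)) = 0"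
      using u(2) unfolding B0_def by (simp add: sum.reindex[OF inj])
    then have "coeff (\<Sum>i<d. smult (u (monom 1 i)) (monom 1 i)) k = 0" by simp
    then show False using k by (simp add: coeff_sum if_distrib cong: if_cong)
  qed
  define good where "good = (\<lambda>bs M. distinct bs \<and> \<not> vs.dependent (set bs) \<and> vs.span (set bs) = V \<and>
     M \<in> carrier_mat (length bs) (length bs) \<and>
     (\<forall>j<length bs. T (bs ! j) = (\<Sum>i<length bs. smult (M $$ (i, j)) (bs ! i))))"
  have good_char: "map_poly to_ac (char_poly M) = char_poly (mat d d N)" if "good bs M" for bs M
  proof -
    have "card (set bs) = card B0"
      using that indep0 span0 vs.bij_if_span_eq_span_bases[of "set bs" B0]
      by (auto simp: good_def dest: bij_betw_same_card)
    then have l: "length bs = d"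
      using that card_image[OF inj] by (simp add: good_def distinct_card B0_def)
    have in_V: "bs ! j \<in> V" if "j < d" for j
      using \<open>good bs M\<close> that l vs.span_superset[of "set bs"] by (auto simp: good_def)
    have T_bs: "T (bs ! j) = (\<Sum>i<d. smult (M $$ (i, j)) (bs ! i))" if "j < d" for j
      using \<open>good bs M\<close> that l by (simp add: good_def)
    have M: "M \<in> carrier_mat d d" using that l by (simp add: good_def)
    define W where "W = (\<lambda>(i, j). e i (bs ! j))"
    have intertwine: "(\<Sum>c<d. N (i, c) * W (c, j)) = (\<Sum>c<d. W (i, c) * to_ac (M $$ (c, j)))"
      if "i < d" "j < d" for i j
    proof -
      have "(\<Sum>c<d. N (i, c) * W (c, j)) = e i (T (bs ! j))"
        using N[of "bs ! j" i] in_V that by (simp add: W_def e_def V_def)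
      also have "\<dots> = (\<Sum>c<d. W (i, c) * to_ac (M $$ (c, j)))"
        by (simp add: T_bs that e_sum e_smult W_def mult.commute)
      finally show ?thesis .
    qed
    \<comment> \<open>A kernel vector would be a linear relation between the coordinates on the
      whole space, which Lagrange interpolation at the distinct points \<open>\<zeta> i\<close>
      excludes.\<close>
    have "det (mat d d W) \<noteq> 0"
    proof
      assume "det (mat d d W) = 0"
      then have "det (transpose_mat (mat d d W)) = 0" by (subst det_transpose[of _ d]) auto
      then obtain v where v: "v \<in> carrier_vec d" "v \<noteq> 0\<^sub>v d" "transpose_mat (mat d d W) *\<^sub>v v = 0\<^sub>v d"
        using det_0_iff_vec_prod_zero_field[of "transpose_mat (mat d d W)" d] by auto
      define u where "u = (\<lambda>i. vec_index v i)"
      define K where "K = {x. (\<Sum>i<d. u i * e i x) = 0}"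
      have K_sub: "vs.subspace K"
        unfolding vs.subspace_def K_def
        by (auto simp: e_add e_smult algebra_simps sum.distrib e_0 simp flip: sum_distrib_left)
      have "bs ! j \<in> K" if "j < d" for j
      proof -
        have "0 = vec_index (transpose_mat (mat d d W) *\<^sub>v v) j" using v(3) that by simp
        also have "\<dots> = (\<Sum>i<d. u i * e i (bs ! j))"
          using that v(1) by (simp add: scalar_prod_def atLeast0LessThan W_def u_def mult.commute)
        finally show ?thesis by (simp add: K_def)
      qed
      then have "set bs \<subseteq> K" using l by (auto simp: in_set_conv_nth)
      then have "vs.span (set bs) \<subseteq> K" by (rule vs.span_minimal[OF _ K_sub])
      then have VK: "V \<subseteq> K" using \<open>good bs M\<close> by (simp add: good_def)
      have pow0: "(\<Sum>i<d. u i * \<beta> i * \<zeta> i ^ a) = 0" if "a < d" for a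
      proof -
        have "monom 1 a \<in> K" using VK that by (auto simp: V_def degree_monom_eq)
        then show ?thesis by (simp add: K_def e_def map_poly_monom poly_monom mult.assoc)
      qed
      \<comment> \<open>The relation is known for monomials and extends to polynomials over the
        closure, where the interpolation polynomial below lives.\<close>
      have poly0: "(\<Sum>i<d. u i * \<beta> i * poly p (\<zeta> i)) = 0" if "degree p < d" for p
      proof -
        have "(\<Sum>i<d. u i * \<beta> i * poly p (\<zeta> i)) =
            (\<Sum>i<d. \<Sum>a\<le>degree p. coeff p a * (u i * \<beta> i * \<zeta> i ^ a))"
          by (simp add: poly_altdef sum_distrib_left mult_ac)
        also have "\<dots> = (\<Sum>a\<le>degree p. coeff p a * (\<Sum>i<d. u i * \<beta> i * \<zeta> i ^ a))"
          by (subst sum.swap) (simp add: sum_distrib_left)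
        also have "\<dots> = 0" by (rule sum.neutral) (use pow0 that in auto)
        finally show ?thesis .
      qed
      have "u i = 0" if i: "i < d" for i
      proof -
        define p where "p = (\<Prod>l\<in>{..<d} - {i}. [:- \<zeta> l, 1:])"
        have "degree p = card ({..<d} - {i})"
          unfolding p_def by (subst degree_prod_eq_sum_degree) auto
        then have "degree p < d" using i by simp
        from poly0[OF this] have "(\<Sum>j<d. u j * \<beta> j * poly p (\<zeta> j)) = 0" .
        also have "(\<Sum>j<d. u j * \<beta> j * poly p (\<zeta> j)) = (\<Sum>j<d. if j = i then u i * \<beta> i * poly p (\<zeta> i) else 0)"
        proof (intro sum.cong refl)
          fix j assume "j \<in> {..<d}"
          then show "u j * \<beta> j * poly p (\<zeta> j) = (if j = i then u i * \<beta> i * poly p (\<zeta> i) else 0)"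
            by (auto simp: p_def poly_prod)
        qed
        finally have "u i * \<beta> i * poly p (\<zeta> i) = 0" using i by simp
        moreover have "poly p (\<zeta> i) \<noteq> 0"
          using inj_onD[OF \<zeta>] i by (auto simp: p_def poly_prod)
        ultimately show "u i = 0" using \<beta>[OF i] by simp
      qed
      then have "v = 0\<^sub>v d" using v(1) by (intro eq_vecI) (auto simp: u_def)
      then show False using v(2) by simp
    qed
    moreover have "0 dvd det (mat d d W) *
        (coeff (char_poly (mat d d N)) k - coeff (char_poly (mat d d (\<lambda>(i, j). to_ac (M $$ (i, j))))) k)" for k
      by (rule dvd_char_poly_diff) (simp add: intertwine)
    ultimately have "char_poly (mat d d N) = char_poly (mat d d (\<lambda>(i, j). to_ac (M $$ (i, j))))"
      by (intro poly_eqI) simp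
    also have "mat d d (\<lambda>(i, j). to_ac (M $$ (i, j))) = map_mat to_ac M"
      using M by (intro eq_matI) auto
    finally show ?thesis by (simp add: A.char_poly_hom[OF M])
  qed
  obtain bs M where "good bs M"
  proof -
    define bs where "bs = map (\<lambda>i. monom (1 :: 'k) i) [0..<d]"
    define M where "M = mat d d (\<lambda>(i, j). coeff (T (bs ! j)) i)"
    have set_bs: "set bs = B0" by (auto simp: bs_def B0_def)
    have "T (bs ! j) = (\<Sum>i<d. smult (M $$ (i, j)) (bs ! i))" if j: "j < d" for j
    proof (rule poly_eqI)
      fix k
      have "degree (T (bs ! j)) < d" using j by (intro T) (simp add: bs_def degree_monom_eq)
      then show "coeff (T (bs ! j)) k = coeff (\<Sum>i<d. smult (M $$ (i, j)) (bs ! i)) k"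
        using j by (simp add: coeff_sum M_def coeff_eq_0 bs_def if_distrib cong: if_cong)
    qed
    then have "good bs M"
      unfolding good_def set_bs using indep0 span0
      by (auto simp: M_def bs_def distinct_map inj atLeast0LessThan)
    then show ?thesis by (rule that)
  qed
  have "module_char smult V T = char_poly M"
    unfolding module_char_def
  proof (rule the_equality)
    show "\<exists>bs M'. distinct bs \<and> \<not> vs.dependent (set bs) \<and> vs.span (set bs) = V \<and>
      M' \<in> carrier_mat (length bs) (length bs) \<and>
      (\<forall>j<length bs. T (bs ! j) = (\<Sum>i<length bs. smult (M' $$ (i, j)) (bs ! i))) \<and> char_poly M = char_poly M'"
      using \<open>good bs M\<close> unfolding good_def by blast
    fix p assume "\<exists>bs M'. distinct bs \<and> \<not> vs.dependent (set bs) \<and> vs.span (set bs) = V \<and>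
      M' \<in> carrier_mat (length bs) (length bs) \<and>
      (\<forall>j<length bs. T (bs ! j) = (\<Sum>i<length bs. smult (M' $$ (i, j)) (bs ! i))) \<and> p = char_poly M'"
    then obtain bs' M' where "good bs' M'" "p = char_poly M'" unfolding good_def by blast
    then have "map_poly to_ac p = map_poly to_ac (char_poly M)"
      using good_char[OF \<open>good bs M\<close>] good_char by simp
    then show "p = char_poly M" using A1.eq_iff by blast
  qed
  then show ?thesis using good_char[OF \<open>good bs M\<close>] by (simp add: V_def)
qed

text \<open>The polynomial is encoded as a multivariate one in the single variable \<open>k\<close>,
  to which injectivity of \<open>mpoly_eval\<close> applies. It ensures that no \<open>z k\<close>
  is a root of a prime \<open>f\<close>.\<close>

lemma rational_function_field_transcendental:
  fixes a :: "'a::field poly"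
  assumes rf: "rational_function_field n \<iota> z" and k: "k \<in> {1..n}" and 0: "poly (map_poly \<iota> a) (z k) = 0"
  shows "a = 0"
proof -
  interpret field_hom \<iota> using rf by (simp add: rational_function_field_def)
  define ek where "ek = (\<lambda>i :: nat. Poly_Mapping.single k i)"
  have inj: "inj ek" by (rule injI) (metis ek_def lookup_single_eq)
  define p where "p = (\<Sum>i\<le>degree a. Poly_Mapping.single (ek i) (coeff a i))"
  have lookup: "Poly_Mapping.lookup p (ek i) = coeff a i" for i
  proof -
    have "Poly_Mapping.lookup p (ek i) = (\<Sum>j\<le>degree a. if j = i then coeff a j else 0)"
      unfolding p_def by (simp add: lookup_sum lookup_single when_def inj_eq[OF inj])
    then show ?thesis by (simp add: coeff_eq_0)
  qed
  have keys: "Poly_Mapping.keys p = ek ` {i. coeff a i \<noteq> 0}"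
  proof (intro equalityI subsetI)
    fix e assume e: "e \<in> Poly_Mapping.keys p"
    then have "e \<in> (\<Union>i\<le>degree a. Poly_Mapping.keys (Poly_Mapping.single (ek i) (coeff a i)))"
      using keys_sum[of "\<lambda>i. Poly_Mapping.single (ek i) (coeff a i)" "{..degree a}"] by (auto simp: p_def)
    then obtain i where "e = ek i" by (auto split: if_splits)
    then show "e \<in> ek ` {i. coeff a i \<noteq> 0}" using e lookup by (auto simp: in_keys_iff)
  qed (auto simp: in_keys_iff lookup)
  have "p \<in> mpolys_in n" using k by (auto simp: mpolys_in_def keys ek_def)
  moreover have "0 \<in> mpolys_in n" by (simp add: mpolys_in_def)
  moreover have "mpoly_eval \<iota> z p = 0"
  proof -
    have "mpoly_eval \<iota> z p = (\<Sum>i\<in>{i. coeff a i \<noteq> 0}. \<iota> (coeff a i) *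
        (\<Prod>l\<in>Poly_Mapping.keys (ek i). z l ^ Poly_Mapping.lookup (ek i) l))"
      unfolding mpoly_eval_def keys using inj by (subst sum.reindex) (auto simp: lookup intro: inj_on_subset)
    also have "\<dots> = (\<Sum>i\<in>{i. coeff a i \<noteq> 0}. \<iota> (coeff a i) * z k ^ i)"
      by (intro sum.cong) (auto simp: ek_def)
    also have "\<dots> = (\<Sum>i\<le>degree a. \<iota> (coeff a i) * z k ^ i)"
      by (rule sum.mono_neutral_left) (auto simp: le_degree)
    also have "\<dots> = poly (map_poly \<iota> a) (z k)"
      by (simp add: poly_altdef)
    finally show ?thesis using 0 by simp
  qed
  moreover have "mpoly_eval \<iota> z 0 = 0" by (simp add: mpoly_eval_def)
  ultimately have "p = 0" using rf unfolding rational_function_field_def inj_on_def by metis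
  then show "a = 0" using lookup by (intro poly_eqI) (metis coeff_0 lookup_zero)
qed

lemma theta_frob_funpow:
  fixes x :: "'k::field poly"
  shows "(theta_frob q ^^ s) x = pcompose x (theta ^ (q ^ s))"
proof (induction s)
  case (Suc s)
  have "pcompose (theta ^ (q ^ s)) (theta ^ q) = (theta :: 'k::field poly) ^ (q ^ Suc s)"
    by (simp add: pcompose_hom.hom_power pcompose_idR power_mult mult.commute flip: power_mult)
  then show ?case using Suc by (simp add: theta_frob_def flip: pcompose_assoc)
qed simp

section \<open>Coordinates on the quotient modulo \<open>f\<close> over the rational function
  field\<close>

locale rff = field_hom \<iota> for \<iota> :: "'a::{field,finite} \<Rightarrow> 'k::field" +
  fixes n :: nat and z :: "nat \<Rightarrow> 'k"
  assumes rff: "rational_function_field n \<iota> z"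
begin

definition \<kappa> :: "'a \<Rightarrow> 'k alg_closure" where "\<kappa> c = to_ac (\<iota> c)"

definition eval_prod :: "'a poly \<Rightarrow> 'k" where
  "eval_prod a = (\<Prod>k=1..n. poly (map_poly \<iota> a) (z k))"

sublocale base: map_poly_inj_idom_hom \<iota> ..

sublocale L: fq_hom \<kappa> "CARD('a)"
  by unfold_locales (auto simp: \<kappa>_def hom_add hom_mult)

interpretation A: field_hom "to_ac :: 'k \<Rightarrow> 'k alg_closure" by unfold_locales auto

interpretation A1: map_poly_inj_idom_hom "to_ac :: 'k \<Rightarrow> 'k alg_closure" ..

lemma map_to_ac: "map_poly to_ac (map_poly \<iota> a) = map_poly \<kappa> a"
  by (rule poly_eqI) (simp add: coeff_map_poly \<kappa>_def)

lemma eval_prod_mult: "eval_prod (a * b) = eval_prod a * eval_prod b"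
  by (simp add: eval_prod_def base.hom_mult prod.distrib)

context
  fixes f :: "'a poly"
  assumes f: "f \<in> monic_primes"
begin

definition xi :: "'k alg_closure" where "xi = (SOME \<xi>. L.ev \<xi> f = 0)"

lemma xi: "L.ev xi f = 0"
proof -
  have "degree (map_poly \<kappa> f) > 0" using degree_monic_prime[OF f] by simp
  then have "\<exists>\<xi>. L.ev \<xi> f = 0"
    unfolding L.ev_def using alg_closed_imp_poly_has_root by blast
  then show ?thesis unfolding xi_def by (rule someI_ex)
qed

abbreviation rt :: "nat \<Rightarrow> 'k alg_closure" where "rt i \<equiv> xi ^ (CARD('a) ^ i)"

lemma poly_mod_conj: "poly (map_poly to_ac (y mod map_poly \<iota> f)) (rt i) = poly (map_poly to_ac y) (rt i)"
proof -
  have "poly (map_poly to_ac (map_poly \<iota> f)) (rt i) = 0"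
    unfolding map_to_ac using L.root_conj[OF f xi] by (simp add: L.ev_def)
  moreover have "map_poly to_ac y = map_poly to_ac (y div map_poly \<iota> f) * map_poly to_ac (map_poly \<iota> f)
      + map_poly to_ac (y mod map_poly \<iota> f)"
    by (subst (1) div_mult_mod_eq[of y "map_poly \<iota> f", symmetric]) (simp only: A1.hom_add A1.hom_mult)
  ultimately show ?thesis by simp
qed

lemma quot_char_eq: "quot_char (map_poly \<iota> f) = map_poly \<iota> f"
proof -
  have deg: "degree (map_poly \<iota> f) = degree f" by simp
  define N :: "nat \<times> nat \<Rightarrow> 'k alg_closure" where "N = (\<lambda>(i, c). if i = c then rt i else 0)"
  have "map_poly to_ac (quot_char (map_poly \<iota> f)) = char_poly (mat (degree f) (degree f) N)"
    unfolding quot_char_def range_mod_poly[of "map_poly \<iota> f", unfolded deg, OF degree_monic_prime[OF f]]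
  proof (rule module_char_eval[where \<beta> = "\<lambda>_. 1" and \<zeta> = rt])
    show "inj_on rt {..<degree f}" by (rule L.inj_on_conj[OF f xi])
    show "degree (theta * x mod map_poly \<iota> f) < degree f" for x
      using range_mod_poly[of "map_poly \<iota> f", unfolded deg, OF degree_monic_prime[OF f]] by blast
    fix x i assume "i < degree f"
    then have "(\<Sum>c<degree f. N (i, c) * (1 * poly (map_poly to_ac x) (rt c))) =
        (\<Sum>c<degree f. if c = i then rt i * poly (map_poly to_ac x) (rt i) else 0)"
      by (intro sum.cong) (auto simp: N_def)
    also have "\<dots> = rt i * poly (map_poly to_ac x) (rt i)" using \<open>i < degree f\<close> by simp
    also have "\<dots> = poly (map_poly to_ac (theta * x)) (rt i)"
      by (simp add: A1.hom_mult map_poly_pCons del: mult_pCons_left)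
    finally show "1 * poly (map_poly to_ac (theta * x mod map_poly \<iota> f)) (rt i) =
        (\<Sum>c<degree f. N (i, c) * (1 * poly (map_poly to_ac x) (rt c)))"
      by (simp only: poly_mod_conj mult_1)
  qed (use degree_monic_prime[OF f] in auto)
  also have "\<dots> = (\<Prod>i<degree f. [:- rt i, 1:])"
    unfolding char_poly_mat by (subst det_mat_lower_triangular) (auto simp: N_def)
  also have "\<dots> = map_poly \<kappa> f" by (rule L.map_poly_eq_prod_conj[OF f xi, symmetric])
  also have "\<dots> = map_poly to_ac (map_poly \<iota> f)" by (rule map_to_ac[symmetric])
  finally show ?thesis using A1.eq_iff by blast
qed

text \<open>The rescaling of the \<open>i\<close>-th coordinate. At the \<open>i\<close>-th
  conjugate the product of the \<open>ell\<close> factors of order \<open>s\<close> has the value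
  \<open>beta (i + s) / beta i\<close>, so these factors disappear from the action.\<close>

definition beta :: "nat \<Rightarrow> 'k alg_closure" where
  "beta i = (\<Prod>l<i. \<Prod>k=1..n. to_ac (z k) - rt l)"

lemma poly_z_conj: "to_ac (poly (map_poly \<iota> f) (z k)) = (\<Prod>l<degree f. to_ac (z k) - rt (i + l))"
proof -
  have "to_ac (poly (map_poly \<iota> f) (z k)) = poly (map_poly \<kappa> f) (to_ac (z k))"
    by (simp add: A.poly_map_poly flip: map_to_ac)
  also have "map_poly \<kappa> f = (\<Prod>l<degree f. [:- (rt i ^ (CARD('a) ^ l)), 1:])"
    by (rule L.map_poly_eq_prod_conj[OF f L.root_conj[OF f xi]])
  also have "poly \<dots> (to_ac (z k)) = (\<Prod>l<degree f. to_ac (z k) - rt (i + l))"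
    by (simp add: poly_prod power_add flip: power_mult)
  finally show ?thesis .
qed

lemma beta_nz: "beta i \<noteq> 0"
proof -
  have "to_ac (z k) \<noteq> rt l" if "k \<in> {1..n}" for k l
  proof
    assume "to_ac (z k) = rt l"
    then have "poly (map_poly to_ac (map_poly \<iota> f)) (to_ac (z k)) = 0"
      unfolding map_to_ac using L.root_conj[OF f xi] by (simp add: L.ev_def)
    moreover have "poly (map_poly to_ac p) (to_ac x) = to_ac (poly p x)" for p :: "'k poly" and x
      by (simp add: A.poly_map_poly)
    ultimately have "poly (map_poly \<iota> f) (z k) = 0" by simp
    then have "f = 0" using rational_function_field_transcendental[OF rff that] by blast
    then show False using degree_monic_prime[OF f] by simp
  qed
  then show ?thesis by (auto simp: beta_def)
qed

lemma beta_add: "beta (i + s) = beta i * (\<Prod>k=1..n. \<Prod>l<s. to_ac (z k) - rt (i + l))"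
proof -
  have "beta (i + s) = beta i * (\<Prod>l<s. \<Prod>k=1..n. to_ac (z k) - rt (i + l))"
    by (induction s) (simp_all add: beta_def mult.assoc)
  also have "(\<Prod>l<s. \<Prod>k=1..n. to_ac (z k) - rt (i + l)) = (\<Prod>k=1..n. \<Prod>l<s. to_ac (z k) - rt (i + l))"
    by (rule prod.swap)
  finally show ?thesis .
qed

text \<open>The origin of the value of \<open>y\<close>: over a full period each \<open>z k\<close>
  is subtracted once from every root of \<open>f\<close>, which produces
  \<open>f(z_k)\<close>.\<close>

lemma beta_period: "beta (i + degree f) = to_ac (eval_prod f) * beta i"
  by (simp add: beta_add eval_prod_def to_ac_prod poly_z_conj[of _ i] mult.commute)

context
  fixes \<phi> :: "'a poly \<Rightarrow> 'a poly poly" and \<Phi> :: "'k poly \<Rightarrow> 'k poly poly" and r :: nat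
  assumes drinfeld: "drinfeld_module r \<phi>" and assoc: "associated_module \<iota> n z r \<phi> \<Phi>"
begin

lemma deg_phi: "degree (\<phi> theta) = r" and phi_0: "coeff (\<phi> theta) 0 = theta"
  using drinfeld by (auto simp: drinfeld_module_def)

lemma Phi_theta: "coeff (\<Phi> theta) s = (if s \<le> r then (\<Prod>k=1..n. ell CARD('a) s (z k)) * map_poly \<iota> (coeff (\<phi> theta) s) else 0)"
proof -
  have "\<Phi> theta = (\<Sum>i\<le>r. monom ((\<Prod>k=1..n. ell CARD('a) i (z k)) * map_poly \<iota> (coeff (\<phi> theta) i)) i)"
    using assoc by (simp add: associated_module_def)
  then show ?thesis by (simp only: coeff_sum coeff_monom) (simp add: if_distrib cong: if_cong)
qed

text \<open>The power \<open>s\<close> of the twist moves evaluation from the \<open>i\<close>-th to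
  the \<open>(i + s)\<close>-th conjugate, and \<open>beta\<close> absorbs the \<open>ell\<close>
  factors; what remains are the coefficients of \<open>\<phi>\<close> itself.\<close>

lemma tw_act_Phi_eval:
  "beta i * poly (map_poly to_ac (tw_act (theta_frob CARD('a)) (\<Phi> theta) x)) (rt i) =
   (\<Sum>s\<le>r. L.ev (rt i) (coeff (\<phi> theta) s) * (beta (i + s) * poly (map_poly to_ac x) (rt (i + s))))"
proof -
  have "degree (\<Phi> theta) \<le> r" by (rule degree_le) (simp add: Phi_theta)
  then have "tw_act (theta_frob CARD('a)) (\<Phi> theta) x = (\<Sum>s\<le>r.
      ((\<Prod>k=1..n. ell CARD('a) s (z k)) * map_poly \<iota> (coeff (\<phi> theta) s)) * pcompose x (theta ^ (CARD('a) ^ s)))"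
    by (subst tw_act_altdef[of _ r]) (simp_all add: Phi_theta theta_frob_funpow)
  moreover have "poly (map_poly to_ac (ell CARD('a) s w)) (rt i) = (\<Prod>l<s. to_ac w - rt (i + l))" for s w
  proof -
    have "map_poly to_ac [:w:] = [:to_ac w:]"
      by (rule poly_eqI) (simp add: coeff_map_poly coeff_pCons split: nat.splits)
    then have "map_poly to_ac ([:w:] - theta ^ m) = [:to_ac w:] - theta ^ m" for m
      by (simp add: A1.hom_minus A1.hom_power map_poly_pCons)
    then show ?thesis
      by (simp add: ell_def A1.hom_prod poly_prod power_add poly_power flip: power_mult)
  qed
  moreover have "poly (map_poly to_ac (map_poly \<iota> a)) (rt i) = L.ev (rt i) a" for a
    by (simp add: map_to_ac L.ev_def)
  moreover have "poly (map_poly to_ac (pcompose x (theta ^ (CARD('a) ^ s)))) (rt i) = poly (map_poly to_ac x) (rt (i + s))" for s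
  proof -
    have "map_poly to_ac (pcompose x (theta ^ m)) = pcompose (map_poly to_ac x) (theta ^ m)" for m
      by (simp add: A.map_poly_pcompose A1.hom_power map_poly_pCons)
    then show ?thesis by (simp add: poly_pcompose poly_power power_add flip: power_mult)
  qed
  ultimately show ?thesis
    by (simp add: A1.hom_sum A1.hom_mult A1.hom_prod poly_sum poly_prod beta_add sum_distrib_left mult_ac)
qed

lemma beta_eval_period:
  "beta i * poly (map_poly to_ac x) (rt i) =
   to_ac (eval_prod f) ^ (i div degree f) * (beta (i mod degree f) * poly (map_poly to_ac x) (rt (i mod degree f)))"
proof -
  have "beta (m * degree f + i) * poly (map_poly to_ac x) (rt (m * degree f + i)) =
      to_ac (eval_prod f) ^ m * (beta i * poly (map_poly to_ac x) (rt i))" for m i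
  proof (induction m)
    case (Suc m)
    have c: "rt (j + degree f) = rt j" for j
    proof -
      have "rt (j + degree f) = rt (degree f) ^ (CARD('a) ^ j)" by (simp add: power_add mult.commute flip: power_mult)
      then show ?thesis by (simp only: L.frob_period[OF f xi])
    qed
    have "Suc m * degree f + i = (m * degree f + i) + degree f" by simp
    then show ?case using Suc by (simp only: beta_period c power_Suc) (simp add: mult.assoc)
  qed simp
  from this[of "i div degree f" "i mod degree f"] show ?thesis by simp
qed

lemma tw_quot_char_eq_shift_det:
  "map_poly to_ac (tw_quot_char (theta_frob CARD('a)) \<Phi> (map_poly \<iota> f)) =
   poly (L.shift_det xi (degree f) (\<phi> theta)) [:to_ac (eval_prod f):]"
proof -
  have deg: "degree (map_poly \<iota> f) = degree f" by simp
  let ?d = "degree f" and ?F = "to_ac (eval_prod f)"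
  \<comment> \<open>Coordinates with index beyond \<open>degree f\<close> are folded back by
    \<open>beta_eval_period\<close>, each period contributing a factor \<open>?F\<close>.\<close>
  define N where "N = (\<lambda>(i, c). \<Sum>s\<le>r. if (i + s) mod ?d = c
    then L.ev (rt i) (coeff (\<phi> theta) s) * ?F ^ ((i + s) div ?d) else 0)"
  have "map_poly to_ac (tw_quot_char (theta_frob CARD('a)) \<Phi> (map_poly \<iota> f)) = char_poly (mat ?d ?d N)"
    unfolding tw_quot_char_def range_mod_poly[of "map_poly \<iota> f", unfolded deg, OF degree_monic_prime[OF f]]
  proof (rule module_char_eval[where \<beta> = beta and \<zeta> = rt])
    show "inj_on rt {..<?d}" by (rule L.inj_on_conj[OF f xi])
    show "degree (tw_act (theta_frob CARD('a)) (\<Phi> theta) x mod map_poly \<iota> f) < ?d" for x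
      using range_mod_poly[of "map_poly \<iota> f", unfolded deg, OF degree_monic_prime[OF f]] by blast
    fix x i assume i: "i < ?d"
    have "(\<Sum>c<?d. N (i, c) * (beta c * poly (map_poly to_ac x) (rt c))) =
        (\<Sum>s\<le>r. \<Sum>c<?d. if c = (i + s) mod ?d then L.ev (rt i) (coeff (\<phi> theta) s) * ?F ^ ((i + s) div ?d) *
          (beta c * poly (map_poly to_ac x) (rt c)) else 0)"
      unfolding N_def split sum_distrib_right by (subst sum.swap) (intro sum.cong, auto)
    also have "\<dots> = (\<Sum>s\<le>r. L.ev (rt i) (coeff (\<phi> theta) s) * ?F ^ ((i + s) div ?d) *
          (beta ((i + s) mod ?d) * poly (map_poly to_ac x) (rt ((i + s) mod ?d))))"
      using degree_monic_prime[OF f] by (intro sum.cong) auto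
    also have "\<dots> = (\<Sum>s\<le>r. L.ev (rt i) (coeff (\<phi> theta) s) * (beta (i + s) * poly (map_poly to_ac x) (rt (i + s))))"
      by (intro sum.cong refl) (simp only: beta_eval_period[of "i + _"] mult.assoc)
    finally show "beta i * poly (map_poly to_ac (tw_act (theta_frob CARD('a)) (\<Phi> theta) x mod map_poly \<iota> f)) (rt i) =
        (\<Sum>c<?d. N (i, c) * (beta c * poly (map_poly to_ac x) (rt c)))"
      by (simp only: poly_mod_conj tw_act_Phi_eval)
  qed (use degree_monic_prime[OF f] beta_nz in auto)
  also have "\<dots> = cyc_det ?d r (L.shift_coeff xi (\<phi> theta)) [:?F:]"
    unfolding char_poly_mat cyc_det_def
  proof (intro arg_cong[of _ _ det] cong_mat refl, unfold split)
    fix j c assume jc: "j < ?d" "c < ?d"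
    have pow: "[:?F:] ^ m = [:?F ^ m:]" for m by (simp add: poly_const_pow)
    have "(\<Sum>s\<le>r. if (j + s) mod ?d = c then L.shift_coeff xi (\<phi> theta) j s * [:?F:] ^ ((j + s) div ?d) else 0) =
        (\<Sum>s\<le>r. (if s = 0 then if j = c then [:0, 1:] else 0 else 0) -
          [:if (j + s) mod ?d = c then L.ev (rt j) (coeff (\<phi> theta) s) * ?F ^ ((j + s) div ?d) else 0:])"
      using jc by (intro sum.cong refl) (auto simp: L.shift_coeff_def pow)
    also have "\<dots> = (if j = c then [:0, 1:] else 0) - [:N (j, c):]"
      by (simp add: sum_subtractf sum_pCons_0 N_def)
    finally show "(if j = c then [:0, 1:] else 0) - [:N (j, c):] =
        (\<Sum>s\<le>r. if (j + s) mod ?d = c then L.shift_coeff xi (\<phi> theta) j s * [:?F:] ^ ((j + s) div ?d) else 0)" ..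
  qed
  also have "\<dots> = poly (L.shift_det xi ?d (\<phi> theta)) [:?F:]"
    unfolding L.shift_det_def poly_hom.hom_cyc_det by (simp add: deg_phi)
  finally show ?thesis .
qed

end

end

end

text \<open>The hypothesis says \<open>d * i \<le> m * (d - a)\<close> with
  \<open>a \<le> d\<close>, and this only weakens when \<open>m\<close> grows to \<open>r\<close>.
  It makes the weight bound uniform although the reduced rank depends on \<open>f\<close>.\<close>

lemma weight_rescale:
  fixes a b d i m r :: nat
  assumes "m * a + d * i \<le> d * m" "1 \<le> m" "m \<le> r"
  shows "r * a + d * i \<le> d * r"
proof -
  have "m * a \<le> m * d" using assms(1) by (metis add_leD1 mult.commute)
  then have "a \<le> d" using assms(2) by simp
  then obtain b where d: "d = a + b" by (metis le_Suc_ex)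
  have "d * i \<le> m * b" using assms(1) by (simp add: d algebra_simps)
  also have "\<dots> \<le> r * b" using assms(3) by (rule mult_le_mono1)
  finally show ?thesis by (simp add: d algebra_simps)
qed

text \<open>Coefficientwise form of \<open>f * D_f(x) = c(f) * P(f x)\<close>, with \<open>P\<close>
  the characteristic polynomial of Frobenius; the factor \<open>f\<close> removes the exponents
  \<open>i - 1\<close> of the definition.\<close>

lemma coeff_local_poly:
  fixes \<phi> :: "'a::{field,finite} poly \<Rightarrow> 'a poly poly"
  assumes "drinfeld_module r \<phi>" "f \<in> monic_primes" "red_rank \<phi> f \<ge> 1"
  shows "f * coeff (local_poly \<phi> f) i = coeff (smult [:frob_const \<phi> f:] (frob_char_poly \<phi> f)) i * f ^ i"
proof -
  define R where "R = red_rank \<phi> f"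
  define p where "p = coeff (frob_char_poly \<phi> f)"
  define c where "c = frob_const \<phi> f"
  have R: "R \<ge> 1" using assms(3) by (simp add: R_def)
  have p: "c \<noteq> 0" "p 0 = smult (inverse c) f" "p R = 1" "\<And>i. i > R \<Longrightarrow> p i = 0"
    using frob_char_poly_props(1-4)[OF assms] by (auto simp: p_def R_def c_def coeff_eq_0)
  have sum_monom: "coeff (\<Sum>j=1..m. monom (u j) j) i = (if i \<in> {1..m} then u i else 0)" for u :: "nat \<Rightarrow> 'a poly" and m
  proof -
    have "coeff (\<Sum>j=1..m. monom (u j) j) i = (\<Sum>j=1..m. if j = i then u j else 0)"
      by (simp add: coeff_sum)
    then show ?thesis by (simp only: sum.delta[OF finite_atLeastAtMost])
  qed
  have "local_poly \<phi> f = 1 + (\<Sum>j=1..R - 1. monom (smult c (p j * f ^ (j - 1))) j) + monom (smult c (f ^ (R - 1))) R"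
    using R by (simp add: local_poly_def Let_def R_def[symmetric] p_def[symmetric] c_def[symmetric])
  then have D: "coeff (local_poly \<phi> f) i = (if i = 0 then 1 else 0)
      + (if i \<in> {1..R - 1} then smult c (p i * f ^ (i - 1)) else 0)
      + (if i = R then smult c (f ^ (R - 1)) else 0)"
    by (simp only: coeff_add sum_monom coeff_monom coeff_1) auto
  have f_pow: "f * f ^ (i - 1) = f ^ i" if "i > 0" for i using that by (cases i) auto
  consider "i = 0" | "i \<in> {1..R - 1}" | "i = R" | "i > R" using R by fastforce
  then have "f * coeff (local_poly \<phi> f) i = smult c (p i) * f ^ i"
  proof cases
    case 1
    then show ?thesis using R p D by simp
  next
    case 2
    then have "f * coeff (local_poly \<phi> f) i = smult c (p i * (f * f ^ (i - 1)))"
      using R by (auto simp: D mult.left_commute)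
    then show ?thesis using 2 by (subst (asm) f_pow) auto
  next
    case 3
    then have "f * coeff (local_poly \<phi> f) i = smult c (f * f ^ (i - 1))" using R D by auto
    then show ?thesis using 3 R p by (subst (asm) f_pow) auto
  next
    case 4
    then show ?thesis using R p D by auto
  qed
  then show ?thesis by (simp add: p_def c_def)
qed

context rff begin

interpretation A: field_hom "to_ac :: 'k \<Rightarrow> 'k alg_closure" by unfold_locales auto

interpretation A1: map_poly_inj_idom_hom "to_ac :: 'k \<Rightarrow> 'k alg_closure" ..

text \<open>\<open>Q\<close> is \<open>\<Delta>\<close> over the finite field. For positive reduced
  rank it is the scaled characteristic polynomial of Frobenius, transferred to the closure of
  \<open>'k\<close>; for reduced rank 0 the shift drops out and \<open>\<Delta>\<close> is the
  constant \<open>f\<close>.\<close>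

lemma local_factor:
  assumes f: "f \<in> monic_primes" and drinfeld: "drinfeld_module r \<phi>" and assoc: "associated_module \<iota> n z r \<phi> \<Phi>"
  obtains Q :: "'a poly poly" where
    "tw_quot_char (theta_frob CARD('a)) \<Phi> (map_poly \<iota> f) = poly (map_poly (map_poly \<iota>) Q) [:eval_prod f:]"
    "\<And>i. f * coeff (local_poly \<phi> f) i = coeff Q i * f ^ i"
    "\<And>i. coeff Q i \<noteq> 0 \<Longrightarrow> r * degree (coeff Q i) + degree f * i \<le> degree f * r"
proof -
  let ?\<xi> = "xi f"
  note xi = xi[OF f]
  have eq: "tw_quot_char (theta_frob CARD('a)) \<Phi> (map_poly \<iota> f) = poly (map_poly (map_poly \<iota>) Q) [:eval_prod f:]"
    if Q: "L.shift_det ?\<xi> (degree f) (\<phi> theta) = map_poly (map_poly \<kappa>) Q" for Q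
  proof -
    have "map_poly (map_poly \<kappa>) Q = map_poly (map_poly to_ac) (map_poly (map_poly \<iota>) Q)"
      by (rule poly_eqI) (simp add: coeff_map_poly map_to_ac)
    moreover have "map_poly to_ac [:eval_prod f:] = [:to_ac (eval_prod f):]"
      by (rule poly_eqI) (simp add: coeff_map_poly coeff_pCons split: nat.splits)
    ultimately have "map_poly to_ac (tw_quot_char (theta_frob CARD('a)) \<Phi> (map_poly \<iota> f)) =
        map_poly to_ac (poly (map_poly (map_poly \<iota>) Q) [:eval_prod f:])"
      using tw_quot_char_eq_shift_det[OF f drinfeld assoc] Q by (simp add: A1.poly_map_poly[symmetric])
    then show ?thesis using A1.eq_iff by blast
  qed
  have le_r: "red_rank \<phi> f \<le> r"
    using red_rank_bounds(2)[of \<phi> f] deg_phi[OF f drinfeld assoc] by simp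
  have ev_0: "L.ev ?\<xi> (coeff (\<phi> theta) s) = 0" if "s > red_rank \<phi> f" for s
    using red_rank_bounds(1)[OF that] L.ev_eq_0_iff[OF f xi] by blast
  show ?thesis
  proof (cases "red_rank \<phi> f = 0")
    case True
    have "L.shift_det ?\<xi> (degree f) (\<phi> theta) = cyc_det (degree f) 0 (\<lambda>j s. [:L.shift_coeff ?\<xi> (\<phi> theta) j s:]) [:0, 1:]"
      unfolding L.shift_det_def
    proof (rule cyc_det_truncate)
      fix j s :: nat assume "0 < s"
      then show "[:L.shift_coeff ?\<xi> (\<phi> theta) j s:] = 0"
        using ev_0[of s] True by (simp add: L.shift_coeff_def zero_power flip: L.ev_pow_q_pow)
    qed simp
    also have "\<dots> = det (mat (degree f) (degree f) (\<lambda>(j, c). if j = c then [:L.shift_coeff ?\<xi> (\<phi> theta) j 0:] else 0))"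
      unfolding cyc_det_def by (intro arg_cong[of _ _ det] cong_mat) auto
    also have "\<dots> = (\<Prod>j<degree f. [:L.shift_coeff ?\<xi> (\<phi> theta) j 0:])"
      by (subst det_mat_lower_triangular) auto
    also have "\<dots> = [:\<Prod>j<degree f. L.shift_coeff ?\<xi> (\<phi> theta) j 0:]"
    proof -
      have "(\<Prod>j\<in>J. [:u j:]) = [:\<Prod>j\<in>J. u j:]" for J and u :: "nat \<Rightarrow> 'k alg_closure poly"
        by (induction J rule: infinite_finite_induct) (auto simp: one_pCons)
      then show ?thesis .
    qed
    also have "(\<Prod>j<degree f. L.shift_coeff ?\<xi> (\<phi> theta) j 0) = map_poly \<kappa> f"
      by (simp add: L.shift_coeff_0[OF f xi phi_0[OF f drinfeld assoc]] L.map_poly_eq_prod_conj[OF f xi])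
    also have "[:map_poly \<kappa> f:] = map_poly (map_poly \<kappa>) [:f:]"
      by (rule poly_eqI) (simp add: coeff_map_poly coeff_pCons split: nat.splits)
    finally have Q: "L.shift_det ?\<xi> (degree f) (\<phi> theta) = map_poly (map_poly \<kappa>) [:f:]" .
    have D: "f * coeff (local_poly \<phi> f) i = coeff [:f:] i * f ^ i" for i
      by (cases i) (simp_all add: local_poly_def True)
    have deg: "r * degree (coeff [:f:] i) + degree f * i \<le> degree f * r" if "coeff [:f:] i \<noteq> 0" for i
      using that by (cases i) simp_all
    show ?thesis by (rule that[OF eq[OF Q] D deg])
  next
    case False
    then have rk: "red_rank \<phi> f \<ge> 1" by simp
    let ?Q = "smult [:frob_const \<phi> f:] (frob_char_poly \<phi> f)"
    obtain \<xi>' where \<xi>': "fq_hom.ev to_ac \<xi>' f = 0"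
      "fq_hom.shift_det to_ac (CARD('a)) \<xi>' (degree f) (\<phi> theta) = map_poly (map_poly to_ac) ?Q"
      using frob_char_poly_props(5)[OF drinfeld f rk] by blast
    have "fq_hom (to_ac :: 'a \<Rightarrow> 'a alg_closure) CARD('a)" by unfold_locales auto
    from shift_det_transfer[OF this L.fq_hom_axioms f \<xi>'(1) xi \<xi>'(2)]
    have Q: "L.shift_det ?\<xi> (degree f) (\<phi> theta) = map_poly (map_poly \<kappa>) ?Q" .
    have w: "weight_le (red_rank \<phi> f) (degree f) (int (degree f) * int (red_rank \<phi> f)) (map_poly (map_poly \<kappa>) ?Q)"
      unfolding Q[symmetric]
      by (rule L.weight_shift_det[OF degree_monic_prime[OF f] red_rank_bounds(2)]) (rule ev_0)
    have deg: "r * degree (coeff ?Q i) + degree f * i \<le> degree f * r" if "coeff ?Q i \<noteq> 0" for i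
    proof -
      have "coeff (coeff (map_poly (map_poly \<kappa>) ?Q) i) (degree (coeff ?Q i)) = \<kappa> (lead_coeff (coeff ?Q i))"
        by (simp only: coeff_map_poly map_poly_0 L.hom_zero)
      moreover have "\<kappa> (lead_coeff (coeff ?Q i)) \<noteq> 0" using that by (simp only: L.hom_0_iff leading_coeff_0_iff) simp
      ultimately have "int (red_rank \<phi> f * degree (coeff ?Q i) + degree f * i) \<le> int (degree f) * int (red_rank \<phi> f)"
        using w unfolding weight_le_def by metis
      then have "red_rank \<phi> f * degree (coeff ?Q i) + degree f * i \<le> degree f * red_rank \<phi> f"
        by (metis of_nat_le_iff of_nat_mult)
      then show ?thesis using rk le_r by (rule weight_rescale)
    qed
    show ?thesis
      by (rule that[OF eq[OF Q] coeff_local_poly[OF drinfeld f rk] deg])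
  qed
qed

end

section \<open>Euler products in the field of Laurent series\<close>

lemma one_in_monics: "1 \<in> (monics :: 'a::field poly set)"
  by (simp add: monics_def)

lemma monics_mult: "a \<in> monics \<Longrightarrow> b \<in> monics \<Longrightarrow> a * b \<in> monics"
  by (simp add: monics_def lead_coeff_mult)

lemma monics_prod: "(\<And>i. i \<in> I \<Longrightarrow> g i \<in> monics) \<Longrightarrow> (\<Prod>i\<in>I. g i) \<in> monics"
  by (induction I rule: infinite_finite_induct) (auto simp: one_in_monics monics_mult)

lemma monics_power: "a \<in> monics \<Longrightarrow> a ^ i \<in> monics"
  by (induction i) (auto simp: one_in_monics monics_mult)

lemma monic_primes_monic: "f \<in> monic_primes \<Longrightarrow> f \<in> monics"
  by (simp add: monic_primes_def monics_def)

lemma not_dvd_prod_primes: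
  assumes "finite S" "S \<subseteq> monic_primes" "f \<in> monic_primes" "f \<notin> S"
  shows "\<not> f dvd (\<Prod>g\<in>S. g ^ e g)"
  using assms
proof (induction S)
  case empty
  then show ?case using degree_monic_prime[of f] by (auto simp: is_unit_iff_degree)
next
  case (insert g S)
  show ?case
  proof
    assume "f dvd (\<Prod>g\<in>insert g S. g ^ e g)"
    then have "f dvd g ^ e g * (\<Prod>g\<in>S. g ^ e g)" using insert by simp
    then have "f dvd g ^ e g"
      using insert monic_primes_prime[of f] by (auto simp: prime_elem_dvd_mult_iff)
    then have "f dvd g" using monic_primes_prime[of f] insert.prems by (auto dest: prime_elem_dvd_power)
    then show False using monic_primes_dvd_eq[of f g] insert.prems by auto
  qed
qed

lemma prod_primes_inj:
  assumes S: "finite S" "S \<subseteq> monic_primes" and eq: "(\<Prod>g\<in>S. g ^ e g) = (\<Prod>g\<in>S. g ^ e' g)" and f: "f \<in> S"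
  shows "e f = e' f"
proof -
  have *: False if lt: "e f < e' f" and eq: "(\<Prod>g\<in>S. g ^ e g) = (\<Prod>g\<in>S. g ^ e' g)" for e e' :: "'a poly \<Rightarrow> nat"
  proof -
    have split: "(\<Prod>g\<in>S. g ^ e g) = f ^ e f * (\<Prod>g\<in>S - {f}. g ^ e g)" for e :: "'a poly \<Rightarrow> nat"
      using prod.remove[OF S(1) f] .
    have "f ^ e' f = f ^ e f * (f * f ^ (e' f - e f - 1))"
      using lt by (simp flip: power_Suc power_add)
    then have "f ^ e f * (\<Prod>g\<in>S - {f}. g ^ e g) = f ^ e f * (f * (f ^ (e' f - e f - 1) * (\<Prod>g\<in>S - {f}. g ^ e' g)))"
      using eq by (simp add: split mult.assoc)
    moreover have "f ^ e f \<noteq> 0" using S f degree_monic_prime[of f] by auto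
    ultimately have "(\<Prod>g\<in>S - {f}. g ^ e g) = f * (f ^ (e' f - e f - 1) * (\<Prod>g\<in>S - {f}. g ^ e' g))"
      by (simp only: mult_cancel_left) simp
    then have "f dvd (\<Prod>g\<in>S - {f}. g ^ e g)" by (rule dvdI)
    moreover have "\<not> f dvd (\<Prod>g\<in>S - {f}. g ^ e g)"
      by (rule not_dvd_prod_primes) (use S f in auto)
    ultimately show False by blast
  qed
  show ?thesis using *[OF _ eq] *[OF _ eq[symmetric]] by (meson linorder_neqE_nat)
qed

text \<open>\<open>S\<close> is prescribed and the exponents are bounded, so that \<open>a\<close>
  is located in the expansion of a product over \<open>S\<close> of truncated local series.\<close>

lemma monic_factorization:
  fixes a :: "'a::field poly"
  assumes "a \<in> monics" "finite S" "\<And>f. f \<in> monic_primes \<Longrightarrow> degree f \<le> degree a \<Longrightarrow> f \<in> S"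
  shows "\<exists>e. a = (\<Prod>f\<in>S. f ^ e f) \<and> (\<forall>f. e f \<le> degree a)"
  using assms(1,3)
proof (induction "degree a" arbitrary: a rule: less_induct)
  case (less a)
  show ?case
  proof (cases "degree a = 0")
    case True
    then have "a = 1" using less.prems(1) by (auto simp: monics_def elim!: degree_eq_zeroE)
    then have "a = (\<Prod>f\<in>S. f ^ 0) \<and> (\<forall>f :: 'a poly. 0 \<le> degree a)" by simp
    then show ?thesis by (intro exI[of _ "\<lambda>_. 0"])
  next
    case False
    then obtain f b where f: "Factorial_Ring.irreducible f" "a = f * b" "lead_coeff f = 1"
      using irreducible_monic_factor[of a] by auto
    then have fp: "f \<in> monic_primes" by (simp add: monic_primes_def)
    have b: "b \<in> monics" using less.prems(1) f by (simp add: monics_def lead_coeff_mult)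
    then have "f \<noteq> 0" "b \<noteq> 0" using f by (auto simp: monics_def)
    then have deg: "degree a = degree f + degree b" using f(2) by (simp add: degree_mult_eq)
    then have lt: "degree b < degree a" using degree_monic_prime[OF fp] by simp
    have "\<exists>e. b = (\<Prod>f\<in>S. f ^ e f) \<and> (\<forall>f. e f \<le> degree b)"
      using less.hyps[OF lt b] less.prems(2) lt by force
    then obtain e where e: "b = (\<Prod>f\<in>S. f ^ e f)" "\<And>f. e f \<le> degree b" by blast
    have fS: "f \<in> S" using less.prems(2)[OF fp] deg by simp
    define e' where "e' = e(f := Suc (e f))"
    have "(\<Prod>g\<in>S. g ^ e' g) = f ^ Suc (e f) * (\<Prod>g\<in>S - {f}. g ^ e g)"
      using prod.remove[OF assms(2) fS, of "\<lambda>g. g ^ e' g"] by (simp add: e'_def)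
    also have "\<dots> = f * (\<Prod>g\<in>S. g ^ e g)"
      using prod.remove[OF assms(2) fS, of "\<lambda>g. g ^ e g"] by (simp add: mult.assoc)
    finally have "a = (\<Prod>g\<in>S. g ^ e' g)" using f(2) e(1) by simp
    moreover have "e' g \<le> degree a" for g using e(2)[of g] lt by (auto simp: e'_def)
    ultimately show ?thesis by blast
  qed
qed

lemma coprime_mult_field_poly:
  fixes x y b :: "'b::field poly"
  assumes "coprime x b" "coprime y b"
  shows "coprime (x * y) b"
proof (rule coprimeI)
  fix g assume g: "g dvd x * y" "g dvd b"
  obtain u v u' v' where uv: "u * x + v * b = 1" "u' * y + v' * b = 1"
    using field_poly_coprime_bezout[OF assms(1)] field_poly_coprime_bezout[OF assms(2)] by metis
  have "1 = (u * x + v * b) * (u' * y + v' * b)" by (simp add: uv)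
  also have "\<dots> = (x * y) * (u * u') + b * (u * x * v' + v * u' * y + v * v' * b)" by (simp add: algebra_simps)
  finally show "is_unit g" using g by (metis dvd_add dvd_mult2)
qed

lemma coprime_prime_power_prod:
  assumes "finite S" "S \<subseteq> monic_primes" "f \<in> monic_primes" "f \<notin> S"
  shows "coprime (f ^ i) (\<Prod>g\<in>S. g ^ e g)"
proof (induction i)
  case (Suc i)
  have "coprime f (\<Prod>g\<in>S. g ^ e g)"
    using assms not_dvd_prod_primes[OF assms] by (intro field_poly_irreducible_coprime) (auto simp: monic_primes_def)
  then show ?case using Suc by (simp add: coprime_mult_field_poly)
qed simp

lemma multiplicative_prod_primes:
  fixes g :: "'a::field poly \<Rightarrow> 'r::comm_monoid_mult"
  assumes "g 1 = 1" "\<And>a b. a \<in> monics \<Longrightarrow> b \<in> monics \<Longrightarrow> coprime a b \<Longrightarrow> g (a * b) = g a * g b"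
    and "finite S" "S \<subseteq> monic_primes"
  shows "g (\<Prod>f\<in>S. f ^ e f) = (\<Prod>f\<in>S. g (f ^ e f))"
  using assms(3,4)
proof (induction S)
  case (insert f S)
  have "g (f ^ e f * (\<Prod>f\<in>S. f ^ e f)) = g (f ^ e f) * g (\<Prod>f\<in>S. f ^ e f)"
  proof (rule assms(2))
    show "f ^ e f \<in> monics" using insert by (auto intro: monics_power monic_primes_monic)
    show "(\<Prod>f\<in>S. f ^ e f) \<in> monics" by (rule monics_prod, rule monics_power, rule monic_primes_monic) (use insert in auto)
    show "coprime (f ^ e f) (\<Prod>f\<in>S. f ^ e f)" using insert by (intro coprime_prime_power_prod) auto
  qed
  then show ?case using insert by simp
qed (simp add: assms(1))

lemma finite_degree_less: "finite {a :: 'a::{field,finite} poly. degree a < n}"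
proof -
  have "{a :: 'a poly. degree a < n} \<subseteq> Poly ` {xs. set xs \<subseteq> UNIV \<and> length xs = n}"
  proof
    fix a :: "'a poly" assume "a \<in> {a. degree a < n}"
    then have "a = Poly (map (coeff a) [0..<n])"
      by (intro poly_eqI) (auto simp: nth_default_def coeff_eq_0)
    then show "a \<in> Poly ` {xs. set xs \<subseteq> UNIV \<and> length xs = n}" by (rule image_eqI) simp
  qed
  then show ?thesis
    by (rule finite_subset) (intro finite_imageI finite_lists_length_eq finite)
qed

text \<open>Valuation at least \<open>m / r\<close>: the factor \<open>r\<close> clears the
  denominator in the bound \<open>degree a / r\<close> for the term of \<open>a\<close>.\<close>

definition val_ge :: "nat \<Rightarrow> int \<Rightarrow> 'k::field fls \<Rightarrow> bool" where
  "val_ge r m x \<longleftrightarrow> x = 0 \<or> m \<le> int r * fls_subdegree x"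

lemma val_ge_0 [simp]: "val_ge r m 0"
  by (simp add: val_ge_def)

lemma val_ge_mono: "val_ge r m x \<Longrightarrow> m' \<le> m \<Longrightarrow> val_ge r m' x"
  by (auto simp: val_ge_def)

lemma val_ge_add:
  assumes "val_ge r m x" "val_ge r m y"
  shows "val_ge r m (x + y)"
proof (cases "x = 0 \<or> y = 0 \<or> x + y = 0")
  case False
  then have "min (fls_subdegree x) (fls_subdegree y) \<le> fls_subdegree (x + y)"
    by (intro fls_plus_subdegree) auto
  then have "int r * min (fls_subdegree x) (fls_subdegree y) \<le> int r * fls_subdegree (x + y)"
    by (intro mult_left_mono) auto
  then show ?thesis using assms False by (auto simp: val_ge_def min_def split: if_splits)
qed (use assms in auto)

lemma val_ge_uminus [simp]: "val_ge r m (- x) \<longleftrightarrow> val_ge r m x"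
  by (simp add: val_ge_def)

lemma val_ge_diff: "val_ge r m x \<Longrightarrow> val_ge r m y \<Longrightarrow> val_ge r m (x - y)"
  using val_ge_add[of r m x "- y"] by simp

lemma val_ge_sum: "(\<And>i. i \<in> I \<Longrightarrow> val_ge r m (g i)) \<Longrightarrow> val_ge r m (\<Sum>i\<in>I. g i)"
  by (induction I rule: infinite_finite_induct) (auto intro: val_ge_add)

lemma val_ge_mult: "val_ge r m x \<Longrightarrow> val_ge r m' y \<Longrightarrow> val_ge r (m + m') (x * y)"
  by (cases "x = 0"; cases "y = 0") (auto simp: val_ge_def distrib_left)

lemma val_ge_1 [simp]: "val_ge r 0 1"
  by (simp add: val_ge_def)

lemma val_ge_prod: "(\<And>i. i \<in> I \<Longrightarrow> val_ge r (m i) (g i)) \<Longrightarrow> val_ge r (\<Sum>i\<in>I. m i) (\<Prod>i\<in>I. g i)"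
  by (induction I rule: infinite_finite_induct) (auto intro: val_ge_mult)

lemma val_ge_prod_diff:
  assumes "finite I" "\<And>i. i \<in> I \<Longrightarrow> val_ge r 0 (g i)" "\<And>i. i \<in> I \<Longrightarrow> val_ge r m (g i - h i)" "m \<ge> 0"
  shows "val_ge r m ((\<Prod>i\<in>I. g i) - (\<Prod>i\<in>I. h i)) \<and> val_ge r 0 (\<Prod>i\<in>I. h i)"
  using assms(1-3)
proof (induction I)
  case (insert i I)
  have h: "val_ge r 0 (h i)"
    using val_ge_diff[OF insert.prems(1)[of i] val_ge_mono[OF insert.prems(2)[of i] assms(4)]] by simp
  have g: "val_ge r 0 (\<Prod>i\<in>I. g i)" using val_ge_prod[of I r "\<lambda>_. 0" g] insert by simp
  have "(\<Prod>i\<in>insert i I. g i) - (\<Prod>i\<in>insert i I. h i) =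
      (g i - h i) * (\<Prod>i\<in>I. g i) + h i * ((\<Prod>i\<in>I. g i) - (\<Prod>i\<in>I. h i))"
    using insert by (simp add: algebra_simps)
  moreover have "val_ge r (m + 0) ((g i - h i) * (\<Prod>i\<in>I. g i))"
    using insert g by (intro val_ge_mult) auto
  moreover have "val_ge r (0 + m) (h i * ((\<Prod>i\<in>I. g i) - (\<Prod>i\<in>I. h i)))"
    using insert h by (intro val_ge_mult) auto
  moreover have "val_ge r (0 + 0) (h i * (\<Prod>i\<in>I. h i))"
    using insert h by (intro val_ge_mult) auto
  ultimately show ?case using insert by (simp add: val_ge_add)
qed simp

lemma val_ge_nth: "val_ge r m x \<Longrightarrow> int r * l < m \<Longrightarrow> fls_nth x l = 0"
proof (rule ccontr)
  assume x: "val_ge r m x" "int r * l < m" and nz: "fls_nth x l \<noteq> 0"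
  then have "fls_subdegree x \<le> l" by (intro fls_subdegree_leI)
  then have "int r * fls_subdegree x \<le> int r * l" by (intro mult_left_mono) auto
  then show False using x nz by (auto simp: val_ge_def)
qed

lemma val_geI_nth:
  assumes "\<And>l. int r * l < m \<Longrightarrow> fls_nth x l = 0"
  shows "val_ge r m x"
proof (cases "x = 0")
  case False
  then have "fls_nth x (fls_subdegree x) \<noteq> 0" by simp
  then show ?thesis using assms[of "fls_subdegree x"] by (force simp: val_ge_def)
qed simp

lemma tendsto_fls_val_ge:
  fixes g :: "'b \<Rightarrow> 'k::field fls"
  assumes "r > 0" "\<And>m :: nat. eventually (\<lambda>x. val_ge r (int m) (g x - L)) F"
  shows "(g \<longlongrightarrow> L) F"
proof (rule tendstoI)
  fix e :: real assume "e > 0"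
  then obtain N where N: "(1/2) ^ N < e" using real_arch_pow_inv[of e "1/2"] by auto
  have "dist x L < e" if "val_ge r (int (r * N)) (x - L)" for x :: "'k fls"
  proof (cases "x = L")
    case False
    then have "int r * int N \<le> int r * fls_subdegree (x - L)" using that by (simp add: val_ge_def)
    then have N': "int N \<le> fls_subdegree (x - L)" using assms(1) by simp
    then have "dist x L = (1/2) ^ nat (fls_subdegree (x - L))"
      using False by (simp add: dist_fls_def power_one_over inverse_eq_divide)
    also have "\<dots> \<le> (1/2) ^ N" using N' by (intro power_decreasing) auto
    finally show ?thesis using N by simp
  qed (use \<open>e > 0\<close> in simp)
  then show "eventually (\<lambda>x. dist (g x) L < e) F"
    using assms(2)[of "r * N"] by (auto elim!: eventually_mono)
qed

text \<open>
  Modulo terms of large valuation, the partial product over a finite set of primes is a finite sum, in which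
  all \<open>a\<close> of small degree occur by unique factorization.
\<close>

theorem euler_product_fls:
  fixes t :: "'a::{field,finite} poly \<Rightarrow> 'k::field fls" and E :: "'a poly \<Rightarrow> 'k fls"
  assumes r: "r > 0"
    and t1: "t 1 = 1"
    and t_mult: "\<And>a b. a \<in> monics \<Longrightarrow> b \<in> monics \<Longrightarrow> coprime a b \<Longrightarrow> t (a * b) = t a * t b"
    and t_val: "\<And>a. a \<in> monics \<Longrightarrow> val_ge r (int (degree a)) (t a)"
    and E_val: "\<And>f. f \<in> monic_primes \<Longrightarrow> val_ge r 0 (E f)"
    and E: "\<And>f m. f \<in> monic_primes \<Longrightarrow> val_ge r (int m) (E f - (\<Sum>i\<le>m. t (f ^ i)))"
  shows "\<exists>L. ((\<lambda>S. \<Prod>f\<in>S. E f) \<longlongrightarrow> L) (finite_subsets_at_top monic_primes) \<and> (t has_sum L) monics"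
proof -
  define A where "A = (\<lambda>m. {a :: 'a poly. degree a < m} \<inter> monics)"
  have A: "finite (A m)" "A m \<subseteq> monics" for m
    using finite_degree_less[of m] by (auto simp: A_def)
  have tail: "val_ge r (int m) ((\<Sum>a\<in>U. t a) - (\<Sum>a\<in>A m. t a))" if U: "finite U" "A m \<subseteq> U" "U \<subseteq> monics" for U m
  proof -
    have "(\<Sum>a\<in>U. t a) - (\<Sum>a\<in>A m. t a) = (\<Sum>a\<in>U - A m. t a)"
      using U by (simp add: sum_diff)
    moreover have "val_ge r (int m) (\<Sum>a\<in>U - A m. t a)"
    proof (rule val_ge_sum)
      fix a assume "a \<in> U - A m"
      then have "a \<in> monics" "degree a \<ge> m" using U by (auto simp: A_def)
      then show "val_ge r (int m) (t a)" using val_ge_mono[OF t_val] by simp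
    qed
    ultimately show ?thesis by simp
  qed
  define s where "s = (\<lambda>m. \<Sum>a\<in>A m. t a)"
  have s_diff: "val_ge r (int m) (s m' - s m)" if "m \<le> m'" for m m'
    unfolding s_def by (rule tail) (use A that in \<open>auto simp: A_def\<close>)
  have s_0: "val_ge r 0 (s m)" for m using s_diff[of 0 m] by (simp add: s_def A_def)
  \<comment> \<open>By \<open>s_diff\<close>, the coefficient of index \<open>l\<close> no longer
    changes once \<open>m > r * l\<close>, so the limit is read off at \<open>Suc (r * l)\<close>;
    \<open>s_0\<close> excludes negative indices.\<close>
  define L where "L = fps_to_fls (Abs_fps (\<lambda>l. fls_nth (s (Suc (r * l))) (int l)))"
  have L: "val_ge r (int m) (s m - L)" for m
  proof (rule val_geI_nth)
    fix l assume l: "int r * l < int m"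
    show "fls_nth (s m - L) l = 0"
    proof (cases "l < 0")
      case True
      then have "fls_nth (s m) l = 0" using r by (intro val_ge_nth[OF s_0]) (simp add: mult_pos_neg)
      then show ?thesis using True by (simp add: L_def)
    next
      case False
      then obtain k where k: "l = int k" using nonneg_int_cases by (metis linorder_not_less)
      have "int (r * k) < int m" using l k by simp
      then have "Suc (r * k) \<le> m" by linarith
      then have "fls_nth (s m - s (Suc (r * k))) l = 0"
        by (intro val_ge_nth[OF s_diff]) (simp_all add: k)
      then show ?thesis using k by (simp add: L_def)
    qed
  qed
  have to_L: "val_ge r (int m) (x - L)" if "val_ge r (int m) (x - s m)" for x m
    using val_ge_add[OF that L[of m]] by simp
  have "(t has_sum L) monics"
    unfolding has_sum_def
  proof (rule tendsto_fls_val_ge[OF r])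
    fix m
    show "eventually (\<lambda>U. val_ge r (int m) (sum t U - L)) (finite_subsets_at_top monics)"
      unfolding eventually_finite_subsets_at_top
      by (intro exI[of _ "A m"]) (auto intro!: to_L tail simp: A s_def)
  qed
  moreover have "((\<lambda>S. \<Prod>f\<in>S. E f) \<longlongrightarrow> L) (finite_subsets_at_top monic_primes)"
  proof (rule tendsto_fls_val_ge[OF r])
    fix m
    define P where "P = {f :: 'a poly. degree f < m} \<inter> monic_primes"
    have "val_ge r (int m) ((\<Prod>f\<in>S. E f) - L)" if S: "finite S" "P \<subseteq> S" "S \<subseteq> monic_primes" for S
    proof -
      \<comment> \<open>The polynomials that occur in the expanded product. Exponents up to
        \<open>m\<close> suffice to reach every monic \<open>a\<close> of degree below
        \<open>m\<close>, as each exponent is at most \<open>degree a\<close>.\<close>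
      define U where "U = (\<lambda>e. \<Prod>f\<in>S. f ^ e f) ` (PiE S (\<lambda>_. {..m}))"
      have inj: "inj_on (\<lambda>e. \<Prod>f\<in>S. f ^ e f) (PiE S (\<lambda>_. {..m}))"
        by (rule inj_onI) (rule PiE_ext, auto intro: prod_primes_inj[OF S(1,3)])
      have "(\<Prod>f\<in>S. \<Sum>i\<le>m. t (f ^ i)) = (\<Sum>e\<in>PiE S (\<lambda>_. {..m}). \<Prod>f\<in>S. t (f ^ e f))"
        by (rule prod_sum_PiE) (use S in auto)
      also have "\<dots> = (\<Sum>e\<in>PiE S (\<lambda>_. {..m}). t (\<Prod>f\<in>S. f ^ e f))"
        by (simp add: multiplicative_prod_primes[OF t1 t_mult S(1,3)])
      also have "\<dots> = (\<Sum>a\<in>U. t a)"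
        unfolding U_def by (simp add: sum.reindex[OF inj])
      finally have prod: "(\<Prod>f\<in>S. \<Sum>i\<le>m. t (f ^ i)) = (\<Sum>a\<in>U. t a)" .
      have "finite U" unfolding U_def using S by (intro finite_imageI finite_PiE) auto
      moreover have "U \<subseteq> monics"
        unfolding U_def
        by (rule image_subsetI, rule monics_prod, rule monics_power, rule monic_primes_monic) (use S(3) in auto)
      moreover have "A m \<subseteq> U"
      proof
        fix a assume "a \<in> A m"
        then have a: "degree a < m" "a \<in> monics" by (auto simp: A_def)
        have "f \<in> S" if "f \<in> monic_primes" "degree f \<le> degree a" for f
          using that S(2) a(1) by (auto simp: P_def)
        then obtain e where e: "a = (\<Prod>f\<in>S. f ^ e f)" "\<And>f. e f \<le> degree a"
          using monic_factorization[OF a(2) S(1)] by blast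
        have "a = (\<Prod>f\<in>S. f ^ restrict e S f)" unfolding e(1) by (intro prod.cong) auto
        moreover have "restrict e S \<in> PiE S (\<lambda>_. {..m})"
          using e(2) a(1) by (auto intro: le_trans less_imp_le)
        ultimately show "a \<in> U" unfolding U_def by (rule image_eqI)
      qed
      ultimately have "val_ge r (int m) ((\<Sum>a\<in>U. t a) - s m)" unfolding s_def by (intro tail)
      then have "val_ge r (int m) ((\<Sum>a\<in>U. t a) - L)" by (rule to_L)
      moreover have "val_ge r (int m) ((\<Prod>f\<in>S. E f) - (\<Prod>f\<in>S. \<Sum>i\<le>m. t (f ^ i)))"
        using val_ge_prod_diff[OF S(1), of r E "int m" "\<lambda>f. \<Sum>i\<le>m. t (f ^ i)"] S(3) E E_val by auto
      ultimately have "val_ge r (int m) (((\<Prod>f\<in>S. E f) - (\<Sum>a\<in>U. t a)) + ((\<Sum>a\<in>U. t a) - L))"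
        unfolding prod by (intro val_ge_add)
      then show ?thesis by simp
    qed
    moreover have "finite P" "P \<subseteq> monic_primes" using finite_degree_less[of m] by (auto simp: P_def)
    ultimately show "eventually (\<lambda>S. val_ge r (int m) ((\<Prod>f\<in>S. E f) - L)) (finite_subsets_at_top monic_primes)"
      unfolding eventually_finite_subsets_at_top by blast
  qed
  ultimately show ?thesis by blast
qed

section \<open>Polynomials as Laurent series at infinity\<close>

lemma comm_ring_hom_fls_const: "comm_ring_hom (fls_const :: 'k::field \<Rightarrow> 'k fls)"
  by unfold_locales (auto simp: fls_plus_const fls_const_mult_const)

lemma at_infinity_sum: "at_infinity_fls a = (\<Sum>i\<le>degree a. fls_const (coeff a i) * fls_X_inv ^ i)"
proof -
  interpret C: comm_ring_hom "fls_const :: 'a \<Rightarrow> 'a fls" by (rule comm_ring_hom_fls_const)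
  have "degree (map_poly fls_const a) = degree a"
    by (rule degree_map_poly) simp
  then show ?thesis by (simp add: at_infinity_fls_def poly_altdef coeff_map_poly)
qed

lemma comm_ring_hom_at_infinity: "comm_ring_hom (at_infinity_fls :: 'k::field poly \<Rightarrow> 'k fls)"
proof -
  interpret C: comm_ring_hom "fls_const :: 'k \<Rightarrow> 'k fls" by (rule comm_ring_hom_fls_const)
  interpret M: map_poly_comm_ring_hom "fls_const :: 'k \<Rightarrow> 'k fls" ..
  show ?thesis
    by unfold_locales (simp_all add: at_infinity_fls_def M.hom_add M.hom_mult)
qed

lemma at_infinity_const: "at_infinity_fls [:c:] = fls_const c"
  by (simp add: at_infinity_sum)

lemma nth_at_infinity: "fls_nth (at_infinity_fls a) l = (if l \<le> 0 then coeff a (nat (- l)) else 0)"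
proof -
  have "fls_nth (at_infinity_fls a) l = (\<Sum>i\<le>degree a. if l = - int i then coeff a i else 0)"
    by (simp add: at_infinity_sum fls_nth_sum fls_mult_const_nth if_distrib cong: if_cong)
  also have "\<dots> = (\<Sum>i\<le>degree a. if i = nat (- l) then (if l \<le> 0 then coeff a i else 0) else 0)"
    by (intro sum.cong) auto
  also have "\<dots> = (if l \<le> 0 then coeff a (nat (- l)) else 0)"
    by (auto simp: coeff_eq_0)
  finally show ?thesis .
qed

lemma subdegree_at_infinity: "a \<noteq> 0 \<Longrightarrow> fls_subdegree (at_infinity_fls a) = - int (degree a)"
  by (rule fls_subdegree_eqI) (auto simp: nth_at_infinity coeff_eq_0)

lemma at_infinity_eq_0_iff [simp]: "at_infinity_fls a = 0 \<longleftrightarrow> a = 0"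
proof
  assume "at_infinity_fls a = 0"
  then have "fls_nth (at_infinity_fls a) (- int (degree a)) = 0" by simp
  then show "a = 0" by (simp add: nth_at_infinity)
qed (simp add: at_infinity_sum)

lemma val_ge_inverse_one_plus:
  assumes "r > 0" "val_ge r 1 y"
  shows "1 + y \<noteq> 0" "val_ge r 0 (inverse (1 + y))"
proof -
  have "fls_nth y l = 0" if "l \<le> 0" for l
    by (rule val_ge_nth[OF assms(2)]) (use that mult_nonneg_nonpos[of "int r" l] in simp)
  then have sub: "fls_subdegree (1 + y) = 0" and nz: "fls_nth (1 + y) 0 \<noteq> 0"
    by (auto intro!: fls_subdegree_eqI)
  show "1 + y \<noteq> 0" by (metis nz fls_zero_nth)
  then show "val_ge r 0 (inverse (1 + y))" using sub by (simp add: val_ge_def)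
qed

lemma coeff_local_poly_0: "coeff (local_poly \<phi> f) 0 = 1"
  by (auto simp: local_poly_def Let_def coeff_sum)

section \<open>Valuations of the Euler factors and of the terms of the sum\<close>

context rff begin

abbreviation at_inf :: "'a poly \<Rightarrow> 'k fls" where
  "at_inf a \<equiv> at_infinity_fls (map_poly \<iota> a)"

definition euler_term :: "('a poly \<Rightarrow> 'a poly) \<Rightarrow> 'a poly \<Rightarrow> 'k fls" where
  "euler_term \<mu> a = at_inf (\<mu> a) * fls_const (eval_prod a) / at_inf a"

definition local_euler_factor :: "('k poly \<Rightarrow> 'k poly poly) \<Rightarrow> 'a poly \<Rightarrow> 'k fls" where
  "local_euler_factor \<Phi> f = at_infinity_fls (quot_char (map_poly \<iota> f)) /
     at_infinity_fls (tw_quot_char (theta_frob CARD('a)) \<Phi> (map_poly \<iota> f))"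

context
  fixes \<phi> :: "'a poly \<Rightarrow> 'a poly poly" and \<Phi> :: "'k poly \<Rightarrow> 'k poly poly" and r :: nat and \<mu> :: "'a poly \<Rightarrow> 'a poly"
  assumes drinfeld: "drinfeld_module r \<phi>" and assoc: "associated_module \<iota> n z r \<phi> \<Phi>" and mu: "is_mu \<phi> \<mu>"
begin

interpretation I: comm_ring_hom "at_infinity_fls :: 'k poly \<Rightarrow> 'k fls"
  by (rule comm_ring_hom_at_infinity)

interpretation C: comm_ring_hom "fls_const :: 'k \<Rightarrow> 'k fls"
  by (rule comm_ring_hom_fls_const)

lemma euler_term_1: "euler_term \<mu> 1 = 1"
  using mu by (simp add: euler_term_def is_mu_def eval_prod_def)

lemma euler_term_mult:
  "a \<in> monics \<Longrightarrow> b \<in> monics \<Longrightarrow> coprime a b \<Longrightarrow> euler_term \<mu> (a * b) = euler_term \<mu> a * euler_term \<mu> b"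
  using mu by (simp add: euler_term_def is_mu_def base.hom_mult I.hom_mult eval_prod_mult C.hom_mult
      del: fls_const_mult_const)

context
  fixes f :: "'a poly"
  assumes f: "f \<in> monic_primes"
begin

text \<open>The point at which \<open>D_f\<close> is evaluated; \<open>delta i\<close> is the term
  of degree \<open>i\<close> of \<open>D_f\<close> at this point.\<close>

definition fu :: "'k fls" where
  "fu = fls_const (eval_prod f) / at_inf f"

definition delta :: "nat \<Rightarrow> 'k fls" where
  "delta i = at_inf (coeff (local_poly \<phi> f) i) * fu ^ i"

lemma euler_term_power: "euler_term \<mu> (f ^ i) = at_inf (\<mu> (f ^ i)) * fu ^ i"
proof -
  have "eval_prod (f ^ i) = eval_prod f ^ i"
    by (simp add: eval_prod_def base.hom_power poly_power prod_power_distrib)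
  then show ?thesis
    by (simp add: euler_term_def fu_def base.hom_power I.hom_power C.hom_power power_divide)
qed

lemma convolution: "(\<Sum>i\<le>l. euler_term \<mu> (f ^ i) * delta (l - i)) = (if l = 0 then 1 else 0)"
proof -
  have "Abs_fps (\<lambda>i. \<mu> (f ^ i)) * fps_of_poly (local_poly \<phi> f) = 1"
    using mu f by (simp add: is_mu_def)
  from arg_cong[OF this, of "\<lambda>s. fps_nth s l"]
  have "(\<Sum>i=0..l. \<mu> (f ^ i) * coeff (local_poly \<phi> f) (l - i)) = (if l = 0 then 1 else 0)"
    by (simp add: fps_mult_nth)
  then have eq: "at_inf (\<Sum>i\<le>l. \<mu> (f ^ i) * coeff (local_poly \<phi> f) (l - i)) = at_inf (if l = 0 then 1 else 0)"
    by (simp only: atLeast0AtMost)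
  have "(\<Sum>i\<le>l. euler_term \<mu> (f ^ i) * delta (l - i)) =
      (\<Sum>i\<le>l. at_inf (\<mu> (f ^ i) * coeff (local_poly \<phi> f) (l - i)) * fu ^ l)"
  proof (intro sum.cong refl)
    fix i assume "i \<in> {..l}"
    then have "fu ^ l = fu ^ i * fu ^ (l - i)" by (simp flip: power_add)
    then show "euler_term \<mu> (f ^ i) * delta (l - i) = at_inf (\<mu> (f ^ i) * coeff (local_poly \<phi> f) (l - i)) * fu ^ l"
      by (simp add: euler_term_power delta_def base.hom_mult I.hom_mult mult_ac)
  qed
  also have "\<dots> = at_inf (\<Sum>i\<le>l. \<mu> (f ^ i) * coeff (local_poly \<phi> f) (l - i)) * fu ^ l"
    by (simp add: sum_distrib_right base.hom_sum I.hom_sum)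
  also have "\<dots> = (if l = 0 then 1 else 0)" unfolding eq by simp
  finally show ?thesis .
qed

text \<open>From \<open>f * D_i = Q_i * f ^ i\<close>, where \<open>D_i\<close> and
  \<open>Q_i\<close> are the coefficients, a nonzero \<open>delta i\<close> has valuation
  \<open>degree f - degree Q_i\<close>; the weight bound on \<open>Q\<close> says that
  \<open>r\<close> times this is at least \<open>degree f * i\<close>.\<close>

lemma val_ge_delta: "val_ge r (int (degree f * i)) (delta i)"
proof (cases "coeff (local_poly \<phi> f) i = 0 \<or> eval_prod f = 0 \<and> i > 0")
  case True
  then show ?thesis by (auto simp: delta_def fu_def zero_power)
next
  case False
  let ?D = "coeff (local_poly \<phi> f) i"
  obtain Q where Q: "f * ?D = coeff Q i * f ^ i" "coeff Q i \<noteq> 0 \<Longrightarrow> r * degree (coeff Q i) + degree f * i \<le> degree f * r"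
    using local_factor[OF f drinfeld assoc] by metis
  have Qi: "coeff Q i \<noteq> 0" using Q(1) False monic_prime_nz[OF f] by auto
  have "degree (f * ?D) = degree f + degree ?D" using False monic_prime_nz[OF f] by (intro degree_mult_eq) auto
  moreover have "degree (coeff Q i * f ^ i) = degree (coeff Q i) + degree f * i"
    using Qi monic_prime_nz[OF f] by (simp add: degree_mult_eq degree_power_eq)
  ultimately have deg: "degree f + degree ?D = degree (coeff Q i) + degree f * i" using Q(1) by simp
  have "fls_subdegree fu = int (degree f)" if "i > 0"
    using False that monic_prime_nz[OF f] by (simp add: fu_def fls_divide_subdegree subdegree_at_infinity)
  then have "fls_subdegree (fu ^ i) = int (degree f * i)"
    by (cases "i > 0") (auto simp: fls_subdegree_pow)
  moreover have "fu \<noteq> 0 \<or> i = 0" using False monic_prime_nz[OF f] by (auto simp: fu_def)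
  ultimately have "fls_subdegree (delta i) = int (degree f * i) - int (degree ?D)"
    using False by (auto simp: delta_def subdegree_at_infinity)
  moreover have "int (degree f * i) \<le> int r * (int (degree f * i) - int (degree ?D))"
  proof -
    have "r * (degree f + degree ?D) + degree f * i = r * degree (coeff Q i) + degree f * i + r * (degree f * i)"
      unfolding deg by (simp add: algebra_simps)
    also have "\<dots> \<le> degree f * r + r * (degree f * i)" using Q(2)[OF Qi] by simp
    finally have "r * degree ?D + degree f * i \<le> r * (degree f * i)" by (simp add: algebra_simps)
    then have "int (r * degree ?D + degree f * i) \<le> int (r * (degree f * i))" by (simp only: of_nat_le_iff)
    then show ?thesis by (simp add: algebra_simps)
  qed
  ultimately show ?thesis by (simp add: val_ge_def)
qed

lemma delta_0: "delta 0 = 1"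
  by (simp add: delta_def coeff_local_poly_0)

text \<open>Since \<open>delta 0 = 1\<close>, the convolution identity expresses each term through
  earlier ones, and the bounds for the factors add up.\<close>

lemma val_ge_euler_term_power: "val_ge r (int (degree f * i)) (euler_term \<mu> (f ^ i))"
proof (induction i rule: less_induct)
  case (less i)
  show ?case
  proof (cases "i = 0")
    case False
    have "{..i} = insert i {..<i}" by auto
    then have "euler_term \<mu> (f ^ i) = - (\<Sum>j<i. euler_term \<mu> (f ^ j) * delta (i - j))"
      using convolution[of i] False by (simp add: delta_0 eq_neg_iff_add_eq_0)
    moreover have "val_ge r (int (degree f * i)) (\<Sum>j<i. euler_term \<mu> (f ^ j) * delta (i - j))"
    proof (rule val_ge_sum)
      fix j assume j: "j \<in> {..<i}"
      have "degree f * i = degree f * j + degree f * (i - j)"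
        using j by (simp flip: add_mult_distrib2)
      then have eq: "int (degree f * i) = int (degree f * j) + int (degree f * (i - j))"
        by (simp only: of_nat_add)
      then show "val_ge r (int (degree f * i)) (euler_term \<mu> (f ^ j) * delta (i - j))"
        unfolding eq using less j by (intro val_ge_mult val_ge_delta) blast
    qed
    ultimately show ?thesis by simp
  qed (simp add: euler_term_1)
qed

text \<open>The denominator of the local factor is \<open>f\<close> times \<open>D_f\<close> at
  \<open>fu\<close>, and the numerator is \<open>f\<close>. \<open>D_f\<close> is a polynomial, so
  all long partial sums agree; \<open>J\<close> stays free in order to exceed a given truncation
  order later.\<close>

lemma local_euler_factor_eq:
  "\<exists>M. \<forall>J\<ge>M. local_euler_factor \<Phi> f = inverse (\<Sum>i\<le>J. delta i)"
proof -
  obtain Q where Q: "tw_quot_char (theta_frob CARD('a)) \<Phi> (map_poly \<iota> f) = poly (map_poly (map_poly \<iota>) Q) [:eval_prod f:]"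
    "\<And>i. f * coeff (local_poly \<phi> f) i = coeff Q i * f ^ i"
    using local_factor[OF f drinfeld assoc] by metis
  have "local_euler_factor \<Phi> f = inverse (\<Sum>i\<le>J. delta i)" if J: "J \<ge> degree Q" for J
  proof -
    have "poly (map_poly (map_poly \<iota>) Q) [:eval_prod f:] = (\<Sum>i\<le>J. map_poly \<iota> (coeff Q i) * [:eval_prod f:] ^ i)"
    proof -
      have "poly (map_poly (map_poly \<iota>) Q) [:eval_prod f:] =
          (\<Sum>i\<le>degree (map_poly (map_poly \<iota>) Q). map_poly \<iota> (coeff Q i) * [:eval_prod f:] ^ i)"
        by (simp only: poly_altdef coeff_map_poly base.hom_zero)
      also have "\<dots> = (\<Sum>i\<le>J. map_poly \<iota> (coeff Q i) * [:eval_prod f:] ^ i)"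
      proof (rule sum.mono_neutral_left)
        show "{..degree (map_poly (map_poly \<iota>) Q)} \<subseteq> {..J}"
          using J degree_map_poly_le[of "map_poly \<iota>" Q] by auto
        show "\<forall>i\<in>{..J} - {..degree (map_poly (map_poly \<iota>) Q)}. map_poly \<iota> (coeff Q i) * [:eval_prod f:] ^ i = 0"
        proof
          fix i assume "i \<in> {..J} - {..degree (map_poly (map_poly \<iota>) Q)}"
          then have "coeff (map_poly (map_poly \<iota>) Q) i = 0" by (intro coeff_eq_0) simp
          then have "map_poly \<iota> (coeff Q i) = 0" by (simp only: coeff_map_poly base.hom_zero)
          then show "map_poly \<iota> (coeff Q i) * [:eval_prod f:] ^ i = 0" by simp
        qed
      qed simp
      finally show ?thesis .
    qed
    then have "at_infinity_fls (tw_quot_char (theta_frob CARD('a)) \<Phi> (map_poly \<iota> f)) =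
        (\<Sum>i\<le>J. at_inf (coeff Q i) * fls_const (eval_prod f) ^ i)"
      by (simp add: Q(1) I.hom_sum I.hom_mult I.hom_power at_infinity_const)
    also have "\<dots> = (\<Sum>i\<le>J. at_inf f * delta i)"
    proof (intro sum.cong refl)
      fix i
      have "at_inf f * delta i = at_inf (coeff Q i * f ^ i) * fu ^ i"
        by (simp add: delta_def base.hom_mult I.hom_mult flip: Q(2) mult.assoc)
      also have "\<dots> = at_inf (coeff Q i) * (at_inf f * fu) ^ i"
        by (simp add: base.hom_mult I.hom_mult base.hom_power I.hom_power power_mult_distrib mult.assoc)
      also have "at_inf f * fu = fls_const (eval_prod f)" using monic_prime_nz[OF f] by (simp add: fu_def)
      finally show "at_inf (coeff Q i) * fls_const (eval_prod f) ^ i = at_inf f * delta i" ..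
    qed
    finally have "at_infinity_fls (tw_quot_char (theta_frob CARD('a)) \<Phi> (map_poly \<iota> f)) = at_inf f * (\<Sum>i\<le>J. delta i)"
      by (simp add: sum_distrib_left)
    then show ?thesis
      using monic_prime_nz[OF f] by (simp add: local_euler_factor_def quot_char_eq[OF f] divide_inverse)
  qed
  then show ?thesis by blast
qed

lemma sum_delta:
  assumes "J > 0"
  shows "(\<Sum>i\<le>J. delta i) \<noteq> 0" "val_ge r 0 (inverse (\<Sum>i\<le>J. delta i))"
proof -
  have r: "r > 0" using drinfeld by (simp add: drinfeld_module_def)
  have "{..J} = insert 0 {1..J}" by auto
  then have "(\<Sum>i\<le>J. delta i) = 1 + (\<Sum>i\<in>{1..J}. delta i)" by (simp add: delta_0)
  moreover have "val_ge r 1 (\<Sum>i\<in>{1..J}. delta i)"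
  proof (rule val_ge_sum)
    fix i assume "i \<in> {1..J}"
    then have "1 \<le> degree f * i" using degree_monic_prime[OF f] by (simp add: Suc_le_eq)
    then have "(1::int) \<le> int (degree f * i)" by linarith
    then show "val_ge r 1 (delta i)" by (rule val_ge_mono[OF val_ge_delta])
  qed
  ultimately show "(\<Sum>i\<le>J. delta i) \<noteq> 0" "val_ge r 0 (inverse (\<Sum>i\<le>J. delta i))"
    using val_ge_inverse_one_plus[OF r] by simp_all
qed

lemma val_ge_local_euler_factor: "val_ge r 0 (local_euler_factor \<Phi> f)"
proof -
  obtain M where "\<And>J. J \<ge> M \<Longrightarrow> local_euler_factor \<Phi> f = inverse (\<Sum>i\<le>J. delta i)"
    using local_euler_factor_eq by blast
  from this[of "Suc M"] show ?thesis using sum_delta(2)[of "Suc M"] by simp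
qed

text \<open>The truncated series times \<open>D_f\<close> at \<open>fu\<close> is 1 plus terms with
  \<open>i + j > m\<close>. These have large valuation, and dividing by the value of
  \<open>D_f\<close>, whose inverse has nonnegative valuation, keeps it large.\<close>

lemma local_euler_factor_approx:
  "val_ge r (int m) (local_euler_factor \<Phi> f - (\<Sum>i\<le>m. euler_term \<mu> (f ^ i)))"
proof -
  obtain M where M: "\<And>J. J \<ge> M \<Longrightarrow> local_euler_factor \<Phi> f = inverse (\<Sum>i\<le>J. delta i)"
    using local_euler_factor_eq by blast
  \<comment> \<open>\<open>J \<ge> m\<close> places the triangle \<open>?T\<close> inside the box
    \<open>?B\<close>, and \<open>J \<ge> M\<close> makes the partial sum exact.\<close>
  define J where "J = Suc (max M m)"
  let ?B = "{..m} \<times> {..J}" and ?T = "{(i, j). i + j \<le> m}"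
  let ?s = "\<Sum>i\<le>m. euler_term \<mu> (f ^ i)" and ?D = "\<Sum>i\<le>J. delta i"
  have D: "?D \<noteq> 0" "val_ge r 0 (inverse ?D)" using sum_delta[of J] by (simp_all add: J_def)
  have "?s * ?D = (\<Sum>(i, j)\<in>?B. euler_term \<mu> (f ^ i) * delta j)"
    by (simp add: sum_product sum.cartesian_product)
  also have "\<dots> = (\<Sum>(i, j)\<in>?B - ?T. euler_term \<mu> (f ^ i) * delta j) + (\<Sum>(i, j)\<in>?T. euler_term \<mu> (f ^ i) * delta j)"
    by (rule sum.subset_diff) (auto simp: J_def)
  also have "(\<Sum>(i, j)\<in>?T. euler_term \<mu> (f ^ i) * delta j) = (\<Sum>l\<le>m. \<Sum>i\<le>l. euler_term \<mu> (f ^ i) * delta (l - i))"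
    by (rule sum.triangle_reindex_eq)
  also have "\<dots> = (\<Sum>l\<le>m. if l = 0 then 1 else 0)" by (simp only: convolution)
  also have "\<dots> = 1" by simp
  finally have eq: "?s * ?D = (\<Sum>(i, j)\<in>?B - ?T. euler_term \<mu> (f ^ i) * delta j) + 1" .
  have rest: "val_ge r (int m) (\<Sum>(i, j)\<in>?B - ?T. euler_term \<mu> (f ^ i) * delta j)"
  proof (rule val_ge_sum)
    fix x assume "x \<in> ?B - ?T"
    then obtain i j where x: "x = (i, j)" and "\<not> i + j \<le> m" by auto
    then have "m \<le> i + j" by simp
    also have "\<dots> \<le> degree f * (i + j)" using degree_monic_prime[OF f] by simp
    finally have "int m \<le> int (degree f * i + degree f * j)"
      by (simp only: of_nat_le_iff add_mult_distrib2)
    then have "int m \<le> int (degree f * i) + int (degree f * j)" by (simp only: of_nat_add)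
    then show "val_ge r (int m) (case x of (i, j) \<Rightarrow> euler_term \<mu> (f ^ i) * delta j)"
      unfolding x split by (intro val_ge_mono[OF val_ge_mult[OF val_ge_euler_term_power val_ge_delta]])
  qed
  have "local_euler_factor \<Phi> f - ?s = - (inverse ?D * (\<Sum>(i, j)\<in>?B - ?T. euler_term \<mu> (f ^ i) * delta j))"
    using D(1) M[of J] eq by (simp add: J_def field_simps)
  moreover have "val_ge r (0 + int m) (inverse ?D * (\<Sum>(i, j)\<in>?B - ?T. euler_term \<mu> (f ^ i) * delta j))"
    by (rule val_ge_mult[OF D(2) rest])
  ultimately show ?thesis by simp
qed

end

lemma val_ge_euler_term:
  assumes a: "a \<in> monics"
  shows "val_ge r (int (degree a)) (euler_term \<mu> a)"
proof -
  define S where "S = {f :: 'a poly. degree f < Suc (degree a)} \<inter> monic_primes"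
  have S: "finite S" "S \<subseteq> monic_primes" using finite_degree_less[of "Suc (degree a)"] by (auto simp: S_def)
  obtain e where e: "a = (\<Prod>f\<in>S. f ^ e f)"
    using monic_factorization[OF a S(1)] by (auto simp: S_def)
  have "euler_term \<mu> a = (\<Prod>f\<in>S. euler_term \<mu> (f ^ e f))"
    unfolding e by (rule multiplicative_prod_primes[OF euler_term_1 euler_term_mult S])
  moreover have "val_ge r (\<Sum>f\<in>S. int (degree f * e f)) (\<Prod>f\<in>S. euler_term \<mu> (f ^ e f))"
    by (rule val_ge_prod) (use S val_ge_euler_term_power in auto)
  moreover have "degree a = (\<Sum>f\<in>S. degree f * e f)"
  proof -
    have nz: "f \<noteq> 0" if "f \<in> S" for f using that S(2) degree_monic_prime[of f] by auto
    have "degree a = (\<Sum>f\<in>S. degree (f ^ e f))"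
      unfolding e by (rule degree_prod_eq_sum_degree) (use nz in auto)
    also have "\<dots> = (\<Sum>f\<in>S. degree f * e f)"
      by (intro sum.cong) (auto simp: degree_power_eq nz)
    finally show ?thesis .
  qed
  ultimately show ?thesis by simp
qed

lemma euler_product:
  "\<exists>L. ((\<lambda>S. \<Prod>f\<in>S. local_euler_factor \<Phi> f) \<longlongrightarrow> L) (finite_subsets_at_top monic_primes) \<and>
     (euler_term \<mu> has_sum L) monics"
proof (rule euler_product_fls)
  show "r > 0" using drinfeld by (simp add: drinfeld_module_def)
qed (auto intro: euler_term_1 euler_term_mult val_ge_euler_term val_ge_local_euler_factor local_euler_factor_approx)

end

end

theorem theorem3p3:
  fixes \<phi> :: "'a::{field,finite} poly \<Rightarrow> 'a poly poly"
    and \<iota> :: "'a \<Rightarrow> 'k::field"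
    and z :: "nat \<Rightarrow> 'k"
    and \<Phi> :: "'k poly \<Rightarrow> 'k poly poly"
    and \<mu> :: "'a poly \<Rightarrow> 'a poly"
    and r n :: nat
  assumes "drinfeld_module r \<phi>"
    and "rational_function_field n \<iota> z"
    and "associated_module \<iota> n z r \<phi> \<Phi>"
    and "is_mu \<phi> \<mu>"
  shows "\<exists>L :: 'k fls.
    ((\<lambda>S. \<Prod>f\<in>S. at_infinity_fls (quot_char (map_poly \<iota> f)) /
            at_infinity_fls (tw_quot_char (theta_frob CARD('a)) \<Phi> (map_poly \<iota> f))) \<longlongrightarrow> L)
      (finite_subsets_at_top monic_primes) \<and>
    ((\<lambda>a. at_infinity_fls (map_poly \<iota> (\<mu> a)) *
            fls_const (\<Prod>k=1..n. poly (map_poly \<iota> a) (z k)) /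
            at_infinity_fls (map_poly \<iota> a)) has_sum L) monics"
proof -
  have "field_hom \<iota>" using assms(2) by (simp add: rational_function_field_def)
  then interpret rff \<iota> n z using assms(2) by (simp add: rff_def rff_axioms_def)
  show ?thesis
    using euler_product[OF assms(1,3,4)]
    unfolding local_euler_factor_def[abs_def] euler_term_def[abs_def] eval_prod_def .
qed

end
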